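(* Assume the following. (i) $f$ is continuous on $\mathbb{R}^{d+1}$, $g$ is continuous on $\mathbb{R}^d$, $g$ satisfies a Lipschitz condition, and $g(x)>0$ for all $x\in S$. (ii) There exists $D\ge 0$ such that, as soon as $\mathrm{dist}(\mathbf{i},\mathbf{j})>D$, the pairs $(X_{\mathbf{i}},X_{\mathbf{j}})$ and $((X_{\mathbf{i}},Y_{\mathbf{i}}),(X_{\mathbf{j}},Y_{\mathbf{j}}))$ admit densities $g_{\mathbf{i},\mathbf{j}}$ and $f_{\mathbf{i},\mathbf{j}}$; moreover, for some constant $c\ge 0$, $|f_{\mathbf{i},\mathbf{j}}(s,t)-f(s)f(t)|\le c$ for all $s,t\in\mathbb{R}^{d+1}$ and $|g_{\mathbf{i},\mathbf{j}}(u,v)-g(u)g(v)|\le c$ for all $u,v\in\mathbb{R}^d$. (iii) For $0\le i+j\le 2$ and $1\le l\le d$, the partial derivative $\frac{\partial^{i+j}f}{\partial x_l^i\partial y^j}$ exists, is bounded and integrable; and $F(y|x)$ has continuous second partial derivatives with respect to $x$. (iv) $F(y|x)$ has a continuous second derivative with respect to $y$. (v) $K$ is an integrable, symmetric, Lipschitz density function on $\mathbb{R}^d$ with compact support, and $\int_{\mathbb{R}^d}\|s\|^2K(s)\,ds<\infty$. (vi) $w$ is a symmetric Lipschitz density function on $\mathbb{R}$ with compact support. (vii) $\lim_{\mathbf{n}\to\infty}\widehat{\mathbf{n}}h^{d+2}(\log\widehat{\mathbf{n}})^{-1}=0$. (viii) At least one of the following holds: (a) $\phi(n,m)\le C\min(n,m)$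 for all $n,m\in\mathbb{N}$ and some $C>0$, and $\widehat{\mathbf{n}}h^{\theta_1}(\log\widehat{\mathbf{n}})^{\theta_2}(u(\mathbf{n}))^{-2N/(\beta-N(d+5))}\to\infty$ as $\mathbf{n}\to\infty$; (b) $\phi(n,m)\le C(n+m+1)^{\kappa}$ for all $n,m\in\mathbb{N}$ and some $\kappa\ge1$, $C>0$, and $\widehat{\mathbf{n}}h^{\theta_3}(\log\widehat{\mathbf{n}})^{\theta_4}(u(\mathbf{n}))^{-2N/(\beta-N(d+4+2\kappa))}\to\infty$ as $\mathbf{n}\to\infty$. Then $$\sup_{y\in\mathcal{V}}\sup_{x\in S}|F_{\mathbf{n}}(y|x)-F(y|x)|=O(\Omega_{\mathbf{n}})\quad\text{almost surely as }\mathbf{n}\to\infty.$$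
   Context: Let $d,N\ge1$ be integers and $\mathbb{N}^*=\{1,2,\dots\}$. $(X,Y)$ is a pair of random variables with values in $\mathbb{R}^d\times\mathbb{R}$, with joint density $f(x,y)$; $X$ has marginal density $g$; $F(\cdot|x)$ is the conditional distribution function of $Y$ given $X=x$, with density $f(\cdot|x)$. For fixed $p\in\,]0,1[$, $\mu_p(x)$ is the conditional quantile of order $p$, a solution $y$ of $F(y|x)=p$. $((X_{\mathbf{i}},Y_{\mathbf{i}}))_{\mathbf{i}\in(\mathbb{N}^* )^N}$ is a strictly stationary random field, each $(X_{\mathbf{i}},Y_{\mathbf{i}})$ having the law of $(X,Y)$. For $\mathbf{n}=(n_1,\dots,n_N)\in(\mathbb{N}^* )^N$: $\mathcal{I}_{\mathbf{n}}=\{\mathbf{i}=(i_1,\dots,i_N)\in(\mathbb{N}^* )^N:1\le i_k\le n_k,\ k=1,\dots,N\}$, $\widehat{\mathbf{n}}=n_1\cdots n_N$, and $\mathbf{n}\to\infty$ means $\min_k n_k\to\infty$. The bandwidth $h=h(\mathbf{n})>0$ satisfies $h\to0$ as $\mathbf{n}\to\infty$; $K$ and $w$ are probability densities on $\mathbb{R}^d$ and $\mathbb{R}$. Estimators: $g_{\mathbf{n}}(x)=\frac{1}{\widehat{\mathbf{n}}h^d}\sum_{\mathbf{i}\in\mathcal{I}_{\mathbf{n}}}K\left(\frac{x-X_{\mathbf{i}}}{h}\right)$, $\psi_{\mathbf{n}}(x,y)=\frac{1}{\widehat{\mathbf{n}}h^{d+1}}\sum_{\mathbf{i}\in\mathcal{I}_{\mathbf{n}}}K\left(\frac{x-X_{\mathbf{i}}}{h}\right)\int_{-\infty}^{y}w\left(\frac{z-Y_{\mathbf{i}}}{h}\right)dz$,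 and $F_{\mathbf{n}}(y|x)=\frac{\psi_{\mathbf{n}}(x,y)}{g_{\mathbf{n}}(x)}\mathbf{1}_{\{g_{\mathbf{n}}(x)\neq0\}}$. Mixing: there are a function $\chi:\mathbb{R}^+\to\mathbb{R}^+$ with $\chi(t)\downarrow0$ as $t\to\infty$ and a symmetric positive function $\phi:\mathbb{N}^2\to\mathbb{R}^+$, nondecreasing in each variable, such that for all finite $E,E'\subset(\mathbb{N}^* )^N$, $\sup\{|P(A\cap B)-P(A)P(B)|:A\in\mathcal{B}(E),B\in\mathcal{B}(E')\}\le\phi(\mathrm{Card}\,E,\mathrm{Card}\,E')\,\chi(\mathrm{dist}(E,E'))$, where $\mathcal{B}(E)$ is the $\sigma$-field generated by $(X_{\mathbf{i}},Y_{\mathbf{i}})_{\mathbf{i}\in E}$ and $\mathrm{dist}$ is Euclidean distance; moreover $\chi(i)=O(i^{-\beta})$ for some $\beta>0$. $S\subset\mathbb{R}^d$ is a fixed compact set. With $a=\inf\{y:F(y|x)>0\}$ and $b=\sup\{y:F(y|x)<1\}$, $\mathcal{V}\subseteq[a,b]$ is a fixed compact neighborhood of the quantile $\mu_p(x)$. $\Omega_{\mathbf{n}}=\sqrt{\log\widehat{\mathbf{n}}/(\widehat{\mathbf{n}}h^d)}$; $u(\mathbf{n})=\prod_{i=1}^N(\log n_i)(\log\log n_i)^{1+\varepsilon}$ for an arbitrary small fixed $\varepsilon>0$; $\theta_1=\frac{N(d+1)(d+2)+(d+1)\beta}{\beta-N(d+5)}$, $\theta_2=\frac{N(d+2)-\beta}{\beta-N(d+5)}$,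 $\theta_3=\frac{N(d^2+4d+2)+(d+1)\beta}{\beta-N(d+4+2\kappa)}$, $\theta_4=\frac{N(d+1)-\beta}{\beta-N(d+4+2\kappa)}$. "$A_{\mathbf{n}}=O(\Omega_{\mathbf{n}})$ almost surely" means that almost surely $\limsup_{\mathbf{n}\to\infty}|A_{\mathbf{n}}|/\Omega_{\mathbf{n}}<\infty$.
   Formalization: In (viii) the denominators β−N(d+5) in (a) and β−N(d+4+2κ) in (b) are required to be positive; at zero the exponents are undefined, and for negative values the growth condition is vacuous and the claim fails for slowly mixing fields. *)

theory Defs
  imports "HOL-Probability.Probability" "HOL-Library.Landau_Symbols"
begin

text \<open>
  The random fields below are functions on all of \<^typ>\<open>nat ^ 'n\<close>, but only their values at
  indices with positive components matter.
\<close>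

definition lattice_point :: "nat ^ 'n::finite \<Rightarrow> real ^ 'n" where
  "lattice_point i = (\<chi> k. real (i $ k))"

definition pos_index :: "(nat ^ 'n::finite) set" where
  "pos_index = {i. \<forall>k. 1 \<le> i $ k}"

definition rect :: "nat ^ 'n::finite \<Rightarrow> (nat ^ 'n) set" where
  "rect n = {i. \<forall>k. 1 \<le> i $ k \<and> i $ k \<le> n $ k}"

definition nhat :: "nat ^ 'n::finite \<Rightarrow> real" where
  "nhat n = (\<Prod>k\<in>UNIV. real (n $ k))"

definition multi_at_top :: "(nat ^ 'n::finite) filter" where
  "multi_at_top = filtercomap (\<lambda>n. MIN k\<in>UNIV. n $ k) at_top"

definition partial :: "'v::real_normed_vector \<Rightarrow> ('v \<Rightarrow> real) \<Rightarrow> 'v \<Rightarrow> real" where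
  "partial v F z = deriv (\<lambda>t. F (z + t *\<^sub>R v)) 0"

definition has_partial_on :: "'v::real_normed_vector set \<Rightarrow> 'v \<Rightarrow> ('v \<Rightarrow> real) \<Rightarrow> bool" where
  "has_partial_on U v F \<longleftrightarrow> (\<forall>z\<in>U. (\<lambda>t. F (z + t *\<^sub>R v)) field_differentiable at 0)"

definition has_iter_partial :: "'v::real_normed_vector \<Rightarrow> nat \<Rightarrow> ('v \<Rightarrow> real) \<Rightarrow> bool" where
  "has_iter_partial v m F \<longleftrightarrow> (\<forall>k<m. has_partial_on UNIV v ((partial v ^^ k) F))"

definition dir_x :: "'d::finite \<Rightarrow> (real ^ 'd) \<times> real" where
  "dir_x l = (axis l 1, 0)"

definition dir_y :: "(real ^ 'd::finite) \<times> real" where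
  "dir_y = (0, 1)"

definition prob_density :: "('v::euclidean_space \<Rightarrow> real) \<Rightarrow> bool" where
  "prob_density k \<longleftrightarrow> (\<forall>s. 0 \<le> k s) \<and> integrable lborel k \<and> (LINT s|lborel. k s) = 1"

definition compact_support :: "('v::euclidean_space \<Rightarrow> real) \<Rightarrow> bool" where
  "compact_support k \<longleftrightarrow> compact (closure {s. k s \<noteq> 0})"

definition lipschitz_fun :: "('v::metric_space \<Rightarrow> real) \<Rightarrow> bool" where
  "lipschitz_fun k \<longleftrightarrow> (\<exists>L. L-lipschitz_on UNIV k)"

definition marginal_density :: "((real ^ 'd::finite) \<times> real \<Rightarrow> real) \<Rightarrow> real ^ 'd \<Rightarrow> real" where
  "marginal_density f x = (LINT y|lborel. f (x, y))"

text \<open>The two conditional quantities below are only meaningful where the marginal density is positive.\<close>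

definition cond_density :: "((real ^ 'd::finite) \<times> real \<Rightarrow> real) \<Rightarrow> real \<Rightarrow> real ^ 'd \<Rightarrow> real" where
  "cond_density f y x = f (x, y) / marginal_density f x"

definition cond_cdf :: "((real ^ 'd::finite) \<times> real \<Rightarrow> real) \<Rightarrow> real \<Rightarrow> real ^ 'd \<Rightarrow> real" where
  "cond_cdf f y x = (LINT z:{..y}|lborel. cond_density f z x)"

text \<open>The end points of the conditional distribution may be infinite.\<close>

definition lower_end :: "((real ^ 'd::finite) \<times> real \<Rightarrow> real) \<Rightarrow> real ^ 'd \<Rightarrow> ereal" where
  "lower_end f x = (INF y\<in>{y. cond_cdf f y x > 0}. ereal y)"

definition upper_end :: "((real ^ 'd::finite) \<times> real \<Rightarrow> real) \<Rightarrow> real ^ 'd \<Rightarrow> ereal" where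
  "upper_end f x = (SUP y\<in>{y. cond_cdf f y x < 1}. ereal y)"

definition strictly_stationary ::
    "'a measure \<Rightarrow> (nat ^ 'n::finite \<Rightarrow> 'a \<Rightarrow> 'b::topological_space) \<Rightarrow> bool" where
  "strictly_stationary M Z \<longleftrightarrow>
     (\<forall>E j. finite E \<and> E \<subseteq> pos_index \<longrightarrow>
        distr M (Pi\<^sub>M E (\<lambda>_. borel)) (\<lambda>\<omega>. \<lambda>i\<in>E. Z (i + j) \<omega>) =
        distr M (Pi\<^sub>M E (\<lambda>_. borel)) (\<lambda>\<omega>. \<lambda>i\<in>E. Z i \<omega>))"

definition gen_events ::
    "'a measure \<Rightarrow> (nat ^ 'n::finite \<Rightarrow> 'a \<Rightarrow> 'b::topological_space) \<Rightarrow> (nat ^ 'n) set \<Rightarrow> 'a set set" where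
  "gen_events M Z E =
     sigma_sets (space M) (\<Union>i\<in>E. {Z i -` B \<inter> space M |B. B \<in> sets borel})"

definition mixing_field ::
    "'a measure \<Rightarrow> (nat ^ 'n::finite \<Rightarrow> 'a \<Rightarrow> 'b::topological_space) \<Rightarrow>
      (nat \<Rightarrow> nat \<Rightarrow> real) \<Rightarrow> (real \<Rightarrow> real) \<Rightarrow> bool" where
  "mixing_field M Z \<phi> chi \<longleftrightarrow>
     (\<forall>E E'. finite E \<and> finite E' \<and> E \<subseteq> pos_index \<and> E' \<subseteq> pos_index \<longrightarrow>
        (\<forall>A\<in>gen_events M Z E. \<forall>B\<in>gen_events M Z E'.
           \<bar>measure M (A \<inter> B) - measure M A * measure M B\<bar>
             \<le> \<phi> (card E) (card E') * chi (setdist (lattice_point ` E) (lattice_point ` E'))))"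

definition g_est ::
    "(real ^ 'd::finite \<Rightarrow> real) \<Rightarrow> (nat ^ 'n::finite \<Rightarrow> real) \<Rightarrow> (nat ^ 'n \<Rightarrow> 'a \<Rightarrow> real ^ 'd) \<Rightarrow>
      nat ^ 'n \<Rightarrow> 'a \<Rightarrow> real ^ 'd \<Rightarrow> real" where
  "g_est K h X n \<omega> x =
     1 / (nhat n * h n ^ CARD('d)) * (\<Sum>i\<in>rect n. K ((x - X i \<omega>) /\<^sub>R h n))"

definition psi_est ::
    "(real ^ 'd::finite \<Rightarrow> real) \<Rightarrow> (real \<Rightarrow> real) \<Rightarrow> (nat ^ 'n::finite \<Rightarrow> real) \<Rightarrow>
      (nat ^ 'n \<Rightarrow> 'a \<Rightarrow> real ^ 'd) \<Rightarrow> (nat ^ 'n \<Rightarrow> 'a \<Rightarrow> real) \<Rightarrow>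
      nat ^ 'n \<Rightarrow> 'a \<Rightarrow> real ^ 'd \<Rightarrow> real \<Rightarrow> real" where
  "psi_est K w h X Y n \<omega> x y =
     1 / (nhat n * h n ^ (CARD('d) + 1)) *
       (\<Sum>i\<in>rect n. K ((x - X i \<omega>) /\<^sub>R h n) *
          (LINT z:{..y}|lborel. w ((z - Y i \<omega>) / h n)))"

definition F_est ::
    "(real ^ 'd::finite \<Rightarrow> real) \<Rightarrow> (real \<Rightarrow> real) \<Rightarrow> (nat ^ 'n::finite \<Rightarrow> real) \<Rightarrow>
      (nat ^ 'n \<Rightarrow> 'a \<Rightarrow> real ^ 'd) \<Rightarrow> (nat ^ 'n \<Rightarrow> 'a \<Rightarrow> real) \<Rightarrow>
      nat ^ 'n \<Rightarrow> 'a \<Rightarrow> real \<Rightarrow> real ^ 'd \<Rightarrow> real" where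
  "F_est K w h X Y n \<omega> y x =
     (if g_est K h X n \<omega> x \<noteq> 0 then psi_est K w h X Y n \<omega> x y / g_est K h X n \<omega> x else 0)"

definition Omega :: "nat \<Rightarrow> (nat ^ 'n::finite \<Rightarrow> real) \<Rightarrow> nat ^ 'n \<Rightarrow> real" where
  "Omega d h n = sqrt (ln (nhat n) / (nhat n * h n ^ d))"

definition u_fun :: "real \<Rightarrow> nat ^ 'n::finite \<Rightarrow> real" where
  "u_fun \<epsilon> n = (\<Prod>k\<in>UNIV. ln (real (n $ k)) * ln (ln (real (n $ k))) powr (1 + \<epsilon>))"

definition theta1 :: "real \<Rightarrow> real \<Rightarrow> real \<Rightarrow> real" where
  "theta1 N d \<beta> = (N * (d + 1) * (d + 2) + (d + 1) * \<beta>) / (\<beta> - N * (d + 5))"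

definition theta2 :: "real \<Rightarrow> real \<Rightarrow> real \<Rightarrow> real" where
  "theta2 N d \<beta> = (N * (d + 2) - \<beta>) / (\<beta> - N * (d + 5))"

definition theta3 :: "real \<Rightarrow> real \<Rightarrow> real \<Rightarrow> real \<Rightarrow> real" where
  "theta3 N d \<beta> \<kappa> =
     (N * (d\<^sup>2 + 4 * d + 2) + (d + 1) * \<beta>) / (\<beta> - N * (d + 4 + 2 * \<kappa>))"

definition theta4 :: "real \<Rightarrow> real \<Rightarrow> real \<Rightarrow> real \<Rightarrow> real" where
  "theta4 N d \<beta> \<kappa> = (N * (d + 1) - \<beta>) / (\<beta> - N * (d + 4 + 2 * \<kappa>))"

text \<open>
  In both alternatives below the common denominator of the exponents is required to be positive.
  The growth condition is meant as a lower bound on the bandwidth; with a negative denominator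
  it would hold for practically every bandwidth and the mixing rate would no longer matter.
\<close>

definition bandwidth_cond_a ::
    "nat \<Rightarrow> (nat \<Rightarrow> nat \<Rightarrow> real) \<Rightarrow> real \<Rightarrow> real \<Rightarrow> (nat ^ 'n::finite \<Rightarrow> real) \<Rightarrow> bool" where
  "bandwidth_cond_a d \<phi> \<beta> \<epsilon> h \<longleftrightarrow>
     (let N = real CARD('n); \<delta> = \<beta> - N * (real d + 5) in
       (\<exists>C>0. \<forall>n m. \<phi> n m \<le> C * real (min n m)) \<and> \<delta> > 0 \<and>
       filterlim (\<lambda>n. nhat n * h n powr theta1 N (real d) \<beta>
            * ln (nhat n) powr theta2 N (real d) \<beta>
            * u_fun \<epsilon> n powr (- (2 * N / \<delta>)))
         at_top multi_at_top)"

definition bandwidth_cond_b ::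
    "nat \<Rightarrow> (nat \<Rightarrow> nat \<Rightarrow> real) \<Rightarrow> real \<Rightarrow> real \<Rightarrow> (nat ^ 'n::finite \<Rightarrow> real) \<Rightarrow> bool" where
  "bandwidth_cond_b d \<phi> \<beta> \<epsilon> h \<longleftrightarrow>
     (\<exists>\<kappa>\<ge>1. let N = real CARD('n); \<delta> = \<beta> - N * (real d + 4 + 2 * \<kappa>) in
       (\<exists>C>0. \<forall>n m. \<phi> n m \<le> C * real (n + m + 1) powr \<kappa>) \<and> \<delta> > 0 \<and>
       filterlim (\<lambda>n. nhat n * h n powr theta3 N (real d) \<beta> \<kappa>
            * ln (nhat n) powr theta4 N (real d) \<beta> \<kappa>
            * u_fun \<epsilon> n powr (- (2 * N / \<delta>)))
         at_top multi_at_top)"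

end

theory Submission
  imports Defs "HOL-Real_Asymp.Real_Asymp"
begin

text \<open>
  The estimator is a ratio of two kernel sums, and its error at \<open>(x, y)\<close> is that of
  \<open>\<Sum> K\<^sub>i (W\<^sub>i - F(y|x))\<close> divided by \<open>\<Sum> K\<^sub>i\<close>, where \<open>K\<^sub>i = K((x - X\<^sub>i)/h)\<close> and \<open>W\<^sub>i\<close> is the smoothed
  indicator of \<open>Y\<^sub>i \<le> y\<close>. The numerator consists of two centred sums and of a bias.

  \<^bold>\<open>Bias.\<close> The upper condition on the bandwidth says that \<open>h\<^sup>2 = o(\<Omega>\<^sup>2)\<close>, so a bias of order \<open>h\<close> is
  good enough, and for that it suffices that \<open>F\<close> is Lipschitz in \<open>(x, y)\<close> near \<open>S \<times> V\<close>
  (\<open>cond_cdf_lipschitz_near_compact\<close>). In the direction of \<open>y\<close> this holds because \<open>f\<close> is bounded.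
  In the directions of \<open>x\<close> the second partial derivatives are locally bounded and \<open>F\<close> takes values
  in \<open>[0, 1]\<close>, so Landau's interpolation inequality bounds the first ones. As \<open>W\<^sub>i\<close> lies between the
  indicators of \<open>Y\<^sub>i \<le> y - R h\<close> and \<open>Y\<^sub>i \<le> y + R h\<close>, the bias is controlled by the oscillation of
  \<open>F\<close> over distances of order \<open>h\<close> (\<open>smoothed_cdf_bias\<close>).

  \<^bold>\<open>Centred sums.\<close> The index box is cut into cubes of side \<open>p \<sim> \<Omega>\<^bsup>-1/N\<^esup>\<close>, which fall into \<open>2\<^sup>N\<close>
  parity classes; two cubes of one class are at distance at least \<open>p\<close>. The cubes of a class are
  decoupled one by one in the truncated Laplace transform \<open>E min 1 (c e\<^bsup>\<lambda>S\<^esup>)\<close>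
  (\<open>decoupling_step\<close>). Because the truncated function stays below 1, each decoupling costs only
  the mixing coefficient times the number of values of one rounded cube sum; this replaces the
  coupling of dependent by independent blocks. The result is Bernstein's inequality up to a term
  of order \<open>n\<^sup>2 \<Phi> \<chi>(p)\<close> (\<open>prob_field_sum_ge_le\<close>), with \<open>n\<close> the number of sites and \<open>\<Phi>\<close> a bound for the
  growth of \<open>\<phi>\<close>. The variance in it is of the order known from independent sites
  (\<open>local_covariance_sum_le\<close>): for distant sites the joint densities bound a covariance by
  \<open>C h\<^bsup>2d\<^esup>\<close>, mixing bounds it by \<open>C dist\<^bsup>-\<beta>\<^esup>\<close>, and the geometric mean \<open>C h\<^sup>d dist\<^bsup>-\<beta>/2\<^esup>\<close> is summable.

  \<^bold>\<open>Uniformity.\<close> A grid of mesh \<open>h \<Omega>\<close> in \<open>S \<times> V\<close> has \<open>O((h \<Omega>)\<^bsup>-(d+1)\<^esup>)\<close> points. Between a point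
  and its neighbour on the grid the kernel sums change by at most \<open>C \<Omega>\<close> times the number of \<open>X\<^sub>i\<close> in a
  ball of radius of order \<open>h\<close>, and these counts are controlled on the grid by the same exponential
  inequality. The growth conditions on the bandwidth are what makes the resulting probabilities
  at most \<open>C / (n u(n))\<close> (\<open>bandwidth_consequences\<close>, an inequality between logarithms). This
  bound factorises over the coordinates of the multi-index, and the tail sums of its factors tend
  to 0, which gives an almost sure statement along all multi-indices whose least component tends
  to infinity (\<open>borel_cantelli_multi_index\<close>).
\<close>

section \<open>Decoupling a sum of weakly dependent variables\<close>

text \<open>
  A variable \<open>Z\<close> with values in \<open>[0, 1]\<close> is the integral over \<open>u\<close> of the indicators of \<open>u < Z\<close>. By
  Fubini its covariance with \<open>W\<close> is therefore an average of covariances with events.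
\<close>

lemma (in prob_space) covariance_bound_from_superlevel_sets:
  fixes W Z :: "'a \<Rightarrow> real"
  assumes [measurable]: "random_variable borel W" "random_variable borel Z"
    and W: "\<And>x. x \<in> space M \<Longrightarrow> \<bar>W x\<bar> \<le> 1"
    and Z: "\<And>x. x \<in> space M \<Longrightarrow> 0 \<le> Z x \<and> Z x \<le> 1"
    and level: "\<And>u. \<bar>expectation (\<lambda>x. W x * indicator {x \<in> space M. u < Z x} x)
        - expectation W * prob {x \<in> space M. u < Z x}\<bar> \<le> a"
  shows "\<bar>expectation (\<lambda>x. W x * Z x) - expectation W * expectation Z\<bar> \<le> a"
proof -
  define N where "N = restrict_space lborel {0..1::real}"
  interpret N: prob_space N
    by (rule prob_spaceI) (simp add: N_def space_restrict_space emeasure_restrict_space)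
  interpret P: pair_prob_space M N ..
  have [measurable]: "(\<lambda>u::real. u) \<in> borel_measurable N"
    unfolding N_def by (intro measurable_restrict_space1) simp
  let ?I = "\<lambda>x u. indicator {..<Z x} u :: real"
  have Zu: "(LINT u|N. ?I x u) = Z x" if "x \<in> space M" for x
  proof -
    have "(LINT u|N. ?I x u) = measure N ({..<Z x} \<inter> space N)"
      by (simp add: Int_commute)
    also have "{..<Z x} \<inter> space N = {0..<Z x}"
      using Z[OF that] by (auto simp: N_def space_restrict_space)
    also have "measure N {0..<Z x} = measure lborel {0..<Z x}"
      unfolding N_def using Z[OF that] by (subst measure_restrict_space) auto
    also have "\<dots> = Z x" using Z[OF that] by simp
    finally show ?thesis .
  qed
  have I_ind: "?I x u = indicator {x \<in> space M. u < Z x} x" if "x \<in> space M" for x u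
    using that by (auto simp: indicator_def)
  have fub: "expectation (\<lambda>x. V x * Z x) = (LINT u|N. expectation (\<lambda>x. V x * indicator {x \<in> space M. u < Z x} x))"
    if [measurable]: "random_variable borel V" and V: "\<And>x. x \<in> space M \<Longrightarrow> \<bar>V x\<bar> \<le> 1" for V :: "'a \<Rightarrow> real"
  proof -
    have int: "integrable (M \<Otimes>\<^sub>M N) (\<lambda>(x, u). V x * ?I x u)"
    proof (rule P.integrable_const_bound[where B=1])
      show "AE z in M \<Otimes>\<^sub>M N. norm (case z of (x, u) \<Rightarrow> V x * ?I x u) \<le> 1"
        using V by (auto simp: space_pair_measure indicator_def)
      have "(\<lambda>z. if snd z < Z (fst z) then V (fst z) else 0) \<in> borel_measurable (M \<Otimes>\<^sub>M N)"
        by measurable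
      then show "(\<lambda>(x, u). V x * ?I x u) \<in> borel_measurable (M \<Otimes>\<^sub>M N)"
        by (rule measurable_cong[THEN iffD1, rotated]) (auto simp: indicator_def)
    qed
    have "expectation (\<lambda>x. V x * Z x) = expectation (\<lambda>x. LINT u|N. V x * ?I x u)"
      by (intro Bochner_Integration.integral_cong)
        (simp_all only: integral_mult_right_zero Zu)
    also have "\<dots> = (LINT u|N. expectation (\<lambda>x. V x * ?I x u))"
      using P.Fubini_integral[OF int] by simp
    also have "\<dots> = (LINT u|N. expectation (\<lambda>x. V x * indicator {x \<in> space M. u < Z x} x))"
      by (intro Bochner_Integration.integral_cong) (simp_all add: I_ind)
    finally show ?thesis .
  qed
  have meas: "(\<lambda>u. expectation (\<lambda>x. V x * indicator {x \<in> space M. u < Z x} x)) \<in> borel_measurable N"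
    if [measurable]: "random_variable borel V" for V :: "'a \<Rightarrow> real"
  proof -
    have "(\<lambda>u. expectation (\<lambda>x. if u < Z x then V x else 0)) \<in> borel_measurable N"
      by measurable
    then show ?thesis
      by (rule measurable_cong[THEN iffD1, rotated])
        (auto simp: indicator_def intro!: Bochner_Integration.integral_cong)
  qed
  let ?A = "\<lambda>u. expectation (\<lambda>x. W x * indicator {x \<in> space M. u < Z x} x)"
  let ?B = "\<lambda>u. expectation (\<lambda>x. 1 * indicat_real {x \<in> space M. u < Z x} x)"
  have bd: "\<bar>expectation (\<lambda>x. V x * indicator {x \<in> space M. u < Z x} x)\<bar> \<le> 1"
    if [measurable]: "random_variable borel V" and V: "\<And>x. x \<in> space M \<Longrightarrow> \<bar>V x\<bar> \<le> 1" for u and V :: "'a \<Rightarrow> real"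
  proof -
    have "\<bar>expectation (\<lambda>x. V x * indicator {x \<in> space M. u < Z x} x)\<bar>
        \<le> expectation (\<lambda>x. \<bar>V x * indicator {x \<in> space M. u < Z x} x\<bar>)"
      by (rule integral_abs_bound)
    also have "\<dots> \<le> expectation (\<lambda>_. 1)"
    proof (rule integral_mono)
      show "integrable M (\<lambda>x. \<bar>V x * indicator {x \<in> space M. u < Z x} x\<bar>)"
        by (rule integrable_const_bound[where B=1]) (use V in \<open>auto simp: indicator_def\<close>)
    qed (use V in \<open>auto simp: indicator_def\<close>)
    finally show ?thesis by (simp add: prob_space)
  qed
  have iA: "integrable N ?A" by (rule N.integrable_const_bound[where B=1]) (use bd[of W] W meas[of W] in auto)
  have iB: "integrable N ?B"
    by (rule N.integrable_const_bound[where B=1]) (use bd[of "\<lambda>_. 1"] meas[of "\<lambda>_. 1"] in auto)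
  have lev: "\<bar>?A u - expectation W * ?B u\<bar> \<le> a" for u
  proof -
    have "{x \<in> space M. u < Z x} \<in> events" by measurable
    then have "?B u = prob {x \<in> space M. u < Z x}" by simp
    then show ?thesis using level[of u] by simp
  qed
  have Z1: "expectation Z = (LINT u|N. ?B u)"
    using fub[of "\<lambda>_. 1"] by simp
  have W1: "expectation (\<lambda>x. W x * Z x) = (LINT u|N. ?A u)"
    by (rule fub) (use W in auto)
  have "expectation (\<lambda>x. W x * Z x) - expectation W * expectation Z
      = (LINT u|N. ?A u - expectation W * ?B u)"
    using iA iB W1 Z1 by simp
  also have "\<bar>\<dots>\<bar> \<le> (LINT u|N. \<bar>?A u - expectation W * ?B u\<bar>)"
    by (rule integral_abs_bound)
  also have "\<dots> \<le> (LINT u|N. a)"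
    by (rule integral_mono) (use iA iB lev in auto)
  finally show ?thesis by (simp add: N.prob_space)
qed

text \<open>
  The step that replaces coupling. The variable \<open>U\<close> is rounded up to a grid of mesh \<open>q\<close>. On each of the
  at most \<open>2 b / q + 2\<close> events on which the rounded value is constant, the integrand depends on \<open>S\<close>
  alone and lies in \<open>[0, 1]\<close>, so that passing to independent variables costs one mixing error \<open>a\<close>.
  Without the truncation by 1 this error would be multiplied by \<open>exp (lam * S)\<close>. Concavity of
  \<open>min 1\<close> reassembles the grid values into the Laplace transform of \<open>U\<close>.
\<close>

lemma (in prob_space) decoupling_step:
  fixes S U :: "'a \<Rightarrow> real"
  assumes [measurable]: "random_variable borel S" "random_variable borel U"
    and U: "\<And>x. x \<in> space M \<Longrightarrow> \<bar>U x\<bar> \<le> b"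
    and lam: "0 \<le> lam" and q: "0 < q" and c: "0 \<le> c"
    and mix: "\<And>J J'. J \<in> sets borel \<Longrightarrow> J' \<in> sets borel \<Longrightarrow>
      \<bar>prob {x \<in> space M. S x \<in> J \<and> U x \<in> J'} - prob {x \<in> space M. S x \<in> J} * prob {x \<in> space M. U x \<in> J'}\<bar> \<le> a"
  shows "expectation (\<lambda>x. min 1 (c * exp (lam * (S x + U x))))
    \<le> expectation (\<lambda>x. min 1 (c * (exp (lam * q) * expectation (\<lambda>x. exp (lam * U x))) * exp (lam * S x)))
      + (2 * b / q + 2) * a"
proof -
  obtain x0 where x0: "x0 \<in> space M" using not_empty by auto
  have b: "0 \<le> b" using U[OF x0] by auto
  have a: "0 \<le> a" using mix[of UNIV UNIV] by auto
  define K where "K = {\<lfloor>- b / q\<rfloor>..\<lfloor>b / q\<rfloor>}"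
  have finK: "finite K" by (simp add: K_def)
  have UK: "\<lfloor>U x / q\<rfloor> \<in> K" if "x \<in> space M" for x
  proof -
    have "- b / q \<le> U x / q" "U x / q \<le> b / q"
      using U[OF that] q by (intro divide_right_mono; simp)+
    then show ?thesis unfolding K_def by (auto intro!: floor_mono)
  qed
  define B where "B k = {x \<in> space M. \<lfloor>U x / q\<rfloor> = k}" for k
  have [measurable]: "B k \<in> events" for k unfolding B_def by measurable
  have cardK: "real (card K) \<le> 2 * b / q + 2"
  proof -
    have "\<lfloor>- b / q\<rfloor> \<le> \<lfloor>b / q\<rfloor>" using b q by (intro floor_mono divide_right_mono) auto
    then have "real (card K) = real_of_int \<lfloor>b / q\<rfloor> + 1 - real_of_int \<lfloor>- b / q\<rfloor>"
      by (simp add: K_def)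
    also have "\<dots> \<le> 2 * b / q + 2" by (simp add: field_simps) linarith
    finally show ?thesis .
  qed
  define Z where "Z k x = min 1 (c * exp (lam * (S x + (real_of_int k + 1) * q)))" for k x
  have [measurable]: "random_variable borel (Z k)" for k unfolding Z_def by measurable
  have Z01: "0 \<le> Z k x" "Z k x \<le> 1" for k x using c by (auto simp: Z_def)
  have intZ [simp]: "integrable M (Z k)" for k
    by (rule integrable_const_bound[where B=1]) (use Z01 in auto)
  have intB [simp]: "integrable M (\<lambda>x. indicator (B k) x :: real)" for k
    by (rule integrable_const_bound[where B=1]) (auto simp: indicator_def)
  have intBZ [simp]: "integrable M (\<lambda>x. indicator (B k) x * Z k x)" for k
    by (rule integrable_const_bound[where B=1]) (use Z01 in \<open>auto simp: indicator_def\<close>)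
  have floorU: "U x \<le> (real_of_int \<lfloor>U x / q\<rfloor> + 1) * q" "(real_of_int \<lfloor>U x / q\<rfloor> + 1) * q \<le> U x + q" for x
  proof -
    have "U x / q \<le> real_of_int \<lfloor>U x / q\<rfloor> + 1" by linarith
    then show "U x \<le> (real_of_int \<lfloor>U x / q\<rfloor> + 1) * q" using q by (simp only: pos_divide_le_eq)
    have "real_of_int \<lfloor>U x / q\<rfloor> \<le> U x / q" by linarith
    then show "(real_of_int \<lfloor>U x / q\<rfloor> + 1) * q \<le> U x + q" using q by (simp only: pos_le_divide_eq distrib_right)
  qed
  have sumB: "(\<Sum>k\<in>K. indicator (B k) x * t k) = t \<lfloor>U x / q\<rfloor>" if "x \<in> space M" for x and t :: "int \<Rightarrow> real"
  proof -
    have "(\<Sum>k\<in>K. indicator (B k) x * t k) = (\<Sum>k\<in>K. if \<lfloor>U x / q\<rfloor> = k then t k else 0)"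
      using that by (intro sum.cong) (auto simp: B_def indicator_def)
    then show ?thesis using UK[OF that] finK by simp
  qed
  (* On B k the rounded value of U is (k + 1) q, so Z k depends on S only. *)
  have cov: "expectation (\<lambda>x. indicator (B k) x * Z k x) \<le> prob (B k) * expectation (Z k) + a" for k
  proof -
    have "\<bar>expectation (\<lambda>x. indicator (B k) x * Z k x) - expectation (indicator (B k)) * expectation (Z k)\<bar> \<le> a"
    proof (rule covariance_bound_from_superlevel_sets)
      fix u
      let ?J = "{s. u < min 1 (c * exp (lam * (s + (real_of_int k + 1) * q)))}"
      let ?J' = "{s. \<lfloor>s / q\<rfloor> = k}"
      have J: "?J \<in> sets borel" by measurable
      have J': "?J' \<in> sets borel" by measurable
      have 1: "{x \<in> space M. S x \<in> ?J \<and> U x \<in> ?J'} = B k \<inter> {x \<in> space M. u < Z k x}"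
        "{x \<in> space M. S x \<in> ?J} = {x \<in> space M. u < Z k x}" "{x \<in> space M. U x \<in> ?J'} = B k"
        by (auto simp: B_def Z_def)
      have "{x \<in> space M. u < Z k x} \<in> events" by measurable
      then have "expectation (\<lambda>x. indicator (B k) x * indicator {x \<in> space M. u < Z k x} x)
         = prob (B k \<inter> {x \<in> space M. u < Z k x})"
        by (subst indicator_inter_arith[symmetric]) simp
      then show "\<bar>expectation (\<lambda>x. indicator (B k) x * indicator {x \<in> space M. u < Z k x} x) -
           expectation (indicator (B k)) * prob {x \<in> space M. u < Z k x}\<bar> \<le> a"
        using mix[OF J J'] unfolding 1 by (simp add: mult.commute)
    qed (use Z01 in \<open>auto simp: indicator_def\<close>)
    then show ?thesis by simp
  qed
  have sumP: "(\<Sum>k\<in>K. prob (B k)) = 1"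
  proof -
    have "(\<Sum>k\<in>K. prob (B k)) = expectation (\<lambda>x. \<Sum>k\<in>K. indicator (B k) x * 1)"
      by (subst Bochner_Integration.integral_sum) auto
    also have "\<dots> = expectation (\<lambda>_. 1)"
      by (intro Bochner_Integration.integral_cong) (auto simp del: mult_1_right simp: sumB)
    finally show ?thesis by (simp add: prob_space)
  qed
  define m where "m = exp (lam * q) * expectation (\<lambda>x. exp (lam * U x))"
  have intE: "integrable M (\<lambda>x. exp (lam * U x))"
    by (rule integrable_const_bound[where B="exp (lam * b)"])
      (use U lam in \<open>force intro!: AE_I2 mult_left_mono\<close>, measurable)
  have summ: "(\<Sum>k\<in>K. prob (B k) * exp (lam * ((real_of_int k + 1) * q))) \<le> m"
  proof -
    have "(\<Sum>k\<in>K. prob (B k) * exp (lam * ((real_of_int k + 1) * q)))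
       = expectation (\<lambda>x. \<Sum>k\<in>K. indicator (B k) x * exp (lam * ((real_of_int k + 1) * q)))"
      by (subst Bochner_Integration.integral_sum) auto
    also have "\<dots> \<le> expectation (\<lambda>x. exp (lam * q) * exp (lam * U x))"
    proof (rule integral_mono)
      fix x assume "x \<in> space M"
      have "lam * ((real_of_int \<lfloor>U x / q\<rfloor> + 1) * q) \<le> lam * (U x + q)"
        using lam floorU by (intro mult_left_mono) auto
      then show "(\<Sum>k\<in>K. indicator (B k) x * exp (lam * ((real_of_int k + 1) * q))) \<le> exp (lam * q) * exp (lam * U x)"
        using \<open>x \<in> space M\<close> by (simp add: sumB exp_add[symmetric] algebra_simps)
    qed (use intE in auto)
    also have "\<dots> = m" by (simp add: m_def)
    finally show ?thesis .
  qed
  have "expectation (\<lambda>x. min 1 (c * exp (lam * (S x + U x))))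
    \<le> expectation (\<lambda>x. \<Sum>k\<in>K. indicator (B k) x * Z k x)"
  proof (rule integral_mono)
    show "integrable M (\<lambda>x. min 1 (c * exp (lam * (S x + U x))))"
      by (rule integrable_const_bound[where B=1]) (use c in auto)
    fix x assume x: "x \<in> space M"
    have "lam * (S x + U x) \<le> lam * (S x + (real_of_int \<lfloor>U x / q\<rfloor> + 1) * q)"
      using floorU lam by (intro mult_left_mono add_left_mono)
    then have "c * exp (lam * (S x + U x)) \<le> c * exp (lam * (S x + (real_of_int \<lfloor>U x / q\<rfloor> + 1) * q))"
      using c by (intro mult_left_mono) auto
    then show "min 1 (c * exp (lam * (S x + U x))) \<le> (\<Sum>k\<in>K. indicator (B k) x * Z k x)"
      using x by (simp add: sumB Z_def)
  qed auto
  also have "\<dots> = (\<Sum>k\<in>K. expectation (\<lambda>x. indicator (B k) x * Z k x))"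
    by (subst Bochner_Integration.integral_sum) auto
  also have "\<dots> \<le> (\<Sum>k\<in>K. prob (B k) * expectation (Z k) + a)"
    by (intro sum_mono cov)
  also have "\<dots> = (\<Sum>k\<in>K. prob (B k) * expectation (Z k)) + real (card K) * a"
    by (simp add: sum.distrib)
  also have "(\<Sum>k\<in>K. prob (B k) * expectation (Z k)) = expectation (\<lambda>x. \<Sum>k\<in>K. prob (B k) * Z k x)"
    by (subst Bochner_Integration.integral_sum) auto
  also have "\<dots> \<le> expectation (\<lambda>x. min 1 (c * m * exp (lam * S x)))"
  proof (rule integral_mono)
    have "0 \<le> m" unfolding m_def by (intro mult_nonneg_nonneg Bochner_Integration.integral_nonneg) auto
    then show "integrable M (\<lambda>x. min 1 (c * m * exp (lam * S x)))"
      by (intro integrable_const_bound[where B=1]) (use c in auto)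
    fix x
    have "(\<Sum>k\<in>K. prob (B k) * Z k x) \<le> (\<Sum>k\<in>K. prob (B k) * 1)"
      using Z01 by (intro sum_mono mult_left_mono) auto
    also have "\<dots> = 1" by (simp add: sumP)
    finally have 1: "(\<Sum>k\<in>K. prob (B k) * Z k x) \<le> 1" .
    have "(\<Sum>k\<in>K. prob (B k) * Z k x) \<le> (\<Sum>k\<in>K. prob (B k) * (c * exp (lam * (S x + (real_of_int k + 1) * q))))"
      by (intro sum_mono mult_left_mono) (auto simp: Z_def)
    also have "\<dots> = c * exp (lam * S x) * (\<Sum>k\<in>K. prob (B k) * exp (lam * ((real_of_int k + 1) * q)))"
      unfolding sum_distrib_left by (intro sum.cong) (auto simp: distrib_left exp_add)
    also have "\<dots> \<le> c * exp (lam * S x) * m" using summ c by (intro mult_left_mono) auto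
    finally show "(\<Sum>k\<in>K. prob (B k) * Z k x) \<le> min 1 (c * m * exp (lam * S x))" using 1 by (simp add: mult_ac)
  qed auto
  also have "real (card K) * a \<le> (2 * b / q + 2) * a" using cardK a by (intro mult_right_mono)
  finally show ?thesis unfolding m_def by simp
qed

lemma exp_le_one_add_square:
  fixes t :: real
  assumes "\<bar>t\<bar> \<le> 1"
  shows "exp t \<le> 1 + t + t\<^sup>2"
proof (cases "0 \<le> t")
  case True
  then show ?thesis using assms exp_bound[of t] by simp
next
  case False
  have "exp t \<le> 1 / (1 - t)" using exp_ge_add_one_self[of "- t"] False
    by (simp add: exp_minus field_simps)
  also have "\<dots> \<le> 1 + t + t\<^sup>2"
    using False by (simp add: field_simps power2_eq_square) (simp add: mult_nonneg_nonpos zero_le_mult_iff mult_le_0_iff)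
  finally show ?thesis .
qed

lemma (in prob_space) expectation_exp_le:
  fixes U :: "'a \<Rightarrow> real"
  assumes [measurable]: "random_variable borel U"
    and U: "\<And>x. x \<in> space M \<Longrightarrow> \<bar>U x\<bar> \<le> b"
    and mean: "expectation U = 0"
    and lam: "0 \<le> lam" "lam * b \<le> 1"
  shows "expectation (\<lambda>x. exp (lam * U x)) \<le> exp (lam\<^sup>2 * expectation (\<lambda>x. (U x)\<^sup>2))"
proof -
  have lamU: "\<bar>lam * U x\<bar> \<le> 1" if "x \<in> space M" for x
  proof -
    have "\<bar>lam * U x\<bar> = lam * \<bar>U x\<bar>" using lam by (simp add: abs_mult)
    also have "\<dots> \<le> lam * b" using U[OF that] lam by (intro mult_left_mono)
    finally show ?thesis using lam by simp
  qed
  have iU: "integrable M U" by (rule integrable_const_bound[where B=b]) (use U in auto)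
  have iU2: "integrable M (\<lambda>x. (U x)\<^sup>2)"
    by (rule integrable_const_bound[where B="b\<^sup>2"])
      (use U in \<open>auto intro!: AE_I2 simp: power2_le_iff_abs_le abs_le_square_iff[symmetric]\<close>, force)
  have "expectation (\<lambda>x. exp (lam * U x)) \<le> expectation (\<lambda>x. 1 + lam * U x + lam\<^sup>2 * (U x)\<^sup>2)"
  proof (rule integral_mono)
    show "integrable M (\<lambda>x. exp (lam * U x))"
      by (rule integrable_const_bound[where B="exp 1"])
        (use lamU in \<open>force intro!: AE_I2\<close>, measurable)
    show "exp (lam * U x) \<le> 1 + lam * U x + lam\<^sup>2 * (U x)\<^sup>2" if "x \<in> space M" for x
      using exp_le_one_add_square[OF lamU[OF that]] by (simp add: power_mult_distrib)
  qed (use iU iU2 in auto)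
  also have "\<dots> = 1 + lam\<^sup>2 * expectation (\<lambda>x. (U x)\<^sup>2)"
    using iU iU2 mean by (simp add: prob_space)
  also have "\<dots> \<le> exp (lam\<^sup>2 * expectation (\<lambda>x. (U x)\<^sup>2))"
    by (rule exp_ge_add_one_self)
  finally show ?thesis .
qed

text \<open>
  The variables are removed one at a time. The factor \<open>c\<close> is arbitrary because it collects the Laplace
  transforms of those already removed.
\<close>

lemma (in prob_space) expectation_exp_block_sum_le:
  fixes U :: "'b \<Rightarrow> 'a \<Rightarrow> real"
  assumes fin: "finite F"
    and meas: "\<And>j. j \<in> F \<Longrightarrow> random_variable borel (U j)"
    and U: "\<And>j x. j \<in> F \<Longrightarrow> x \<in> space M \<Longrightarrow> \<bar>U j x\<bar> \<le> b"
    and mean: "\<And>j. j \<in> F \<Longrightarrow> expectation (U j) = 0"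
    and lam: "0 \<le> lam" "lam * b \<le> 1" and q: "0 < q" and c: "0 \<le> c"
    and mix: "\<And>j G J J'. j \<in> F \<Longrightarrow> G \<subseteq> F - {j} \<Longrightarrow> J \<in> sets borel \<Longrightarrow> J' \<in> sets borel \<Longrightarrow>
      \<bar>prob {x \<in> space M. (\<Sum>i\<in>G. U i x) \<in> J \<and> U j x \<in> J'}
        - prob {x \<in> space M. (\<Sum>i\<in>G. U i x) \<in> J} * prob {x \<in> space M. U j x \<in> J'}\<bar> \<le> \<alpha> j"
  shows "expectation (\<lambda>x. min 1 (c * exp (lam * (\<Sum>j\<in>F. U j x))))
    \<le> c * exp (lam\<^sup>2 * (\<Sum>j\<in>F. expectation (\<lambda>x. (U j x)\<^sup>2)) + real (card F) * (lam * q))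
      + (2 * b / q + 2) * (\<Sum>j\<in>F. \<alpha> j)"
  using fin meas U mean c mix
proof (induction F arbitrary: c rule: finite_induct)
  case empty
  then show ?case by (simp add: prob_space)
next
  case (insert j F)
  let ?m = "exp (lam * q) * expectation (\<lambda>x. exp (lam * U j x))"
  let ?v = "\<lambda>j. expectation (\<lambda>x. (U j x)\<^sup>2)"
  have [measurable]: "random_variable borel (U i)" if "i \<in> insert j F" for i
    using insert.prems(1) that by auto
  have m0: "0 \<le> ?m" by (intro mult_nonneg_nonneg Bochner_Integration.integral_nonneg) auto
  have m: "?m \<le> exp (lam * q + lam\<^sup>2 * ?v j)"
    unfolding exp_add using insert.prems lam
    by (intro mult_left_mono expectation_exp_le[where b=b]) auto
  have "expectation (\<lambda>x. min 1 (c * exp (lam * (\<Sum>j\<in>insert j F. U j x))))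
      = expectation (\<lambda>x. min 1 (c * exp (lam * ((\<Sum>j\<in>F. U j x) + U j x))))"
    using insert.hyps by (simp add: add.commute)
  also have "\<dots> \<le> expectation (\<lambda>x. min 1 (c * ?m * exp (lam * (\<Sum>j\<in>F. U j x)))) + (2 * b / q + 2) * \<alpha> j"
    by (rule decoupling_step) (use insert.prems(2,4) insert.prems(5)[of j F] insert.hyps lam q in auto)
  also have "\<dots> \<le> (c * ?m * exp (lam\<^sup>2 * (\<Sum>j\<in>F. ?v j) + real (card F) * (lam * q)) + (2 * b / q + 2) * (\<Sum>j\<in>F. \<alpha> j)) + (2 * b / q + 2) * \<alpha> j"
    using insert.prems m0 insert.hyps
    by (intro add_right_mono insert.IH) (auto intro!: insert.prems(5))
  also have "\<dots> \<le> (c * exp (lam * q + lam\<^sup>2 * ?v j) * exp (lam\<^sup>2 * (\<Sum>j\<in>F. ?v j) + real (card F) * (lam * q)) + (2 * b / q + 2) * (\<Sum>j\<in>F. \<alpha> j)) + (2 * b / q + 2) * \<alpha> j"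
    using m insert.prems(4) by (intro add_right_mono mult_right_mono mult_left_mono) auto
  also have "\<dots> = c * exp (lam\<^sup>2 * (\<Sum>j\<in>insert j F. ?v j) + real (card (insert j F)) * (lam * q)) + (2 * b / q + 2) * (\<Sum>j\<in>insert j F. \<alpha> j)"
    using insert.hyps by (simp add: mult.assoc exp_add[symmetric] algebra_simps add_divide_distrib)
  finally show ?case .
qed

text \<open>
  The indicator of \<open>t \<le> S\<close> is at most \<open>min 1 (exp (lam * (S - t)))\<close>, so the usual exponential Markov
  bound survives the truncation.
\<close>

lemma (in prob_space) prob_block_sum_ge_le:
  fixes U :: "'b \<Rightarrow> 'a \<Rightarrow> real"
  assumes fin: "finite F"
    and meas: "\<And>j. j \<in> F \<Longrightarrow> random_variable borel (U j)"
    and U: "\<And>j x. j \<in> F \<Longrightarrow> x \<in> space M \<Longrightarrow> \<bar>U j x\<bar> \<le> b"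
    and mean: "\<And>j. j \<in> F \<Longrightarrow> expectation (U j) = 0"
    and lam: "0 \<le> lam" "lam * b \<le> 1" and q: "0 < q"
    and mix: "\<And>j G J J'. j \<in> F \<Longrightarrow> G \<subseteq> F - {j} \<Longrightarrow> J \<in> sets borel \<Longrightarrow> J' \<in> sets borel \<Longrightarrow>
      \<bar>prob {x \<in> space M. (\<Sum>i\<in>G. U i x) \<in> J \<and> U j x \<in> J'}
        - prob {x \<in> space M. (\<Sum>i\<in>G. U i x) \<in> J} * prob {x \<in> space M. U j x \<in> J'}\<bar> \<le> \<alpha> j"
  shows "prob {x \<in> space M. t \<le> (\<Sum>j\<in>F. U j x)}
    \<le> exp (lam\<^sup>2 * (\<Sum>j\<in>F. expectation (\<lambda>x. (U j x)\<^sup>2)) + real (card F) * (lam * q) - lam * t)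
      + (2 * b / q + 2) * (\<Sum>j\<in>F. \<alpha> j)"
proof -
  have [measurable]: "(\<lambda>x. \<Sum>j\<in>F. U j x) \<in> borel_measurable M"
    using meas by (intro borel_measurable_sum)
  let ?A = "{x \<in> space M. t \<le> (\<Sum>j\<in>F. U j x)}"
  have "?A \<in> events" by measurable
  then have "prob ?A = expectation (indicator ?A)" by simp
  also have "\<dots> \<le> expectation (\<lambda>x. min 1 (exp (- lam * t) * exp (lam * (\<Sum>j\<in>F. U j x))))"
  proof (rule integral_mono)
    show "integrable M (indicat_real ?A)" using \<open>?A \<in> events\<close> by (simp add: integrable_real_indicator emeasure_eq_measure)
    show "integrable M (\<lambda>x. min 1 (exp (- lam * t) * exp (lam * (\<Sum>j\<in>F. U j x))))"
      by (rule integrable_const_bound[where B=1]) auto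
    show "indicat_real ?A x \<le> min 1 (exp (- lam * t) * exp (lam * (\<Sum>j\<in>F. U j x)))" for x
      using lam mult_left_mono[of t "\<Sum>j\<in>F. U j x" lam] by (auto simp: indicator_def exp_add[symmetric])
  qed
  also have "\<dots> \<le> exp (- lam * t) * exp (lam\<^sup>2 * (\<Sum>j\<in>F. expectation (\<lambda>x. (U j x)\<^sup>2)) + real (card F) * (lam * q))
      + (2 * b / q + 2) * (\<Sum>j\<in>F. \<alpha> j)"
    using assms by (intro expectation_exp_block_sum_le) auto
  also have "\<dots> = exp (lam\<^sup>2 * (\<Sum>j\<in>F. expectation (\<lambda>x. (U j x)\<^sup>2)) + real (card F) * (lam * q) - lam * t)
      + (2 * b / q + 2) * (\<Sum>j\<in>F. \<alpha> j)"
    by (simp add: exp_add[symmetric])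
  finally show ?thesis .
qed

section \<open>Multi-indices and a Borel-Cantelli lemma\<close>

lemma eventually_multi_at_top:
  "eventually P (multi_at_top :: (nat ^ 'n::finite) filter) \<longleftrightarrow> (\<exists>m. \<forall>n. (\<forall>k. m \<le> n $ k) \<longrightarrow> P n)"
proof -
  have "eventually P (multi_at_top :: (nat ^ 'n) filter) \<longleftrightarrow> (\<exists>m. \<forall>n. m \<le> (MIN k\<in>UNIV. n $ k) \<longrightarrow> P n)"
    unfolding multi_at_top_def eventually_filtercomap_at_top_linorder ..
  also have "\<dots> \<longleftrightarrow> (\<exists>m. \<forall>n. (\<forall>k. m \<le> n $ k) \<longrightarrow> P n)"
    by (subst Min_ge_iff) auto
  finally show ?thesis .
qed

definition index_box :: "nat \<Rightarrow> nat \<Rightarrow> (nat ^ 'n::finite) set" where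
  "index_box m m' = {n. \<forall>k. m \<le> n $ k \<and> n $ k \<le> m'}"

lemma sum_prod_vec:
  fixes a :: "'n::finite \<Rightarrow> nat \<Rightarrow> real"
  assumes "\<And>k. finite (A k)"
  shows "(\<Sum>n\<in>{n :: nat ^ 'n. \<forall>k. n $ k \<in> A k}. \<Prod>k\<in>UNIV. a k (n $ k)) = (\<Prod>k\<in>UNIV. \<Sum>j\<in>A k. a k j)"
proof -
  have "(\<Prod>k\<in>UNIV. \<Sum>j\<in>A k. a k j) = (\<Sum>g\<in>Pi\<^sub>E UNIV A. \<Prod>k\<in>UNIV. a k (g k))"
    using assms by (intro prod_sum_PiE) auto
  also have "\<dots> = (\<Sum>n\<in>{n :: nat ^ 'n. \<forall>k. n $ k \<in> A k}. \<Prod>k\<in>UNIV. a k (n $ k))"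
    by (rule sum.reindex_bij_witness[where i="\<lambda>n k. n $ k" and j="\<lambda>g. vec_lambda g"]) (auto simp: PiE_def)
  finally show ?thesis by simp
qed

lemma finite_vec_set: "(\<And>k. finite (A k)) \<Longrightarrow> finite {n :: nat ^ 'n::finite. \<forall>k. n $ k \<in> A k}"
proof -
  assume "\<And>k. finite (A k)"
  then have "finite (Pi\<^sub>E UNIV A)" by (intro finite_PiE) auto
  moreover have "{n :: nat ^ 'n. \<forall>k. n $ k \<in> A k} \<subseteq> vec_lambda ` Pi\<^sub>E UNIV A"
  proof
    fix n :: "nat ^ 'n" assume "n \<in> {n. \<forall>k. n $ k \<in> A k}"
    then show "n \<in> vec_lambda ` Pi\<^sub>E UNIV A"
      by (intro image_eqI[where x="\<lambda>k. n $ k"]) auto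
  qed
  ultimately show ?thesis by (rule finite_surj)
qed

lemma card_vec_set: "(\<And>k. finite (A k)) \<Longrightarrow> real (card {n :: nat ^ 'n::finite. \<forall>k. n $ k \<in> A k}) = (\<Prod>k\<in>UNIV. real (card (A k)))"
  using sum_prod_vec[of A "\<lambda>_ _. 1"] by simp

lemma rect_eq: "rect n = {i. \<forall>k. i $ k \<in> {1..n $ k}}"
  by (auto simp: rect_def)

lemma finite_rect [simp]: "finite (rect n)"
  unfolding rect_eq by (rule finite_vec_set) auto

lemma card_rect: "real (card (rect n)) = nhat n"
  unfolding rect_eq nhat_def by (subst card_vec_set) auto

lemma rect_subset_pos: "rect n \<subseteq> pos_index"
  by (auto simp: rect_def pos_index_def)

text \<open>
  The summand at \<open>k\<close> is at most the increment over \<open>[k - 1, k]\<close> of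
  \<open>- (ln (ln x)) powr (- \<epsilon>) / \<epsilon>\<close>, whose derivative it is. From \<open>m - 1 = 3\<close> on, \<open>ln (ln x)\<close> is positive.
\<close>

lemma iterated_log_tail_sum:
  fixes \<epsilon> :: real
  assumes eps: "0 < \<epsilon>" and m: "4 \<le> m"
  shows "(\<Sum>k=m..M. 1 / (real k * (ln (real k) * ln (ln (real k)) powr (1 + \<epsilon>))))
     \<le> ln (ln (real (m - 1))) powr (- \<epsilon>) / \<epsilon>"
proof -
  define G where "G x = - (ln (ln x) powr (- \<epsilon>)) / \<epsilon>" for x :: real
  have ln3: "1 < ln (x::real)" if "3 \<le> x" for x
  proof -
    have "exp 1 < x" using that e_less_272 by simp
    then have "ln (exp 1) < ln x" using that by (subst ln_less_cancel_iff) auto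
    then show ?thesis by simp
  qed
  have step: "1 / (real k * (ln (real k) * ln (ln (real k)) powr (1 + \<epsilon>))) \<le> G (real k) - G (real (k - 1))"
    if k: "4 \<le> k" for k
  proof -
    have "\<exists>z. real (k - 1) < z \<and> z < real k \<and> G (real k) - G (real (k - 1))
       = (real k - real (k - 1)) * (1 / (z * (ln z * ln (ln z) powr (1 + \<epsilon>))))"
    proof (rule MVT2)
      show "real (k - 1) < real k" using k by simp
      fix x assume x: "real (k - 1) \<le> x" "x \<le> real k"
      then have x3: "3 \<le> x" using k by linarith
      have l: "1 < ln x" "0 < ln (ln x)" using ln3[OF x3] by auto
      have "- \<epsilon> - 1 = - (1 + \<epsilon>)" by simp
      then have pw: "ln (ln x) powr (- \<epsilon> - 1) = 1 / ln (ln x) powr (1 + \<epsilon>)"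
        using powr_minus_divide[of "ln (ln x)" "1 + \<epsilon>"] by (simp only:)
      have D: "((\<lambda>x. ln (ln x)) has_real_derivative inverse (ln x) * inverse x) (at x)"
        using DERIV_chain2[OF DERIV_ln DERIV_ln, of x] l x3 by simp
      have "((\<lambda>x. - (ln (ln x) powr (- \<epsilon>)) / \<epsilon>) has_real_derivative
          - (- \<epsilon> * ln (ln x) powr (- \<epsilon> - 1) * (inverse (ln x) * inverse x)) / \<epsilon>) (at x)"
        by (intro DERIV_cdivide DERIV_minus DERIV_chain2[OF has_real_derivative_powr[OF l(2)] D])
      moreover have "- (- \<epsilon> * ln (ln x) powr (- \<epsilon> - 1) * (inverse (ln x) * inverse x)) / \<epsilon>
          = 1 / (x * (ln x * ln (ln x) powr (1 + \<epsilon>)))"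
        unfolding pw using eps by (simp add: divide_simps)
      ultimately show "(G has_field_derivative 1 / (x * (ln x * ln (ln x) powr (1 + \<epsilon>)))) (at x)"
        unfolding G_def by simp
    qed
    then obtain z where z: "real (k - 1) < z" "z < real k" and
      eq: "G (real k) - G (real (k - 1)) = (real k - real (k - 1)) * (1 / (z * (ln z * ln (ln z) powr (1 + \<epsilon>))))"
      by blast
    have z3: "3 \<le> z" using z k by linarith
    have l: "1 < ln z" "0 < ln (ln z)" using ln3[OF z3] by auto
    have "ln z \<le> ln (real k)" using z z3 by simp
    moreover have "ln (ln z) \<le> ln (ln (real k))" using z z3 l by simp
    ultimately have "z * (ln z * ln (ln z) powr (1 + \<epsilon>)) \<le> real k * (ln (real k) * ln (ln (real k)) powr (1 + \<epsilon>))"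
      using z z3 l eps by (intro mult_mono powr_mono2) auto
    then have "1 / (real k * (ln (real k) * ln (ln (real k)) powr (1 + \<epsilon>))) \<le> 1 / (z * (ln z * ln (ln z) powr (1 + \<epsilon>)))"
      using z3 l by (intro frac_le) (auto intro!: mult_pos_pos)
    then show ?thesis using eq k by simp
  qed
  have G0: "G x \<le> 0" for x using eps by (simp add: G_def divide_le_0_iff)
  have "(\<Sum>k=m..M. 1 / (real k * (ln (real k) * ln (ln (real k)) powr (1 + \<epsilon>)))) \<le> G (real M) - G (real (m - 1)) \<or> M < m"
  proof (induction M)
    case 0
    then show ?case using m by simp
  next
    case (Suc M)
    show ?case
    proof (cases "Suc M < m")
      case False
      show ?thesis
      proof (cases "m = Suc M")
        case True
        then show ?thesis using step[of "Suc M"] m by simp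
      next
        case f: False
        then show ?thesis using Suc False step[of "Suc M"] m by simp
      qed
    qed simp
  qed
  then show ?thesis
  proof
    assume "M < m" then show ?thesis using eps by (simp add: divide_nonneg_pos)
  next
    assume "(\<Sum>k=m..M. 1 / (real k * (ln (real k) * ln (ln (real k)) powr (1 + \<epsilon>)))) \<le> G (real M) - G (real (m - 1))"
    also have "\<dots> \<le> - G (real (m - 1))" using G0[of "real M"] by simp
    finally show ?thesis by (simp add: G_def)
  qed
qed

text \<open>
  The bound is a product over the coordinates. The event that \<open>A n\<close> occurs for some \<open>n\<close> with all
  components at least \<open>m\<close> therefore has probability at most a power of a one-dimensional tail
  sum, and this tends to 0 with \<open>m\<close>. It is this use of tails that covers multi-indices whose
  components grow at arbitrarily different speeds.
\<close>

lemma (in prob_space) borel_cantelli_multi_index: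
  fixes A :: "nat ^ 'n::finite \<Rightarrow> 'a set"
  assumes eps: "0 < \<epsilon>" and ev: "\<And>n. A n \<in> events"
    and le: "eventually (\<lambda>n. prob (A n) \<le> C / (nhat n * u_fun \<epsilon> n)) multi_at_top"
  shows "AE x in M. eventually (\<lambda>n. x \<notin> A n) multi_at_top"
proof -
  let ?a = "\<lambda>k::nat. 1 / (real k * (ln (real k) * ln (ln (real k)) powr (1 + \<epsilon>)))"
  define C' where "C' = max C 0"
  obtain m0 where m0: "\<And>n. (\<forall>k. m0 \<le> n $ k) \<Longrightarrow> prob (A n) \<le> C / (nhat n * u_fun \<epsilon> n)"
    using le unfolding eventually_multi_at_top by blast
  define T where "T m = C' * (ln (ln (real (m - 1))) powr (- \<epsilon>) / \<epsilon>) ^ CARD('n)" for m :: nat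
  have ln4: "1 < ln (real k)" if "4 \<le> k" for k :: nat
  proof -
    have "exp 1 < real k" using that e_less_272 by simp
    then have "ln (exp 1) < ln (real k)" using that by (subst ln_less_cancel_iff) auto
    then show ?thesis by simp
  qed
  have a_nonneg: "0 \<le> ?a k" if "4 \<le> k" for k
    using ln4[OF that] by (intro divide_nonneg_nonneg mult_nonneg_nonneg) auto
  have C'_le: "C / (nhat n * u_fun \<epsilon> n) \<le> C' * (\<Prod>k\<in>UNIV. ?a (n $ k))" if "\<forall>k. 4 \<le> n $ k" for n :: "nat ^ 'n"
  proof -
    have "(\<Prod>k\<in>UNIV. ?a (n $ k)) = 1 / (nhat n * u_fun \<epsilon> n)"
      unfolding nhat_def u_fun_def by (simp add: prod_dividef prod.distrib)
    moreover have "0 \<le> (\<Prod>k\<in>UNIV. ?a (n $ k))" using a_nonneg that by (intro prod_nonneg ballI) blast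
    ultimately have "C * (1 / (nhat n * u_fun \<epsilon> n)) \<le> C' * (1 / (nhat n * u_fun \<epsilon> n))"
      unfolding C'_def by (intro mult_right_mono) auto
    with \<open>(\<Prod>k\<in>UNIV. ?a (n $ k)) = 1 / (nhat n * u_fun \<epsilon> n)\<close> show ?thesis by simp
  qed
  have box: "prob (\<Union>n\<in>index_box m m'. A n) \<le> T m" if m: "4 \<le> m" "m0 \<le> m" for m m'
  proof -
    have fin: "finite (index_box m m' :: (nat ^ 'n) set)"
      using finite_vec_set[of "\<lambda>_. {m..m'}"] by (simp add: index_box_def)
    have "prob (\<Union>n\<in>index_box m m'. A n) \<le> (\<Sum>n\<in>index_box m m'. prob (A n))"
      using fin ev by (intro finite_measure_subadditive_finite) auto
    also have "\<dots> \<le> (\<Sum>n\<in>(index_box m m' :: (nat ^ 'n) set). C' * (\<Prod>k\<in>UNIV. ?a (n $ k)))"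
    proof (rule sum_mono)
      fix n :: "nat ^ 'n" assume n: "n \<in> index_box m m'"
      then have "\<forall>k. m \<le> n $ k" by (simp add: index_box_def)
      then have "\<forall>k. m0 \<le> n $ k" "\<forall>k. 4 \<le> n $ k" using m by (meson le_trans)+
      then show "prob (A n) \<le> C' * (\<Prod>k\<in>UNIV. ?a (n $ k))" by (intro order_trans[OF m0 C'_le])
    qed
    also have "\<dots> = C' * (\<Sum>n\<in>{n :: nat ^ 'n. \<forall>k. n $ k \<in> {m..m'}}. \<Prod>k\<in>UNIV. ?a (n $ k))"
      by (simp add: sum_distrib_left index_box_def)
    also have "\<dots> = C' * (\<Prod>k\<in>(UNIV::'n set). \<Sum>j\<in>{m..m'}. ?a j)"
      by (subst sum_prod_vec[where a="\<lambda>_. ?a"]) auto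
    also have "\<dots> \<le> T m"
      unfolding T_def prod_constant
    proof (intro mult_left_mono power_mono sum_nonneg)
      show "0 \<le> ?a j" if "j \<in> {m..m'}" for j using a_nonneg[of j] m that by simp
      show "(\<Sum>j\<in>{m..m'}. ?a j) \<le> ln (ln (real (m - 1))) powr - \<epsilon> / \<epsilon>"
        by (rule iterated_log_tail_sum[OF eps m(1)])
    qed (simp add: C'_def)
    finally show ?thesis .
  qed
  define D where "D m = (\<Union>n\<in>{n. \<forall>k. m \<le> n $ k}. A n)" for m
  have D: "D m \<in> events \<and> prob (D m) \<le> T m" if m: "4 \<le> m" "m0 \<le> m" for m
  proof -
    have eq: "D m = (\<Union>m'. \<Union>n\<in>index_box m m'. A n)"
    proof (intro set_eqI iffI)
      fix x assume "x \<in> D m"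
      then obtain n where n: "\<forall>k. m \<le> n $ k" "x \<in> A n" by (auto simp: D_def)
      have "n \<in> index_box m (MAX k\<in>UNIV. n $ k)" using n(1) by (auto simp: index_box_def intro!: Max_ge)
      then show "x \<in> (\<Union>m'. \<Union>n\<in>index_box m m'. A n)" using n(2) by blast
    qed (auto simp: D_def index_box_def)
    have evb: "(\<Union>n\<in>index_box m m'. A n) \<in> events" for m'
    proof -
      have "finite (index_box m m' :: (nat ^ 'n) set)"
        using finite_vec_set[of "\<lambda>_. {m..m'}"] by (simp add: index_box_def)
      then show ?thesis using ev by auto
    qed
    have "(\<lambda>m'. prob (\<Union>n\<in>index_box m m'. A n)) \<longlonglongrightarrow> prob (\<Union>m'. \<Union>n\<in>index_box m m'. A n)"
    proof (rule finite_Lim_measure_incseq)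
      have "index_box m l \<subseteq> (index_box m l' :: (nat ^ 'n) set)" if "l \<le> l'" for l l'
        using that le_trans unfolding index_box_def by blast
      then show "incseq (\<lambda>m'. \<Union>n\<in>index_box m m'. A n)"
        unfolding incseq_def by (intro allI impI UN_mono) auto
    qed (use evb in auto)
    then have "prob (D m) \<le> T m" unfolding eq
      by (rule LIMSEQ_le_const2) (use box[OF m] in auto)
    moreover have "D m \<in> events" unfolding eq using evb by auto
    ultimately show ?thesis by simp
  qed
  have T0: "T \<longlonglongrightarrow> 0"
  proof -
    have "filterlim (\<lambda>m::nat. real (m - 1)) at_top sequentially"
      by (rule filterlim_compose[OF filterlim_real_sequentially filterlim_minus_const_nat_at_top])
    then have "filterlim (\<lambda>m. ln (ln (real (m - 1)))) at_top sequentially"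
      by (intro filterlim_compose[OF ln_at_top])
    then have "(\<lambda>m. ln (ln (real (m - 1))) powr (- \<epsilon>)) \<longlonglongrightarrow> 0"
      using eps by (intro tendsto_neg_powr) auto
    then have "(\<lambda>m. ln (ln (real (m - 1))) powr (- \<epsilon>) / \<epsilon>) \<longlonglongrightarrow> 0"
      by (rule tendsto_divide_zero)
    then have "(\<lambda>m. (ln (ln (real (m - 1))) powr (- \<epsilon>) / \<epsilon>) ^ CARD('n)) \<longlonglongrightarrow> 0 ^ CARD('n)"
      by (rule tendsto_power)
    then have "(\<lambda>m. (ln (ln (real (m - 1))) powr (- \<epsilon>) / \<epsilon>) ^ CARD('n)) \<longlonglongrightarrow> 0"
      by (simp only: zero_power[OF zero_less_card_finite])
    then show ?thesis unfolding T_def by (rule tendsto_mult_right_zero)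
  qed
  define E where "E = (\<Inter>m\<in>{max 4 m0..}. D m)"
  have Eev: "E \<in> events" unfolding E_def by (rule sets.countable_INT') (use D in auto)
  have "prob E \<le> T m" if "max 4 m0 \<le> m" for m
  proof -
    have "prob E \<le> prob (D m)" using D that by (intro finite_measure_mono) (auto simp: E_def)
    then show ?thesis using D[of m] that by simp
  qed
  then have "prob E \<le> 0"
    by (intro LIMSEQ_le_const[OF T0] exI[of _ "max 4 m0"] allI impI)
  then have "prob E = 0" by (simp add: measure_le_0_iff)
  then have "E \<in> null_sets M" using Eev by (simp add: emeasure_eq_measure null_sets_def)
  then have "AE x in M. x \<notin> E" by (rule AE_not_in)
  then show ?thesis
  proof (rule AE_mp, intro AE_I2 impI)
    fix x assume "x \<notin> E"
    then obtain m where "x \<notin> D m" by (auto simp: E_def)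
    then have "\<forall>n. (\<forall>k. m \<le> n $ k) \<longrightarrow> x \<notin> A n" unfolding D_def by blast
    then show "eventually (\<lambda>n. x \<notin> A n) multi_at_top"
      unfolding eventually_multi_at_top by (rule exI)
  qed
qed

section \<open>An exponential inequality for mixing fields\<close>

text \<open>
  The bound by superlevel sets is used twice, once for each variable, after mapping \<open>[-1, 1]\<close> onto
  \<open>[0, 1]\<close>. Each of the two maps contributes a factor 2.
\<close>

lemma (in prob_space) covariance_bound_from_events:
  fixes S T :: "'a \<Rightarrow> real"
  assumes [measurable]: "random_variable borel S" "random_variable borel T"
    and S: "\<And>x. x \<in> space M \<Longrightarrow> \<bar>S x\<bar> \<le> 1" and T: "\<And>x. x \<in> space M \<Longrightarrow> \<bar>T x\<bar> \<le> 1"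
    and mix: "\<And>J J'. J \<in> sets borel \<Longrightarrow> J' \<in> sets borel \<Longrightarrow>
      \<bar>prob {x \<in> space M. S x \<in> J \<and> T x \<in> J'} - prob {x \<in> space M. S x \<in> J} * prob {x \<in> space M. T x \<in> J'}\<bar> \<le> a"
  shows "\<bar>expectation (\<lambda>x. S x * T x) - expectation S * expectation T\<bar> \<le> 4 * a"
proof -
  have iS [simp]: "integrable M S" by (rule integrable_const_bound[where B=1]) (use S in auto)
  have iT [simp]: "integrable M T" by (rule integrable_const_bound[where B=1]) (use T in auto)
  have iST [simp]: "integrable M (\<lambda>x. S x * T x)"
    by (rule integrable_const_bound[where B=1]) (use S T in \<open>auto simp: abs_mult intro!: AE_I2 mult_le_one\<close>)
  have one: "\<bar>expectation (\<lambda>x. indicat_real B x * S x) - expectation (indicat_real B) * expectation S\<bar> \<le> 2 * a"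
    if B: "B = {x \<in> space M. T x \<in> J'}" and J': "J' \<in> sets borel" for B J'
  proof -
    have [measurable]: "B \<in> events" unfolding B using J' by measurable
    have [simp]: "integrable M (indicat_real B)"
      by (rule integrable_const_bound[where B=1]) auto
    have [simp]: "integrable M (\<lambda>x. indicat_real B x * S x)"
      by (rule integrable_const_bound[where B=1]) (use S in \<open>auto simp: indicator_def\<close>)
    have "\<bar>expectation (\<lambda>x. indicat_real B x * ((S x + 1) / 2)) - expectation (indicat_real B) * expectation (\<lambda>x. (S x + 1) / 2)\<bar> \<le> a"
    proof (rule covariance_bound_from_superlevel_sets)
      show "0 \<le> (S x + 1) / 2 \<and> (S x + 1) / 2 \<le> 1" if "x \<in> space M" for x using S[OF that] by auto
      fix u
      let ?J = "{s::real. u < (s + 1) / 2}"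
      have J: "?J \<in> sets borel" by measurable
      have 1: "{x \<in> space M. S x \<in> ?J \<and> T x \<in> J'} = B \<inter> {x \<in> space M. u < (S x + 1) / 2}"
        "{x \<in> space M. S x \<in> ?J} = {x \<in> space M. u < (S x + 1) / 2}"
        by (auto simp: B)
      have "{x \<in> space M. u < (S x + 1) / 2} \<in> events" by measurable
      then have "expectation (\<lambda>x. indicat_real B x * indicat_real {x \<in> space M. u < (S x + 1) / 2} x)
         = prob (B \<inter> {x \<in> space M. u < (S x + 1) / 2})"
        by (subst indicator_inter_arith[symmetric]) simp
      then show "\<bar>expectation (\<lambda>x. indicat_real B x * indicator {x \<in> space M. u < (S x + 1) / 2} x) -
           expectation (indicat_real B) * prob {x \<in> space M. u < (S x + 1) / 2}\<bar> \<le> a"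
        using mix[OF J J'] unfolding 1 B[symmetric] by (simp add: mult.commute)
    qed (auto simp: indicator_def)
    also have "(\<lambda>x. indicat_real B x * ((S x + 1) / 2)) = (\<lambda>x. (indicat_real B x * S x + indicat_real B x) / 2)"
      by (simp add: algebra_simps add_divide_distrib)
    also have "expectation \<dots> = (expectation (\<lambda>x. indicat_real B x * S x) + expectation (indicat_real B)) / 2"
      by simp
    also have "expectation (\<lambda>x. (S x + 1) / 2) = (expectation S + 1) / 2"
      by (simp add: prob_space)
    also have "(expectation (\<lambda>x. indicat_real B x * S x) + expectation (indicat_real B)) / 2
        - expectation (indicat_real B) * ((expectation S + 1) / 2)
      = (expectation (\<lambda>x. indicat_real B x * S x) - expectation (indicat_real B) * expectation S) / 2"
      by (simp add: algebra_simps add_divide_distrib diff_divide_distrib)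
    finally show ?thesis by simp
  qed
  have "\<bar>expectation (\<lambda>x. S x * ((T x + 1) / 2)) - expectation S * expectation (\<lambda>x. (T x + 1) / 2)\<bar> \<le> 2 * a"
  proof (rule covariance_bound_from_superlevel_sets)
    show "0 \<le> (T x + 1) / 2 \<and> (T x + 1) / 2 \<le> 1" if "x \<in> space M" for x using T[OF that] by auto
    fix u
    let ?J = "{s::real. u < (s + 1) / 2}"
    have J: "?J \<in> sets borel" by measurable
    have eq: "{x \<in> space M. u < (T x + 1) / 2} = {x \<in> space M. T x \<in> ?J}" by simp
    have "{x \<in> space M. u < (T x + 1) / 2} \<in> events" by measurable
    then show "\<bar>expectation (\<lambda>x. S x * indicator {x \<in> space M. u < (T x + 1) / 2} x) -
           expectation S * prob {x \<in> space M. u < (T x + 1) / 2}\<bar> \<le> 2 * a"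
      using one[OF eq J] by (simp add: mult.commute)
  qed (use S in auto)
  also have "(\<lambda>x. S x * ((T x + 1) / 2)) = (\<lambda>x. (S x * T x + S x) / 2)"
    by (simp add: algebra_simps add_divide_distrib)
  also have "expectation \<dots> = (expectation (\<lambda>x. S x * T x) + expectation S) / 2"
    by simp
  also have "expectation (\<lambda>x. (T x + 1) / 2) = (expectation T + 1) / 2"
    by (simp add: prob_space)
  also have "(expectation (\<lambda>x. S x * T x) + expectation S) / 2 - expectation S * ((expectation T + 1) / 2)
    = (expectation (\<lambda>x. S x * T x) - expectation S * expectation T) / 2"
    by (simp add: algebra_simps add_divide_distrib diff_divide_distrib)
  finally show ?thesis by simp
qed

lemma sets_gen_events:
  "sets (sigma (space M) (\<Union>i\<in>E. {Z i -` B \<inter> space M |B. B \<in> sets borel})) = gen_events M Z E"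
  unfolding gen_events_def by (rule sets_measure_of) auto

lemma sum_preimage_in_gen_events:
  fixes \<zeta> :: "'b::topological_space \<Rightarrow> real"
  assumes [measurable]: "\<zeta> \<in> borel_measurable borel" and J: "J \<in> sets borel" and I: "I \<subseteq> E"
  shows "{x \<in> space M. (\<Sum>i\<in>I. \<zeta> (Z i x)) \<in> J} \<in> gen_events M Z E"
proof -
  define G where "G = sigma (space M) (\<Union>i\<in>E. {Z i -` B \<inter> space M |B. B \<in> sets borel})"
  have sp: "space G = space M" unfolding G_def by (rule space_measure_of) auto
  have "Z i \<in> G \<rightarrow>\<^sub>M borel" if "i \<in> E" for i
  proof (rule measurableI)
    fix A :: "'b set" assume "A \<in> sets borel"
    then have "Z i -` A \<inter> space M \<in> sigma_sets (space M) (\<Union>i\<in>E. {Z i -` B \<inter> space M |B. B \<in> sets borel})"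
      using that by (intro sigma_sets.Basic) auto
    then have "Z i -` A \<inter> space G \<in> gen_events M Z E"
      by (simp add: sp gen_events_def)
    then show "Z i -` A \<inter> space G \<in> sets G"
      using sets_gen_events[of M Z E] by (simp add: G_def)
  qed auto
  then have "(\<lambda>x. \<Sum>i\<in>I. \<zeta> (Z i x)) \<in> borel_measurable G"
    using I by (intro borel_measurable_sum measurable_compose[OF _ assms(1)]) auto
  then have "(\<lambda>x. \<Sum>i\<in>I. \<zeta> (Z i x)) -` J \<inter> space G \<in> sets G"
    using J by (rule measurable_sets)
  moreover have "(\<lambda>x. \<Sum>i\<in>I. \<zeta> (Z i x)) -` J \<inter> space G = {x \<in> space M. (\<Sum>i\<in>I. \<zeta> (Z i x)) \<in> J}"
    by (auto simp: sp)
  ultimately show ?thesis by (simp add: G_def sets_gen_events)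
qed

locale mixing_random_field = prob_space M
  for M :: "'a measure" +
  fixes Z :: "nat ^ 'n::finite \<Rightarrow> 'a \<Rightarrow> 'b::topological_space"
    and \<phi> :: "nat \<Rightarrow> nat \<Rightarrow> real" and chi :: "real \<Rightarrow> real"
  assumes mixing: "mixing_field M Z \<phi> chi"
    and \<phi>_nonneg: "\<forall>n m. 0 \<le> \<phi> n m"
    and chi: "\<forall>t\<ge>0. 0 \<le> chi t" "\<forall>s t. 0 \<le> s \<and> s \<le> t \<longrightarrow> chi t \<le> chi s"
    and Z: "\<And>i. i \<in> pos_index \<Longrightarrow> random_variable borel (Z i)"

text \<open>
  Empty index sets are included, since the block decomposition starts with none: the distance of
  an empty set is 0 by convention, but its \<open>\<sigma>\<close>-field is trivial.
\<close>

lemma (in mixing_random_field) mixing_bound_separated: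
  assumes fin: "finite E" "finite E'" and pos: "E \<subseteq> pos_index" "E' \<subseteq> pos_index"
    and r: "0 \<le> r" and sep: "\<And>i j. i \<in> E \<Longrightarrow> j \<in> E' \<Longrightarrow> r \<le> dist (lattice_point i) (lattice_point j)"
    and A: "A \<in> gen_events M Z E" and B: "B \<in> gen_events M Z E'"
  shows "\<bar>prob (A \<inter> B) - prob A * prob B\<bar> \<le> \<phi> (card E) (card E') * chi r"
proof (cases "E = {} \<or> E' = {}")
  case True
  have triv: "A \<in> {{}, space M}" if "A \<in> gen_events M Z {}" for A
    using that unfolding gen_events_def by (simp add: sigma_sets_empty_eq)
  have into: "A \<inter> space M = A" if "A \<in> gen_events M Z E" for A E
    using sigma_sets_into_sp[of "\<Union>i\<in>E. {Z i -` B \<inter> space M |B. B \<in> sets borel}" "space M" A] that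
    unfolding gen_events_def by blast
  have "A \<in> {{}, space M} \<or> B \<in> {{}, space M}" using True triv A B by blast
  then have "prob (A \<inter> B) = prob A * prob B"
    using into[OF A] into[OF B] by (auto simp: prob_space Int_commute)
  then show ?thesis using \<phi>_nonneg chi(1) r by simp
next
  case False
  have "r \<le> setdist (lattice_point ` E) (lattice_point ` E')"
    using False sep by (intro le_setdistI) auto
  then have "chi (setdist (lattice_point ` E) (lattice_point ` E')) \<le> chi r"
    using chi(2) r by blast
  moreover have "\<bar>prob (A \<inter> B) - prob A * prob B\<bar> \<le> \<phi> (card E) (card E') * chi (setdist (lattice_point ` E) (lattice_point ` E'))"
    using mixing fin pos A B unfolding mixing_field_def by blast
  ultimately show ?thesis using \<phi>_nonneg by (meson mult_left_mono order_trans)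
qed

text \<open>
  The cubes of side \<open>p\<close> are labelled by the integer quotients of their indices.
\<close>

definition block_of :: "nat \<Rightarrow> nat ^ 'n::finite \<Rightarrow> nat ^ 'n" where
  "block_of p i = (\<chi> k. i $ k div p)"

definition parity_class :: "nat ^ 'n::finite \<Rightarrow> nat ^ 'n" where
  "parity_class j = (\<chi> k. j $ k mod 2)"

lemma lattice_component_le_dist:
  "\<bar>real (i $ k) - real (j $ k)\<bar> \<le> dist (lattice_point i) (lattice_point j)"
proof -
  have "\<bar>(lattice_point i - lattice_point j) $ k\<bar> \<le> norm (lattice_point i - lattice_point j)"
    by (rule component_le_norm_cart)
  then show ?thesis by (simp add: lattice_point_def dist_norm)
qed

text \<open>
  Two different labels of the same parity differ by at least 2 in some coordinate, so a whole
  cube lies between the blocks in that direction.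
\<close>

lemma block_separation:
  assumes p: "1 \<le> p" and ne: "block_of p i \<noteq> block_of p j"
    and par: "parity_class (block_of p i) = parity_class (block_of p j)"
  shows "real p \<le> dist (lattice_point i) (lattice_point j)"
proof -
  obtain k where k: "i $ k div p \<noteq> j $ k div p" using ne by (auto simp: block_of_def vec_eq_iff)
  have m: "(i $ k div p) mod 2 = (j $ k div p) mod 2"
    using par by (simp add: block_of_def parity_class_def vec_eq_iff)
  have gap: "p + a \<le> b" if "a div p < b div p" "(a div p) mod 2 = (b div p) mod 2" for a b :: nat
  proof -
    have "x + 2 \<le> y" if "x < y" "x mod 2 = y mod 2" for x y :: nat
      using that by presburger
    from this[OF that] have "a div p + 2 \<le> b div p" .
    then have "(a div p + 2) * p \<le> (b div p) * p" by (rule mult_le_mono1)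
    moreover have "a < p + (a div p) * p" "(b div p) * p \<le> b"
      using p dividend_less_div_times[of p a] by auto
    moreover have "(a div p + 2) * p = (a div p) * p + 2 * p" by (rule distrib_right)
    ultimately show ?thesis by linarith
  qed
  have "p + i $ k \<le> j $ k \<or> p + j $ k \<le> i $ k"
    using k
  proof (rule linorder_neqE_nat)
    assume "i $ k div p < j $ k div p" then show ?thesis using gap m by blast
  next
    assume "j $ k div p < i $ k div p" then show ?thesis using gap m[symmetric] by blast
  qed
  then have "real p \<le> \<bar>real (i $ k) - real (j $ k)\<bar>" by linarith
  then show ?thesis using lattice_component_le_dist order_trans by blast
qed

lemma block_finite_card:
  assumes "1 \<le> p"
  shows "finite {i :: nat ^ 'n::finite. block_of p i = j}" "card {i :: nat ^ 'n. block_of p i = j} \<le> p ^ CARD('n)"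
proof -
  have eq: "{i :: nat ^ 'n. block_of p i = j} \<subseteq> {i. \<forall>k. i $ k \<in> {j $ k * p..<j $ k * p + p}}"
  proof safe
    fix i :: "nat ^ 'n" and k
    show "i $ k \<in> {block_of p i $ k * p..<block_of p i $ k * p + p}"
      using assms dividend_less_div_times[of p "i $ k"] by (simp add: block_of_def add.commute)
  qed
  have fin: "finite {i :: nat ^ 'n. \<forall>k. i $ k \<in> {j $ k * p..<j $ k * p + p}}"
    by (rule finite_vec_set) auto
  show "finite {i :: nat ^ 'n. block_of p i = j}" using eq fin by (rule finite_subset)
  have "real (card {i :: nat ^ 'n. \<forall>k. i $ k \<in> {j $ k * p..<j $ k * p + p}}) = real (p ^ CARD('n))"
    by (subst card_vec_set) auto
  then show "card {i :: nat ^ 'n. block_of p i = j} \<le> p ^ CARD('n)"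
    using card_mono[OF fin eq] by linarith
qed

lemma card_parity_classes: "card {c :: nat ^ 'n::finite. \<forall>k. c $ k \<in> {0, 1}} = 2 ^ CARD('n)"
proof -
  have "real (card {c :: nat ^ 'n. \<forall>k. c $ k \<in> {0, 1}}) = real (2 ^ CARD('n))"
    by (subst card_vec_set) auto
  then show ?thesis by linarith
qed

text \<open>
  A common form of the two growth conditions on \<open>\<phi>\<close>. It is linear in the size of one of the sets in
  order that the sum over all blocks be of the order of the number of sites. The set \<open>E'\<close> must be
  nonempty, as a polynomial bound does not vanish for the empty set.
\<close>

definition mixing_size_bound :: "(nat \<Rightarrow> nat \<Rightarrow> real) \<Rightarrow> nat ^ 'n::finite \<Rightarrow> real \<Rightarrow> bool" where
  "mixing_size_bound \<phi> n \<Phi> \<longleftrightarrow> (\<forall>E E'. E \<subseteq> rect n \<longrightarrow> E' \<subseteq> rect n \<longrightarrow> E' \<noteq> {} \<longrightarrow>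
     \<phi> (card E) (card E') \<le> \<Phi> * real (card E'))"

text \<open>
  Bernstein's inequality for mixing fields: some parity class of blocks carries a sum of at least
  \<open>t\<close>, and the blocks of one class can be decoupled.
\<close>

lemma (in mixing_random_field) prob_field_sum_ge_le:
  fixes \<zeta> :: "'b \<Rightarrow> real"
  assumes \<zeta>: "\<zeta> \<in> borel_measurable borel" "\<And>z. \<bar>\<zeta> z\<bar> \<le> 2"
    and mean: "\<And>i. i \<in> rect n \<Longrightarrow> expectation (\<lambda>x. \<zeta> (Z i x)) = 0"
    and var: "(\<Sum>i\<in>rect n. \<Sum>j\<in>rect n. \<bar>expectation (\<lambda>x. \<zeta> (Z i x) * \<zeta> (Z j x))\<bar>) \<le> v"
    and \<Phi>: "0 \<le> \<Phi>" "mixing_size_bound \<phi> n \<Phi>"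
    and p: "1 \<le> p" and lam: "0 < lam" "lam * (2 * real p ^ CARD('n)) \<le> 1" and n: "n \<in> pos_index"
  shows "prob {x \<in> space M. 2 ^ CARD('n) * t \<le> (\<Sum>i\<in>rect n. \<zeta> (Z i x))}
    \<le> 2 ^ CARD('n) * (exp (lam\<^sup>2 * v + 1 - lam * t) + 4 * (nhat n)\<^sup>2 * \<Phi> * chi (real p))"
proof -
  define Col where "Col = {c :: nat ^ 'n. \<forall>k. c $ k \<in> {0, 1}}"
  have finCol: "finite Col" unfolding Col_def by (rule finite_vec_set) auto
  have cardCol: "card Col = 2 ^ CARD('n)" unfolding Col_def by (rule card_parity_classes)
  define Bl where "Bl j = {i \<in> rect n. block_of p i = j}" for j
  define F where "F c = {j \<in> block_of p ` rect n. parity_class j = c}" for c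
  have finB: "finite (Bl j)" for j by (simp add: Bl_def)
  have finF: "finite (F c)" for c by (simp add: F_def)
  have cardB: "card (Bl j) \<le> p ^ CARD('n)" for j
  proof -
    have "card (Bl j) \<le> card {i :: nat ^ 'n. block_of p i = j}"
      using block_finite_card(1)[OF p] by (intro card_mono) (auto simp: Bl_def)
    then show ?thesis using block_finite_card(2)[OF p, of j] by linarith
  qed
  have B_pos: "Bl j \<subseteq> pos_index" for j using rect_subset_pos by (force simp: Bl_def)
  have nh: "1 \<le> nhat n" using n unfolding nhat_def pos_index_def by (intro prod_ge_1) auto
  define U where "U j x = (\<Sum>i\<in>Bl j. \<zeta> (Z i x))" for j x
  have m\<zeta> [measurable]: "random_variable borel (\<lambda>x. \<zeta> (Z i x))" if "i \<in> pos_index" for i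
    using Z[OF that] \<zeta>(1) by (rule measurable_compose)
  have i\<zeta>: "integrable M (\<lambda>x. \<zeta> (Z i x))" if "i \<in> pos_index" for i
    by (rule integrable_const_bound[where B=2]) (use \<zeta>(2) m\<zeta>[OF that] in auto)
  have i\<zeta>\<zeta>: "integrable M (\<lambda>x. \<zeta> (Z i x) * \<zeta> (Z j x))" if "i \<in> pos_index" "j \<in> pos_index" for i j
  proof (rule integrable_const_bound[where B=4])
    have "\<bar>\<zeta> (Z i x) * \<zeta> (Z j x)\<bar> \<le> 2 * 2" for x
      unfolding abs_mult using \<zeta>(2) by (intro mult_mono) auto
    then show "AE x in M. norm (\<zeta> (Z i x) * \<zeta> (Z j x)) \<le> 4" by simp
  qed (use m\<zeta> that in measurable)
  have Um: "random_variable borel (U j)" for j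
    unfolding U_def using B_pos m\<zeta> by (intro borel_measurable_sum) blast
  have disj: "Bl j \<inter> Bl j' = {}" if "j \<noteq> j'" for j j' using that by (auto simp: Bl_def)
  have sumG: "(\<Sum>j\<in>G. g j) = (\<Sum>i\<in>(\<Union>j\<in>G. Bl j). g' i)" if "finite G" "\<And>j. g j = (\<Sum>i\<in>Bl j. g' i)" for G and g g' :: "nat ^ 'n \<Rightarrow> real"
    using that disj finB by (subst sum.UNION_disjoint) auto
  have UF: "(\<Union>j\<in>F c. Bl j) \<subseteq> rect n" for c by (auto simp: Bl_def)
  have main: "prob {x \<in> space M. t \<le> (\<Sum>j\<in>F c. U j x)} \<le> exp (lam\<^sup>2 * v + 1 - lam * t) + 4 * (nhat n)\<^sup>2 * \<Phi> * chi (real p)" for c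
  proof -
    (* With this mesh the rounding of at most nhat n block sums changes the exponent by at most 1,
       and a block sum, bounded by b with lam b <= 1, has at most 4 nhat n rounded values. *)
    define q where "q = 1 / (lam * nhat n)"
    define b where "b = 2 * real p ^ CARD('n)"
    define \<alpha> where "\<alpha> j = \<Phi> * real (card (Bl j)) * chi (real p)" for j
    have q0: "0 < q" using lam nh by (simp add: q_def)
    have *: "prob {x \<in> space M. t \<le> (\<Sum>j\<in>F c. U j x)}
      \<le> exp (lam\<^sup>2 * (\<Sum>j\<in>F c. expectation (\<lambda>x. (U j x)\<^sup>2)) + real (card (F c)) * (lam * q) - lam * t)
        + (2 * b / q + 2) * (\<Sum>j\<in>F c. \<alpha> j)"
    proof (rule prob_block_sum_ge_le)
      fix j x assume "j \<in> F c" "x \<in> space M"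
      have "\<bar>U j x\<bar> \<le> (\<Sum>i\<in>Bl j. \<bar>\<zeta> (Z i x)\<bar>)" unfolding U_def by (rule sum_abs)
      also have "\<dots> \<le> real (card (Bl j)) * 2" 
        using sum_mono[of "Bl j" "\<lambda>i. \<bar>\<zeta> (Z i x)\<bar>" "\<lambda>_. 2", OF \<zeta>(2)] by simp
      also have "\<dots> \<le> real (p ^ CARD('n)) * 2" by (intro mult_right_mono of_nat_mono cardB) auto
      finally show "\<bar>U j x\<bar> \<le> b" by (simp add: b_def)
    next
      fix j assume "j \<in> F c"
      have "expectation (\<lambda>x. \<Sum>i\<in>Bl j. \<zeta> (Z i x)) = (\<Sum>i\<in>Bl j. expectation (\<lambda>x. \<zeta> (Z i x)))"
        by (intro Bochner_Integration.integral_sum i\<zeta> subsetD[OF B_pos])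
      also have "\<dots> = 0" by (intro sum.neutral ballI mean) (simp add: Bl_def)
      finally show "expectation (U j) = 0" unfolding U_def .
    next
      fix j G and J J' :: "real set"
      assume j: "j \<in> F c" and G: "G \<subseteq> F c - {j}" and J: "J \<in> sets borel" "J' \<in> sets borel"
      let ?E = "\<Union>i\<in>G. Bl i"
      have finG: "finite G" using finite_subset[OF G] finF by simp
      have ER: "?E \<subseteq> rect n" by (auto simp: Bl_def)
      have sG: "(\<Sum>i\<in>G. U i x) = (\<Sum>i\<in>?E. \<zeta> (Z i x))" for x
        using finG by (intro sumG) (auto simp: U_def)
      have "{x \<in> space M. (\<Sum>i\<in>G. U i x) \<in> J \<and> U j x \<in> J'}
        = {x \<in> space M. (\<Sum>i\<in>?E. \<zeta> (Z i x)) \<in> J} \<inter> {x \<in> space M. U j x \<in> J'}"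
        by (auto simp: sG)
      moreover have "\<bar>prob ({x \<in> space M. (\<Sum>i\<in>?E. \<zeta> (Z i x)) \<in> J} \<inter> {x \<in> space M. U j x \<in> J'})
        - prob {x \<in> space M. (\<Sum>i\<in>?E. \<zeta> (Z i x)) \<in> J} * prob {x \<in> space M. U j x \<in> J'}\<bar>
        \<le> \<phi> (card ?E) (card (Bl j)) * chi (real p)"
      proof (rule mixing_bound_separated)
        show "finite ?E" using finG finB by auto
        show "{x \<in> space M. U j x \<in> J'} \<in> gen_events M Z (Bl j)"
          unfolding U_def using \<zeta>(1) J by (intro sum_preimage_in_gen_events) auto
        show "{x \<in> space M. (\<Sum>i\<in>?E. \<zeta> (Z i x)) \<in> J} \<in> gen_events M Z ?E"
          using \<zeta>(1) J by (intro sum_preimage_in_gen_events) auto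
        show "real p \<le> dist (lattice_point i) (lattice_point i')" if "i \<in> ?E" "i' \<in> Bl j" for i i'
          using that G j by (intro block_separation[OF p]) (auto simp: Bl_def F_def)
        show "?E \<subseteq> pos_index" using B_pos by (rule UN_least)
      qed (simp_all only: finB B_pos of_nat_0_le_iff)
      moreover have "\<phi> (card ?E) (card (Bl j)) * chi (real p) \<le> \<alpha> j"
      proof -
        have ne: "Bl j \<noteq> {}" using j by (auto simp: Bl_def F_def)
        have sub: "Bl j \<subseteq> rect n" by (auto simp: Bl_def)
        have "\<phi> (card ?E) (card (Bl j)) \<le> \<Phi> * real (card (Bl j))"
          by (rule \<Phi>(2)[unfolded mixing_size_bound_def, rule_format, OF ER sub ne])
        then show ?thesis unfolding \<alpha>_def using chi(1) by (intro mult_right_mono) auto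
      qed
      ultimately show "\<bar>prob {x \<in> space M. (\<Sum>i\<in>G. U i x) \<in> J \<and> U j x \<in> J'}
        - prob {x \<in> space M. (\<Sum>i\<in>G. U i x) \<in> J} * prob {x \<in> space M. U j x \<in> J'}\<bar> \<le> \<alpha> j"
        by (simp add: sG)
    qed (use finF Um q0 order_less_imp_le[OF lam(1)] lam(2) in \<open>simp_all only: b_def\<close>)
    have s\<alpha>: "(\<Sum>j\<in>F c. \<alpha> j) \<le> \<Phi> * nhat n * chi (real p)"
    proof -
      have "(\<Sum>j\<in>F c. real (card (Bl j))) = (\<Sum>i\<in>(\<Union>j\<in>F c. Bl j). 1)"
        using finF by (intro sumG) auto
      also have "\<dots> \<le> (\<Sum>i\<in>rect n. 1)" using UF by (intro sum_mono2) auto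
      also have "\<dots> = nhat n" by (simp add: card_rect)
      finally have "(\<Sum>j\<in>F c. real (card (Bl j))) \<le> nhat n" .
      then have "\<Phi> * (\<Sum>j\<in>F c. real (card (Bl j))) * chi (real p) \<le> \<Phi> * nhat n * chi (real p)"
        using \<Phi>(1) chi(1) by (intro mult_left_mono mult_right_mono) auto
      then show ?thesis by (simp add: \<alpha>_def sum_distrib_left sum_distrib_right)
    qed
    have sv: "(\<Sum>j\<in>F c. expectation (\<lambda>x. (U j x)\<^sup>2)) \<le> v"
    proof -
      let ?c = "\<lambda>i i'. \<bar>expectation (\<lambda>x. \<zeta> (Z i x) * \<zeta> (Z i' x))\<bar>"
      have "expectation (\<lambda>x. (U j x)\<^sup>2) \<le> (\<Sum>i\<in>Bl j. \<Sum>i'\<in>rect n. ?c i i')" for j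
      proof -
        have "expectation (\<lambda>x. (U j x)\<^sup>2) = expectation (\<lambda>x. \<Sum>i\<in>Bl j. \<Sum>i'\<in>Bl j. \<zeta> (Z i x) * \<zeta> (Z i' x))"
          by (simp add: U_def power2_eq_square sum_product)
        also have "\<dots> = (\<Sum>i\<in>Bl j. \<Sum>i'\<in>Bl j. expectation (\<lambda>x. \<zeta> (Z i x) * \<zeta> (Z i' x)))"
        proof (subst Bochner_Integration.integral_sum)
          show "integrable M (\<lambda>x. \<Sum>i'\<in>Bl j. \<zeta> (Z i x) * \<zeta> (Z i' x))" if "i \<in> Bl j" for i
            using that B_pos[of j] i\<zeta>\<zeta> by (intro Bochner_Integration.integrable_sum) blast
          show "(\<Sum>i\<in>Bl j. expectation (\<lambda>x. \<Sum>i'\<in>Bl j. \<zeta> (Z i x) * \<zeta> (Z i' x)))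
            = (\<Sum>i\<in>Bl j. \<Sum>i'\<in>Bl j. expectation (\<lambda>x. \<zeta> (Z i x) * \<zeta> (Z i' x)))"
            using B_pos[of j] i\<zeta>\<zeta>
            by (intro sum.cong refl Bochner_Integration.integral_sum) blast
        qed
        also have "\<dots> \<le> (\<Sum>i\<in>Bl j. \<Sum>i'\<in>Bl j. ?c i i')" by (intro sum_mono abs_ge_self)
        also have "\<dots> \<le> (\<Sum>i\<in>Bl j. \<Sum>i'\<in>rect n. ?c i i')"
          by (intro sum_mono sum_mono2) (auto simp: Bl_def)
        finally show ?thesis .
      qed
      then have "(\<Sum>j\<in>F c. expectation (\<lambda>x. (U j x)\<^sup>2)) \<le> (\<Sum>j\<in>F c. \<Sum>i\<in>Bl j. \<Sum>i'\<in>rect n. ?c i i')"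
        by (rule sum_mono)
      also have "\<dots> = (\<Sum>i\<in>(\<Union>j\<in>F c. Bl j). \<Sum>i'\<in>rect n. ?c i i')"
        using finF by (intro sumG) auto
      also have "\<dots> \<le> (\<Sum>i\<in>rect n. \<Sum>i'\<in>rect n. ?c i i')"
        using UF by (intro sum_mono2) (auto intro!: sum_nonneg)
      finally show ?thesis using var by linarith
    qed
    have cF: "real (card (F c)) * (lam * q) \<le> 1"
    proof -
      have "card (F c) \<le> card (block_of p ` rect n)"
        by (rule card_mono) (auto simp: F_def)
      also have "\<dots> \<le> card (rect n)" by (rule card_image_le) simp
      finally have "card (F c) \<le> card (rect n)" .
      then have "real (card (F c)) \<le> nhat n" using card_rect[of n] by linarith
      then show ?thesis using lam nh by (simp add: q_def)
    qed
    have bq: "2 * b / q + 2 \<le> 4 * nhat n"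
    proof -
      have "2 * b / q = 2 * (lam * b) * nhat n" using lam nh by (simp add: q_def)
      also have "\<dots> \<le> 2 * 1 * nhat n" using lam nh by (intro mult_left_mono mult_right_mono) (auto simp: b_def)
      finally show ?thesis using nh by linarith
    qed
    have "lam\<^sup>2 * (\<Sum>j\<in>F c. expectation (\<lambda>x. (U j x)\<^sup>2)) \<le> lam\<^sup>2 * v"
      using sv by (intro mult_left_mono) auto
    then have e: "exp (lam\<^sup>2 * (\<Sum>j\<in>F c. expectation (\<lambda>x. (U j x)\<^sup>2)) + real (card (F c)) * (lam * q) - lam * t) \<le> exp (lam\<^sup>2 * v + 1 - lam * t)"
      unfolding exp_le_cancel_iff using cF by linarith
    have "(2 * b / q + 2) * (\<Sum>j\<in>F c. \<alpha> j) \<le> (4 * nhat n) * (\<Phi> * nhat n * chi (real p))"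
    proof (rule mult_mono[OF bq s\<alpha>])
      have "0 \<le> \<alpha> j" for j using \<Phi>(1) chi(1) by (simp add: \<alpha>_def)
      then show "0 \<le> (\<Sum>j\<in>F c. \<alpha> j)" by (intro sum_nonneg)
    qed (use nh in simp)
    also have "(4 * nhat n) * (\<Phi> * nhat n * chi (real p)) = 4 * (nhat n)\<^sup>2 * \<Phi> * chi (real p)"
      by (simp add: power2_eq_square mult_ac)
    finally show ?thesis using * e by linarith
  qed
  have split: "(\<Sum>i\<in>rect n. \<zeta> (Z i x)) = (\<Sum>c\<in>Col. \<Sum>j\<in>F c. U j x)" for x
  proof -
    have "(\<Sum>i\<in>rect n. \<zeta> (Z i x)) = (\<Sum>j\<in>block_of p ` rect n. U j x)"
      unfolding U_def Bl_def by (rule sum.image_gen) simp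
    also have "\<dots> = (\<Sum>c\<in>Col. \<Sum>j\<in>F c. U j x)"
      unfolding F_def
    proof (rule sum.group[symmetric])
      show "parity_class ` block_of p ` rect n \<subseteq> Col" by (auto simp: Col_def parity_class_def)
    qed (use finCol in auto)
    finally show ?thesis .
  qed
  have sub: "{x \<in> space M. 2 ^ CARD('n) * t \<le> (\<Sum>i\<in>rect n. \<zeta> (Z i x))} \<subseteq> (\<Union>c\<in>Col. {x \<in> space M. t \<le> (\<Sum>j\<in>F c. U j x)})"
  proof
    fix x assume x: "x \<in> {x \<in> space M. 2 ^ CARD('n) * t \<le> (\<Sum>i\<in>rect n. \<zeta> (Z i x))}"
    have "Col \<noteq> {}" using cardCol by auto
    have "\<exists>c\<in>Col. t \<le> (\<Sum>j\<in>F c. U j x)"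
    proof (rule ccontr)
      assume "\<not> ?thesis"
      then have "(\<Sum>c\<in>Col. \<Sum>j\<in>F c. U j x) < (\<Sum>c\<in>Col. t)"
        using \<open>Col \<noteq> {}\<close> finCol by (intro sum_strict_mono) (auto simp: not_le)
      then show False using x by (simp add: cardCol split)
    qed
    then show "x \<in> (\<Union>c\<in>Col. {x \<in> space M. t \<le> (\<Sum>j\<in>F c. U j x)})" using x by blast
  qed
  have ev: "{x \<in> space M. t \<le> (\<Sum>j\<in>F c. U j x)} \<in> events" for c
  proof -
    have "(\<lambda>x. \<Sum>j\<in>F c. U j x) \<in> borel_measurable M" using Um by (intro borel_measurable_sum)
    then show ?thesis by measurable
  qed
  have "prob {x \<in> space M. 2 ^ CARD('n) * t \<le> (\<Sum>i\<in>rect n. \<zeta> (Z i x))} \<le> prob (\<Union>c\<in>Col. {x \<in> space M. t \<le> (\<Sum>j\<in>F c. U j x)})"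
    using ev finCol by (intro finite_measure_mono sub) auto
  also have "\<dots> \<le> (\<Sum>c\<in>Col. prob {x \<in> space M. t \<le> (\<Sum>j\<in>F c. U j x)})"
    using ev finCol by (intro finite_measure_subadditive_finite) auto
  also have "\<dots> \<le> (\<Sum>c\<in>Col. exp (lam\<^sup>2 * v + 1 - lam * t) + 4 * (nhat n)\<^sup>2 * \<Phi> * chi (real p))"
    by (intro sum_mono main)
  also have "\<dots> = 2 ^ CARD('n) * (exp (lam\<^sup>2 * v + 1 - lam * t) + 4 * (nhat n)\<^sup>2 * \<Phi> * chi (real p))"
    by (simp add: cardCol)
  finally show ?thesis .
qed

section \<open>Covariances of localised functions\<close>

lemma sum_inverse_square_le: "(\<Sum>l<L. 1 / (1 + real l)\<^sup>2) \<le> 2"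
proof -
  have "(\<Sum>l<Suc L. 1 / (1 + real l)\<^sup>2) \<le> 2 - 1 / (1 + real L)" for L
  proof (induction L)
    case 0
    then show ?case by simp
  next
    case (Suc L)
    have "1 / (1 + real (Suc L))\<^sup>2 \<le> 1 / ((1 + real L) * (1 + real (Suc L)))"
      by (intro divide_left_mono) (auto simp: power2_eq_square)
    also have "\<dots> = 1 / (1 + real L) - 1 / (1 + real (Suc L))"
      by (simp add: field_simps)
    finally show ?case using Suc by simp
  qed
  from this[of L] have "(\<Sum>l<Suc L. 1 / (1 + real l)\<^sup>2) \<le> 2"
    by (rule order_trans) simp
  then show ?thesis by (simp add: add_nonneg_nonneg) (smt (verit) zero_le_divide_1_iff zero_le_power2)
qed

lemma sum_shifted_inverse_square_le: "(\<Sum>j\<in>{1..n}. 1 / (1 + \<bar>real m - real j\<bar>)\<^sup>2) \<le> 4"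
proof -
  have "(\<Sum>j\<in>{1..n}. 1 / (1 + \<bar>real m - real j\<bar>)\<^sup>2)
    = (\<Sum>j\<in>{j\<in>{1..n}. j \<le> m}. 1 / (1 + \<bar>real m - real j\<bar>)\<^sup>2) + (\<Sum>j\<in>{j\<in>{1..n}. \<not> j \<le> m}. 1 / (1 + \<bar>real m - real j\<bar>)\<^sup>2)"
    by (subst sum.union_disjoint[symmetric]) (auto intro!: sum.cong)
  also have "(\<Sum>j\<in>{j\<in>{1..n}. j \<le> m}. 1 / (1 + \<bar>real m - real j\<bar>)\<^sup>2) = (\<Sum>l\<in>(\<lambda>j. m - j) ` {j\<in>{1..n}. j \<le> m}. 1 / (1 + real l)\<^sup>2)"
    by (subst sum.reindex) (auto simp: inj_on_def of_nat_diff intro!: sum.cong)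
  also have "\<dots> \<le> (\<Sum>l<Suc m. 1 / (1 + real l)\<^sup>2)" by (intro sum_mono2) auto
  also have "\<dots> \<le> 2" by (rule sum_inverse_square_le)
  also have "(\<Sum>j\<in>{j\<in>{1..n}. \<not> j \<le> m}. 1 / (1 + \<bar>real m - real j\<bar>)\<^sup>2) = (\<Sum>l\<in>(\<lambda>j. j - m) ` {j\<in>{1..n}. \<not> j \<le> m}. 1 / (1 + real l)\<^sup>2)"
    by (subst sum.reindex) (auto simp: inj_on_def of_nat_diff intro!: sum.cong)
  also have "\<dots> \<le> (\<Sum>l<Suc n. 1 / (1 + real l)\<^sup>2)" by (intro sum_mono2) auto
  also have "\<dots> \<le> 2" by (rule sum_inverse_square_le)
  finally show ?thesis by simp
qed

text \<open>
  A summable majorant for the covariances. It is a product over the coordinates, so that sums over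
  boxes factorise.
\<close>

definition lattice_decay :: "nat ^ 'n::finite \<Rightarrow> nat ^ 'n \<Rightarrow> real" where
  "lattice_decay i j = (\<Prod>k\<in>UNIV. 1 / (1 + \<bar>real (i $ k) - real (j $ k)\<bar>)\<^sup>2)"

lemma sum_lattice_decay_le: "(\<Sum>j\<in>rect n. lattice_decay i j) \<le> 4 ^ CARD('n)"
  for n i :: "nat ^ 'n::finite"
proof -
  have "(\<Sum>j\<in>rect n. lattice_decay i j) = (\<Prod>k\<in>(UNIV :: 'n set). \<Sum>m\<in>{1..n $ k}. 1 / (1 + \<bar>real (i $ k) - real m\<bar>)\<^sup>2)"
    unfolding lattice_decay_def rect_eq
    by (subst sum_prod_vec[where a="\<lambda>k m. 1 / (1 + \<bar>real (i $ k) - real m\<bar>)\<^sup>2"]) auto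
  also have "\<dots> \<le> (\<Prod>k\<in>(UNIV :: 'n set). 4)"
    by (intro prod_mono conjI sum_nonneg sum_shifted_inverse_square_le) auto
  finally show ?thesis by simp
qed

lemma lattice_decay_ge:
  "1 / (1 + dist (lattice_point i) (lattice_point j)) ^ (2 * CARD('n)) \<le> lattice_decay i j"
  for i j :: "nat ^ 'n::finite"
proof -
  let ?\<delta> = "dist (lattice_point i) (lattice_point j)"
  have "1 / (1 + ?\<delta>) ^ (2 * CARD('n)) = (\<Prod>k\<in>(UNIV :: 'n set). 1 / (1 + ?\<delta>)\<^sup>2)"
    by (simp add: power_mult power_one_over)
  also have "\<dots> \<le> lattice_decay i j"
    unfolding lattice_decay_def
  proof (intro prod_mono conjI)
    fix k
    have "1 + \<bar>real (i $ k) - real (j $ k)\<bar> \<le> 1 + ?\<delta>"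
      using lattice_component_le_dist[of i k j] by simp
    then show "1 / (1 + ?\<delta>)\<^sup>2 \<le> 1 / (1 + \<bar>real (i $ k) - real (j $ k)\<bar>)\<^sup>2"
      by (intro frac_le power_mono) auto
  qed auto
  finally show ?thesis .
qed

locale polynomially_mixing_field = mixing_random_field M Z \<phi> chi
  for M :: "'a measure" and Z :: "nat ^ 'n::finite \<Rightarrow> 'a \<Rightarrow> 'b::topological_space"
    and \<phi> :: "nat \<Rightarrow> nat \<Rightarrow> real" and chi :: "real \<Rightarrow> real" +
  fixes \<beta> Cc T :: real
  assumes rate: "\<And>t. T \<le> t \<Longrightarrow> chi t \<le> Cc * t powr (- \<beta>)"

text \<open>
  The moment bounds of a function supported in a small ball, with \<open>a\<close> of the order of the mass of
  the ball: sites farther apart than \<open>D\<close> hit it jointly with probability of order \<open>a\<^sup>2\<close>, as independent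
  sites do. Closer pairs of sites satisfy only the trivial bound \<open>a\<close>.
\<close>

definition local_test ::
    "'a measure \<Rightarrow> (nat ^ 'n::finite \<Rightarrow> 'a \<Rightarrow> 'b::topological_space) \<Rightarrow> real \<Rightarrow> real \<Rightarrow> ('b \<Rightarrow> real) \<Rightarrow> bool" where
  "local_test M Z D a \<zeta> \<longleftrightarrow> \<zeta> \<in> borel_measurable borel \<and> (\<forall>z. \<bar>\<zeta> z\<bar> \<le> 1) \<and>
    (\<forall>i\<in>pos_index. (LINT x|M. \<zeta> (Z i x)) = (LINT x|M. \<zeta> (Z 1 x)) \<and> (LINT x|M. \<bar>\<zeta> (Z i x)\<bar>) \<le> a) \<and>
    (\<forall>i\<in>pos_index. \<forall>j\<in>pos_index. D < dist (lattice_point i) (lattice_point j) \<longrightarrow>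
       (LINT x|M. \<bar>\<zeta> (Z i x) * \<zeta> (Z j x)\<bar>) \<le> a\<^sup>2)"

definition centred_sum ::
    "'a measure \<Rightarrow> (nat ^ 'n::finite \<Rightarrow> 'a \<Rightarrow> 'b) \<Rightarrow> ('b \<Rightarrow> real) \<Rightarrow> nat ^ 'n \<Rightarrow> 'a \<Rightarrow> real" where
  "centred_sum M Z \<zeta> n x = (\<Sum>i\<in>rect n. \<zeta> (Z i x)) - nhat n * (LINT x|M. \<zeta> (Z 1 x))"

text \<open>
  The variance is of the same order \<open>a\<close> per site as for independent sites. Pairs of sites at a bounded
  distance contribute at most \<open>2 a\<close> each, and there are boundedly many of them per site. For the other pairs the covariance
  is at most \<open>2 a\<^sup>2\<close> and, by mixing, at most a multiple of \<open>dist powr (- \<beta>)\<close>; the geometric mean of the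
  two bounds is a multiple of \<open>a * dist powr (- \<beta> / 2)\<close>, which is summable when \<open>\<beta> \<ge> 4 N\<close>.
\<close>

lemma (in polynomially_mixing_field) local_covariance_sum_le:
  assumes \<beta>: "4 * real CARD('n) \<le> \<beta>"
  shows "\<exists>C2>0. \<forall>n \<zeta> a. 0 \<le> a \<longrightarrow> a \<le> 1 \<longrightarrow> local_test M Z D a \<zeta> \<longrightarrow>
      (\<Sum>i\<in>rect n. \<Sum>j\<in>rect n. \<bar>expectation (\<lambda>x. (\<zeta> (Z i x) - expectation (\<lambda>x. \<zeta> (Z 1 x))) * (\<zeta> (Z j x) - expectation (\<lambda>x. \<zeta> (Z 1 x))))\<bar>)
        \<le> C2 * a * nhat n"
proof -
  (* Beyond this distance the joint densities exist, chi has its polynomial rate, and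
     dist and 1 + dist are comparable. *)
  define D' where "D' = max (max D T) 1"
  define B where "B = 4 * \<phi> 1 1 * max Cc 0"
  define c where "c = 2 * (1 + D') ^ (2 * CARD('n)) + 2 ^ (2 * CARD('n)) * sqrt (2 * B)"
  have D'1: "1 \<le> D'" and B0: "0 \<le> B" using \<phi>_nonneg by (auto simp: D'_def B_def)
  have c0: "0 < c" unfolding c_def using D'1 B0 by (intro add_pos_nonneg) auto
  show ?thesis
  proof (intro exI[of _ "c * 4 ^ CARD('n)"] conjI allI impI)
    show "0 < c * 4 ^ CARD('n)" using c0 by simp
    fix n :: "nat ^ 'n" and \<zeta> :: "'b \<Rightarrow> real" and a :: real
    assume a: "0 \<le> a" "a \<le> 1" and test: "local_test M Z D a \<zeta>"
    define m where "m = expectation (\<lambda>x. \<zeta> (Z 1 x))"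
    have [measurable]: "\<zeta> \<in> borel_measurable borel" and \<zeta>1: "\<forall>z. \<bar>\<zeta> z\<bar> \<le> 1"
      and first: "\<forall>i\<in>pos_index. expectation (\<lambda>x. \<zeta> (Z i x)) = m \<and> expectation (\<lambda>x. \<bar>\<zeta> (Z i x)\<bar>) \<le> a"
      and joint: "\<forall>i\<in>pos_index. \<forall>j\<in>pos_index. D < dist (lattice_point i) (lattice_point j) \<longrightarrow>
          expectation (\<lambda>x. \<bar>\<zeta> (Z i x) * \<zeta> (Z j x)\<bar>) \<le> a\<^sup>2"
      using test unfolding local_test_def m_def by simp_all
    have cov: "\<bar>expectation (\<lambda>x. (\<zeta> (Z i x) - m) * (\<zeta> (Z j x) - m))\<bar> \<le> c * a * lattice_decay i j"
      if i: "i \<in> pos_index" and j: "j \<in> pos_index" for i j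
    proof -
      let ?\<delta> = "dist (lattice_point i) (lattice_point j)"
      have m\<zeta> [measurable]: "random_variable borel (\<lambda>x. \<zeta> (Z i x))" "random_variable borel (\<lambda>x. \<zeta> (Z j x))"
        using Z i j by (auto intro!: measurable_compose[OF _ \<open>\<zeta> \<in> borel_measurable borel\<close>])
      have [simp]: "integrable M (\<lambda>x. \<zeta> (Z i x))" "integrable M (\<lambda>x. \<zeta> (Z j x))"
        by (rule integrable_const_bound[where B=1]; use \<zeta>1 in auto)+
      have ab: "\<bar>\<zeta> (Z i x) * \<zeta> (Z j x)\<bar> \<le> \<bar>\<zeta> (Z i x)\<bar>" for x
        using \<zeta>1 mult_left_mono[of "\<bar>\<zeta> (Z j x)\<bar>" 1 "\<bar>\<zeta> (Z i x)\<bar>"] by (simp add: abs_mult)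
      have [simp]: "integrable M (\<lambda>x. \<zeta> (Z i x) * \<zeta> (Z j x))"
        by (rule integrable_const_bound[where B=1]) (use ab \<zeta>1 order_trans in \<open>fastforce intro!: AE_I2\<close>, measurable)
      have m_eq: "expectation (\<lambda>x. \<zeta> (Z i x)) = m" "expectation (\<lambda>x. \<zeta> (Z j x)) = m" using first i j by auto
      have "(\<lambda>x. (\<zeta> (Z i x) - m) * (\<zeta> (Z j x) - m)) = (\<lambda>x. \<zeta> (Z i x) * \<zeta> (Z j x) - m * \<zeta> (Z i x) - m * \<zeta> (Z j x) + m * m)"
        by (simp add: algebra_simps)
      then have eq: "expectation (\<lambda>x. (\<zeta> (Z i x) - m) * (\<zeta> (Z j x) - m)) = expectation (\<lambda>x. \<zeta> (Z i x) * \<zeta> (Z j x)) - m * m"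
        using m_eq by (simp add: prob_space)
      have mabs: "\<bar>m\<bar> \<le> a"
        unfolding m_eq(1)[symmetric] using first i by (intro order_trans[OF integral_abs_bound]) auto
      have mm: "\<bar>m * m\<bar> \<le> a\<^sup>2"
        unfolding abs_mult power2_eq_square using mabs by (intro mult_mono) auto
      have a2: "a\<^sup>2 \<le> a" using a by (simp add: power2_eq_square mult_left_le)
      have tri: "\<bar>expectation (\<lambda>x. (\<zeta> (Z i x) - m) * (\<zeta> (Z j x) - m))\<bar> \<le> expectation (\<lambda>x. \<bar>\<zeta> (Z i x) * \<zeta> (Z j x)\<bar>) + a\<^sup>2"
        unfolding eq using mm integral_abs_bound[of M "\<lambda>x. \<zeta> (Z i x) * \<zeta> (Z j x)"] by linarith
      have \<delta>0: "0 \<le> ?\<delta>" by simp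
      show ?thesis
      proof (cases "?\<delta> \<le> D'")
        case True
        have "expectation (\<lambda>x. \<bar>\<zeta> (Z i x) * \<zeta> (Z j x)\<bar>) \<le> expectation (\<lambda>x. \<bar>\<zeta> (Z i x)\<bar>)"
          by (rule integral_mono) (use ab in auto)
        also have "\<dots> \<le> a" using first i by auto
        finally have "\<bar>expectation (\<lambda>x. (\<zeta> (Z i x) - m) * (\<zeta> (Z j x) - m))\<bar> \<le> 2 * a * 1" using tri a2 by simp
        also have "\<dots> \<le> 2 * a * ((1 + D') ^ (2 * CARD('n)) * (1 / (1 + ?\<delta>) ^ (2 * CARD('n))))"
        proof (rule mult_left_mono)
          have "(1 + ?\<delta>) ^ (2 * CARD('n)) \<le> (1 + D') ^ (2 * CARD('n))" using True by (intro power_mono) auto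
          moreover have "0 < (1 + ?\<delta>) ^ (2 * CARD('n))" by (intro zero_less_power add_pos_nonneg) auto
          ultimately show "1 \<le> (1 + D') ^ (2 * CARD('n)) * (1 / (1 + ?\<delta>) ^ (2 * CARD('n)))" by simp
        qed (use a in auto)
        also have "\<dots> \<le> 2 * a * ((1 + D') ^ (2 * CARD('n)) * lattice_decay i j)"
          using a D'1 by (intro mult_left_mono lattice_decay_ge) auto
        also have "\<dots> = (2 * (1 + D') ^ (2 * CARD('n))) * (a * lattice_decay i j)" by simp
        also have "\<dots> \<le> c * (a * lattice_decay i j)"
          unfolding c_def using a B0 by (intro mult_right_mono) (auto simp: lattice_decay_def intro!: mult_nonneg_nonneg prod_nonneg)
        finally show ?thesis by (simp add: mult_ac)
      next
        case False
        then have \<delta>: "D < ?\<delta>" "T \<le> ?\<delta>" "1 \<le> ?\<delta>" by (auto simp: D'_def)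
        let ?V = "\<bar>expectation (\<lambda>x. (\<zeta> (Z i x) - m) * (\<zeta> (Z j x) - m))\<bar>"
        have V1: "?V \<le> 2 * a\<^sup>2" using tri joint i j \<delta>(1) by fastforce
        have "?V \<le> 4 * (\<phi> 1 1 * chi ?\<delta>)"
        proof -
          have "\<bar>expectation (\<lambda>x. \<zeta> (Z i x) * \<zeta> (Z j x)) - expectation (\<lambda>x. \<zeta> (Z i x)) * expectation (\<lambda>x. \<zeta> (Z j x))\<bar> \<le> 4 * (\<phi> 1 1 * chi ?\<delta>)"
          proof (rule covariance_bound_from_events)
            fix J J' :: "real set" assume J: "J \<in> sets borel" "J' \<in> sets borel"
            have A: "{x \<in> space M. \<zeta> (Z i x) \<in> J} \<in> gen_events M Z {i}"
              using sum_preimage_in_gen_events[OF \<open>\<zeta> \<in> borel_measurable borel\<close> J(1), of "{i}" "{i}" M Z] by simp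
            have B: "{x \<in> space M. \<zeta> (Z j x) \<in> J'} \<in> gen_events M Z {j}"
              using sum_preimage_in_gen_events[OF \<open>\<zeta> \<in> borel_measurable borel\<close> J(2), of "{j}" "{j}" M Z] by simp
            have "{x \<in> space M. \<zeta> (Z i x) \<in> J \<and> \<zeta> (Z j x) \<in> J'} = {x \<in> space M. \<zeta> (Z i x) \<in> J} \<inter> {x \<in> space M. \<zeta> (Z j x) \<in> J'}"
              by auto
            then show "\<bar>prob {x \<in> space M. \<zeta> (Z i x) \<in> J \<and> \<zeta> (Z j x) \<in> J'} - prob {x \<in> space M. \<zeta> (Z i x) \<in> J} * prob {x \<in> space M. \<zeta> (Z j x) \<in> J'}\<bar>
               \<le> \<phi> 1 1 * chi ?\<delta>"
              using mixing_bound_separated[OF _ _ _ _ \<delta>0 _ A B] i j by simp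
          qed (use \<zeta>1 in auto)
          then show ?thesis unfolding eq using m_eq by simp
        qed
        also have "\<dots> \<le> 4 * (\<phi> 1 1 * (max Cc 0 * ?\<delta> powr (- \<beta>)))"
        proof -
          have "chi ?\<delta> \<le> Cc * ?\<delta> powr (- \<beta>)" by (rule rate[OF \<delta>(2)])
          also have "\<dots> \<le> max Cc 0 * ?\<delta> powr (- \<beta>)" by (intro mult_right_mono) auto
          finally show ?thesis using \<phi>_nonneg by (intro mult_left_mono) auto
        qed
        also have "\<dots> = B * ?\<delta> powr (- \<beta>)" by (simp add: B_def)
        also have "\<dots> \<le> B * ?\<delta> powr (- (4 * real CARD('n)))"
          using B0 \<beta> \<delta>(3) by (intro mult_left_mono powr_mono) auto
        also have "?\<delta> powr (- (4 * real CARD('n))) = (1 / ?\<delta> ^ (2 * CARD('n)))\<^sup>2"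
        proof -
          have "?\<delta> powr (4 * real CARD('n)) = ?\<delta> ^ (4 * CARD('n))"
          proof -
            have "0 < ?\<delta>" using \<delta>(3) by linarith
            from powr_realpow[OF this, of "4 * CARD('n)"] show ?thesis by simp
          qed
          also have "\<dots> = (?\<delta> ^ (2 * CARD('n)))\<^sup>2" by (simp add: power_mult[symmetric] mult.commute)
          finally show ?thesis by (simp add: powr_minus_divide power_one_over)
        qed
        finally have V2: "?V \<le> B * (1 / ?\<delta> ^ (2 * CARD('n)))\<^sup>2" .
        (* The geometric mean of the bounds V1 and V2. *)
        have "?V\<^sup>2 \<le> (2 * a\<^sup>2) * (B * (1 / ?\<delta> ^ (2 * CARD('n)))\<^sup>2)"
          unfolding power2_eq_square[of ?V] using V1 V2 B0 by (intro mult_mono) auto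
        also have "\<dots> = (sqrt (2 * B) * a * (1 / ?\<delta> ^ (2 * CARD('n))))\<^sup>2"
          using B0 by (simp add: power_mult_distrib power_divide)
        finally have "?V \<le> sqrt (2 * B) * a * (1 / ?\<delta> ^ (2 * CARD('n)))"
          by (rule power2_le_imp_le) (use a B0 in auto)
        also have "\<dots> \<le> sqrt (2 * B) * a * (2 ^ (2 * CARD('n)) * (1 / (1 + ?\<delta>) ^ (2 * CARD('n))))"
        proof (rule mult_left_mono)
          have "(1 + ?\<delta>) ^ (2 * CARD('n)) \<le> (2 * ?\<delta>) ^ (2 * CARD('n))" using \<delta>(3) by (intro power_mono) auto
          also have "\<dots> = 2 ^ (2 * CARD('n)) * ?\<delta> ^ (2 * CARD('n))" by (rule power_mult_distrib)
          finally have "(1 + ?\<delta>) ^ (2 * CARD('n)) \<le> 2 ^ (2 * CARD('n)) * ?\<delta> ^ (2 * CARD('n))" .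
          moreover have "0 < (1 + ?\<delta>) ^ (2 * CARD('n))" "0 < ?\<delta> ^ (2 * CARD('n))" using \<delta>(3) by (intro zero_less_power; linarith)+
          ultimately show "1 / ?\<delta> ^ (2 * CARD('n)) \<le> 2 ^ (2 * CARD('n)) * (1 / (1 + ?\<delta>) ^ (2 * CARD('n)))"
            by (simp add: divide_simps mult_ac)
        qed (use a B0 in auto)
        also have "\<dots> \<le> sqrt (2 * B) * a * (2 ^ (2 * CARD('n)) * lattice_decay i j)"
          using a B0 by (intro mult_left_mono lattice_decay_ge) auto
        also have "\<dots> = (2 ^ (2 * CARD('n)) * sqrt (2 * B)) * (a * lattice_decay i j)" by simp
        also have "\<dots> \<le> c * (a * lattice_decay i j)"
          unfolding c_def using a D'1 by (intro mult_right_mono) (auto simp: lattice_decay_def intro!: mult_nonneg_nonneg prod_nonneg)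
        finally show ?thesis by (simp add: mult_ac)
      qed
    qed
    have "(\<Sum>i\<in>rect n. \<Sum>j\<in>rect n. \<bar>expectation (\<lambda>x. (\<zeta> (Z i x) - m) * (\<zeta> (Z j x) - m))\<bar>)
       \<le> (\<Sum>i\<in>rect n. \<Sum>j\<in>rect n. c * a * lattice_decay i j)"
      using rect_subset_pos by (intro sum_mono cov) auto
    also have "\<dots> = (\<Sum>i\<in>rect n. c * a * (\<Sum>j\<in>rect n. lattice_decay i j))"
      by (simp add: sum_distrib_left)
    also have "\<dots> \<le> (\<Sum>i\<in>rect n. c * a * 4 ^ CARD('n))"
      using c0 a by (intro sum_mono mult_left_mono sum_lattice_decay_le) auto
    also have "\<dots> = c * 4 ^ CARD('n) * a * nhat n" by (simp add: card_rect)
    finally show "(\<Sum>i\<in>rect n. \<Sum>j\<in>rect n. \<bar>expectation (\<lambda>x. (\<zeta> (Z i x) - expectation (\<lambda>x. \<zeta> (Z 1 x))) * (\<zeta> (Z j x) - expectation (\<lambda>x. \<zeta> (Z 1 x))))\<bar>)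
        \<le> c * 4 ^ CARD('n) * a * nhat n"
      unfolding m_def .
  qed
qed

text \<open>
  The factor 2 comes from applying the one-sided inequality to both signs of the centred function.
\<close>

lemma (in polynomially_mixing_field) local_field_deviation_le:
  assumes \<beta>: "4 * real CARD('n) \<le> \<beta>"
  shows "\<exists>C2>0. \<forall>n \<zeta> a \<Phi> p lam t. n \<in> pos_index \<longrightarrow> 0 \<le> a \<longrightarrow> a \<le> 1 \<longrightarrow> local_test M Z D a \<zeta> \<longrightarrow>
      0 \<le> \<Phi> \<longrightarrow> mixing_size_bound \<phi> n \<Phi> \<longrightarrow> 1 \<le> p \<longrightarrow> 0 < lam \<longrightarrow> lam * (2 * real p ^ CARD('n)) \<le> 1 \<longrightarrow>
      prob {x \<in> space M. 2 ^ CARD('n) * t \<le> \<bar>centred_sum M Z \<zeta> n x\<bar>}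
        \<le> 2 * 2 ^ CARD('n) * (exp (lam\<^sup>2 * (C2 * a * nhat n) + 1 - lam * t) + 4 * (nhat n)\<^sup>2 * \<Phi> * chi (real p))"
proof -
  obtain C2 where "0 < C2 \<and> (\<forall>n \<zeta> a. 0 \<le> a \<longrightarrow> a \<le> 1 \<longrightarrow> local_test M Z D a \<zeta> \<longrightarrow>
      (\<Sum>i\<in>rect n. \<Sum>j\<in>rect n. \<bar>expectation (\<lambda>x. (\<zeta> (Z i x) - expectation (\<lambda>x. \<zeta> (Z 1 x))) * (\<zeta> (Z j x) - expectation (\<lambda>x. \<zeta> (Z 1 x))))\<bar>)
        \<le> C2 * a * nhat n)"
    using local_covariance_sum_le[OF \<beta>] by (rule exE)
  then have C2: "0 < C2" and cov: "\<And>n \<zeta> a. 0 \<le> a \<Longrightarrow> a \<le> 1 \<Longrightarrow> local_test M Z D a \<zeta> \<Longrightarrow>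
      (\<Sum>i\<in>rect n. \<Sum>j\<in>rect n. \<bar>expectation (\<lambda>x. (\<zeta> (Z i x) - expectation (\<lambda>x. \<zeta> (Z 1 x))) * (\<zeta> (Z j x) - expectation (\<lambda>x. \<zeta> (Z 1 x))))\<bar>)
        \<le> C2 * a * nhat n" by simp_all
  show ?thesis
  proof (intro exI[of _ C2] conjI allI impI)
    show "0 < C2" by (rule C2)
    fix n :: "nat ^ 'n" and \<zeta> :: "'b \<Rightarrow> real" and a \<Phi> lam t :: real and p :: nat
    assume n: "n \<in> pos_index" and a: "0 \<le> a" "a \<le> 1" and test: "local_test M Z D a \<zeta>"
      and \<Phi>: "0 \<le> \<Phi>" "mixing_size_bound \<phi> n \<Phi>" and p: "1 \<le> p" and lam: "0 < lam" "lam * (2 * real p ^ CARD('n)) \<le> 1"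
    define m where "m = expectation (\<lambda>x. \<zeta> (Z 1 x))"
    note v = cov[OF a test, of n, folded m_def]
    have m\<zeta> [measurable]: "\<zeta> \<in> borel_measurable borel" and \<zeta>1: "\<forall>z. \<bar>\<zeta> z\<bar> \<le> 1"
      and first: "\<forall>i\<in>pos_index. expectation (\<lambda>x. \<zeta> (Z i x)) = m \<and> expectation (\<lambda>x. \<bar>\<zeta> (Z i x)\<bar>) \<le> a"
      using test unfolding local_test_def m_def by simp_all
    have cs: "centred_sum M Z \<zeta> n x = (\<Sum>i\<in>rect n. \<zeta> (Z i x)) - nhat n * m" for x
      by (simp add: centred_sum_def m_def)
    have m\<zeta>Z [measurable]: "random_variable borel (\<lambda>x. \<zeta> (Z i x))" if "i \<in> pos_index" for i
      using Z[OF that] by (rule measurable_compose) fact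
    have i\<zeta>: "integrable M (\<lambda>x. \<zeta> (Z i x))" if "i \<in> pos_index" for i
      by (rule integrable_const_bound[where B=1]) (use \<zeta>1 m\<zeta>Z[OF that] in auto)
    have one: "1 \<in> (pos_index :: (nat ^ 'n) set)" by (simp add: pos_index_def)
    have m1: "\<bar>m\<bar> \<le> 1"
    proof -
      have "expectation (\<lambda>x. \<zeta> (Z 1 x)) = m" "expectation (\<lambda>x. \<bar>\<zeta> (Z 1 x)\<bar>) \<le> 1"
        using first one a by (blast intro: order_trans)+
      then show ?thesis using integral_abs_bound[of M "\<lambda>x. \<zeta> (Z 1 x)"] by linarith
    qed
    define b where "b = exp (lam\<^sup>2 * (C2 * a * nhat n) + 1 - lam * t) + 4 * (nhat n)\<^sup>2 * \<Phi> * chi (real p)"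
    have s: "prob {x \<in> space M. 2 ^ CARD('n) * t \<le> (\<Sum>i\<in>rect n. \<sigma> * (\<zeta> (Z i x) - m))} \<le> 2 ^ CARD('n) * b"
      if \<sigma>: "\<sigma> = 1 \<or> \<sigma> = -1" for \<sigma> :: real
      unfolding b_def
    proof (rule prob_field_sum_ge_le[where \<zeta>="\<lambda>z. \<sigma> * (\<zeta> z - m)"])
      show "\<bar>\<sigma> * (\<zeta> z - m)\<bar> \<le> 2" for z
        using \<sigma> \<zeta>1[rule_format, of z] m1 by auto
      show "expectation (\<lambda>x. \<sigma> * (\<zeta> (Z i x) - m)) = 0" if "i \<in> rect n" for i
        using that rect_subset_pos[of n] first i\<zeta>[of i] by (auto simp: prob_space)
      have ss: "\<sigma> * u * (\<sigma> * w) = u * w" for u w using \<sigma> by auto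
      show "(\<Sum>i\<in>rect n. \<Sum>j\<in>rect n. \<bar>expectation (\<lambda>x. \<sigma> * (\<zeta> (Z i x) - m) * (\<sigma> * (\<zeta> (Z j x) - m)))\<bar>) \<le> C2 * a * nhat n"
        unfolding ss by (rule v)
    qed (use \<Phi> p lam n in auto)
    let ?E = "\<lambda>\<sigma>. {x \<in> space M. 2 ^ CARD('n) * t \<le> (\<Sum>i\<in>rect n. \<sigma> * (\<zeta> (Z i x) - m))}"
    have ev: "?E \<sigma> \<in> events" for \<sigma>
    proof -
      have "(\<lambda>x. \<Sum>i\<in>rect n. \<sigma> * (\<zeta> (Z i x) - m)) \<in> borel_measurable M"
      proof (rule borel_measurable_sum)
        fix i assume "i \<in> rect n"
        then have "i \<in> pos_index" using rect_subset_pos by auto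
        then show "random_variable borel (\<lambda>x. \<sigma> * (\<zeta> (Z i x) - m))" by measurable
      qed
      then show ?thesis by measurable
    qed
    have "{x \<in> space M. 2 ^ CARD('n) * t \<le> \<bar>centred_sum M Z \<zeta> n x\<bar>} \<subseteq> ?E 1 \<union> ?E (-1)"
      by (auto simp: cs sum_subtractf card_rect sum_negf abs_real_def split: if_splits)
    then have "prob {x \<in> space M. 2 ^ CARD('n) * t \<le> \<bar>centred_sum M Z \<zeta> n x\<bar>} \<le> prob (?E 1 \<union> ?E (-1))"
      by (rule finite_measure_mono[OF _ sets.Un[OF ev ev]])
    also have "\<dots> \<le> prob (?E 1) + prob (?E (-1))" using ev by (intro measure_Un_le)
    also have "\<dots> \<le> 2 * 2 ^ CARD('n) * b" using s[of 1] s[of "-1"] by simp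
    finally show "prob {x \<in> space M. 2 ^ CARD('n) * t \<le> \<bar>centred_sum M Z \<zeta> n x\<bar>}
        \<le> 2 * 2 ^ CARD('n) * (exp (lam\<^sup>2 * (C2 * a * nhat n) + 1 - lam * t) + 4 * (nhat n)\<^sup>2 * \<Phi> * chi (real p))"
      unfolding b_def .
  qed
qed

section \<open>The bandwidth conditions\<close>

lemma nhat_ge_component:
  fixes n :: "nat ^ 'n::finite"
  assumes "n \<in> pos_index"
  shows "real (n $ k) \<le> nhat n"
proof -
  have "real (n $ k) * 1 \<le> real (n $ k) * (\<Prod>j\<in>UNIV - {k}. real (n $ j))"
    using assms by (intro mult_left_mono prod_ge_1) (auto simp: pos_index_def)
  also have "\<dots> = nhat n" unfolding nhat_def by (subst prod.remove[of UNIV k]) auto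
  finally show ?thesis by simp
qed

lemma eventually_pos_index: "eventually (\<lambda>n. n \<in> pos_index) (multi_at_top :: (nat ^ 'n::finite) filter)"
  unfolding eventually_multi_at_top pos_index_def by blast

lemma filterlim_nhat: "filterlim nhat at_top (multi_at_top :: (nat ^ 'n::finite) filter)"
  unfolding filterlim_at_top eventually_multi_at_top
proof (intro allI)
  fix Z :: real
  show "\<exists>m. \<forall>n :: nat ^ 'n. (\<forall>k. m \<le> n $ k) \<longrightarrow> Z \<le> nhat n"
  proof (intro exI allI impI)
    fix n :: "nat ^ 'n" assume n: "\<forall>k. max 1 (nat \<lceil>Z\<rceil>) \<le> n $ k"
    then have "n \<in> pos_index" by (auto simp: pos_index_def)
    from nhat_ge_component[OF this, of undefined] n[rule_format, of undefined] show "Z \<le> nhat n" by linarith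
  qed
qed

lemma eventually_u_fun_ge_1: 
  assumes "0 < \<epsilon>"
  shows "eventually (\<lambda>n. 1 \<le> u_fun \<epsilon> n) (multi_at_top :: (nat ^ 'n::finite) filter)"
proof -
  have "eventually (\<lambda>x::real. 1 \<le> ln x \<and> 1 \<le> ln (ln x)) at_top"
    by (intro eventually_conj; real_asymp)
  then obtain x0 :: real where x0: "\<And>x. x0 \<le> x \<Longrightarrow> 1 \<le> ln x \<and> 1 \<le> ln (ln x)"
    unfolding eventually_at_top_linorder by blast
  show ?thesis
    unfolding eventually_multi_at_top
  proof (intro exI allI impI)
    fix n :: "nat ^ 'n" assume n: "\<forall>k. nat \<lceil>x0\<rceil> \<le> n $ k"
    show "1 \<le> u_fun \<epsilon> n"
      unfolding u_fun_def
    proof (rule prod_ge_1)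
      fix k
      have "x0 \<le> real (n $ k)" using n[rule_format, of k] by linarith
      from x0[OF this] have l: "1 \<le> ln (real (n $ k))" "1 \<le> ln (ln (real (n $ k)))" by auto
      then have "1 \<le> ln (ln (real (n $ k))) powr (1 + \<epsilon>)" using assms by (intro ge_one_powr_ge_zero) auto
      then show "1 \<le> ln (real (n $ k)) * ln (ln (real (n $ k))) powr (1 + \<epsilon>)"
        using l mult_mono[of 1 "ln (real (n $ k))" 1 "ln (ln (real (n $ k))) powr (1 + \<epsilon>)"] by simp
    qed
  qed
qed

text \<open>
  The growth condition in logarithmic form: \<open>a\<close> and \<open>l\<close> are the logarithm and the iterated logarithm
  of the number of sites, \<open>H = - ln h\<close>, \<open>W = - ln \<Omega>\<close>, \<open>U = ln u\<close> and \<open>D = d + 1\<close>. The first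
  assumption is the definition of \<open>\<Omega>\<close>. With \<open>b = \<beta> / N\<close>, eliminating \<open>U\<close> and \<open>a\<close> leaves
  \<open>3 l + 4 W - (b + 2 (D - 1)\<^sup>2) H\<close>, where \<open>b > D + 4 \<ge> 6\<close> makes the coefficient of \<open>H\<close> at least 8.
\<close>

lemma log_bandwidth_bound_a:
  fixes a l H W U D N \<beta> \<delta> :: real
  assumes a: "a = l + (D - 1) * H + 2 * W" and W: "W \<le> H" and l: "l \<le> H" and H: "0 \<le> H"
    and D: "2 \<le> D" and N: "0 < N" and \<delta>: "\<delta> = \<beta> - N * (D + 4)" "0 < \<delta>"
    and grow: "0 \<le> a - (N * D * (D + 1) + D * \<beta>) / \<delta> * H + (N * (D + 1) - \<beta>) / \<delta> * l - 2 * N / \<delta> * U"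
  shows "3 * a + U + D * (H + W) \<le> \<beta> / N * W"
proof -
  define b where "b = \<beta> / N"
  have \<beta>: "\<beta> = N * b" using N by (simp add: b_def)
  have b: "D + 4 < b" using \<delta> N by (simp add: \<beta>)
  have "0 \<le> \<delta> * (a - (N * D * (D + 1) + D * \<beta>) / \<delta> * H + (N * (D + 1) - \<beta>) / \<delta> * l - 2 * N / \<delta> * U)"
    using grow \<delta> by (intro mult_nonneg_nonneg) auto
  also have "\<dots> = \<delta> * a - (N * D * (D + 1) + D * \<beta>) * H + (N * (D + 1) - \<beta>) * l - 2 * N * U"
    using \<delta>(2) by (simp add: field_simps)
  also have "\<dots> = N * ((b - D - 4) * a - (D * (D + 1) + D * b) * H + (D + 1 - b) * l - 2 * U)"
    unfolding \<delta>(1) \<beta> by (simp add: algebra_simps)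
  finally have "0 \<le> (b - D - 4) * a - (D * (D + 1) + D * b) * H + (D + 1 - b) * l - 2 * U"
    using N by (simp add: zero_le_mult_iff)
  then have "2 * (3 * a + U + D * (H + W) - b * W) \<le> 6 * a + (b - D - 4) * a - (D * (D + 1) + D * b) * H + (D + 1 - b) * l + 2 * D * (H + W) - 2 * b * W"
    by (simp add: algebra_simps)
  also have "\<dots> = 3 * l + 4 * W - (b + 2 * (D - 1)\<^sup>2) * H"
    unfolding a by (simp add: algebra_simps power2_eq_square)
  also have "\<dots> \<le> 3 * H + 4 * H - (6 + 2 * 1) * H"
  proof -
    have "1 \<le> (D - 1)\<^sup>2" using D one_le_power[of "D - 1" 2] by simp
    then have "6 + 2 * 1 \<le> b + 2 * (D - 1)\<^sup>2" using b D by linarith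
    then have "(6 + 2 * 1) * H \<le> (b + 2 * (D - 1)\<^sup>2) * H" using H by (rule mult_right_mono)
    then show ?thesis using W l by linarith
  qed
  also have "\<dots> \<le> 0" using H by simp
  finally show ?thesis by (simp add: b_def)
qed

text \<open>
  The same elimination leaves \<open>3 l + 6 W - (b + 2 (D - 1)\<^sup>2) H\<close> here, and now \<open>b > D + 3 + 2 \<kappa> \<ge> 7\<close>.
\<close>

lemma log_bandwidth_bound_b:
  fixes a l H W U D N \<beta> \<delta> \<kappa> :: real
  assumes a: "a = l + (D - 1) * H + 2 * W" and W: "W \<le> H" and l: "l \<le> H" and H: "0 \<le> H"
    and D: "2 \<le> D" and N: "0 < N" and \<kappa>: "1 \<le> \<kappa>" and \<delta>: "\<delta> = \<beta> - N * (D + 3 + 2 * \<kappa>)" "0 < \<delta>"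
    and grow: "0 \<le> a - (N * (D\<^sup>2 + 2 * D - 1) + D * \<beta>) / \<delta> * H + (N * D - \<beta>) / \<delta> * l - 2 * N / \<delta> * U"
  shows "(3 + \<kappa>) * a + U + D * (H + W) \<le> \<beta> / N * W"
proof -
  define b where "b = \<beta> / N"
  have \<beta>: "\<beta> = N * b" using N by (simp add: b_def)
  have b: "D + 3 + 2 * \<kappa> < b" using \<delta> N by (simp add: \<beta>)
  have "0 \<le> \<delta> * (a - (N * (D\<^sup>2 + 2 * D - 1) + D * \<beta>) / \<delta> * H + (N * D - \<beta>) / \<delta> * l - 2 * N / \<delta> * U)"
    using grow \<delta> by (intro mult_nonneg_nonneg) auto
  also have "\<dots> = \<delta> * a - (N * (D\<^sup>2 + 2 * D - 1) + D * \<beta>) * H + (N * D - \<beta>) * l - 2 * N * U"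
    using \<delta>(2) by (simp add: field_simps)
  also have "\<dots> = N * ((b - D - 3 - 2 * \<kappa>) * a - (D\<^sup>2 + 2 * D - 1 + D * b) * H + (D - b) * l - 2 * U)"
    unfolding \<delta>(1) \<beta> by (simp add: algebra_simps)
  finally have "0 \<le> (b - D - 3 - 2 * \<kappa>) * a - (D\<^sup>2 + 2 * D - 1 + D * b) * H + (D - b) * l - 2 * U"
    using N by (simp add: zero_le_mult_iff)
  then have "2 * ((3 + \<kappa>) * a + U + D * (H + W) - b * W) \<le> 2 * (3 + \<kappa>) * a + (b - D - 3 - 2 * \<kappa>) * a - (D\<^sup>2 + 2 * D - 1 + D * b) * H + (D - b) * l + 2 * D * (H + W) - 2 * b * W"
    by (simp add: algebra_simps)
  also have "\<dots> = 3 * l + 6 * W - (b + 2 * (D - 1)\<^sup>2) * H"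
    unfolding a by (simp add: algebra_simps power2_eq_square)
  also have "\<dots> \<le> 3 * H + 6 * H - (7 + 2 * 1) * H"
  proof -
    have "1 \<le> (D - 1)\<^sup>2" using D one_le_power[of "D - 1" 2] by simp
    then have "7 + 2 * 1 \<le> b + 2 * (D - 1)\<^sup>2" using b D \<kappa> by linarith
    then have "(7 + 2 * 1) * H \<le> (b + 2 * (D - 1)\<^sup>2) * H" using H by (rule mult_right_mono)
    then show ?thesis using W l by linarith
  qed
  also have "\<dots> \<le> 0" using H by simp
  finally show ?thesis by (simp add: b_def)
qed

text \<open>
  What the conditions on the bandwidth are for. The upper one gives \<open>h \<le> \<Omega>\<close>, so that errors of order
  \<open>h\<close> are admissible. The last inequality of the third part says that \<open>(h \<Omega>) powr (- (d + 1))\<close>, the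
  size of the grid, times the mixing error \<open>nhat powr (2 + \<kappa>) * \<Omega> powr (\<beta> / N)\<close> for
  blocks of side \<open>\<Omega> powr (- 1 / N)\<close>, is at most \<open>1 / (nhat * u)\<close>. It also forces \<open>\<Omega>\<close> to decay like
  a power of the number of sites.
\<close>

lemma bandwidth_consequences:
  fixes h :: "nat ^ 'n::finite \<Rightarrow> real" and d :: nat
  assumes d: "1 \<le> d" and eps: "0 < \<epsilon>"
    and h_pos: "\<forall>n\<in>pos_index. h n > 0"
    and h_lim: "(h \<longlongrightarrow> 0) multi_at_top"
    and h_upper: "((\<lambda>n. nhat n * h n ^ (d + 2) / ln (nhat n)) \<longlongrightarrow> 0) multi_at_top"
    and h_lower: "bandwidth_cond_a d \<phi> \<beta> \<epsilon> h \<or> bandwidth_cond_b d \<phi> \<beta> \<epsilon> h"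
  shows "4 * real CARD('n) \<le> \<beta>"
    and "(Omega d h \<longlongrightarrow> 0) multi_at_top"
    and "\<exists>\<kappa>\<ge>0. \<exists>C\<ge>0.
      (\<forall>n\<in>(pos_index :: (nat ^ 'n) set). mixing_size_bound \<phi> n (C * nhat n powr \<kappa>)) \<and>
      eventually (\<lambda>n. n \<in> pos_index \<and> 1 \<le> ln (nhat n) \<and> h n < 1 \<and> h n \<le> Omega d h n \<and> Omega d h n \<le> 1 \<and> 1 \<le> u_fun \<epsilon> n \<and>
         nhat n powr (3 + \<kappa>) * u_fun \<epsilon> n * (h n * Omega d h n) powr (- (real d + 1))
           * Omega d h n powr (\<beta> / real CARD('n)) \<le> 1) multi_at_top"
proof -
  define N where "N = real CARD('n)"
  define D where "D = real d + 1"
  have N: "1 \<le> N" unfolding N_def by (simp add: Suc_leI)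
  have D: "2 \<le> D" using d by (simp add: D_def)
  let ?\<Omega> = "Omega d h"
  let ?good = "\<lambda>n. n \<in> pos_index \<and> 1 \<le> ln (nhat n) \<and> h n < 1 \<and> h n \<le> ?\<Omega> n \<and> 1 \<le> u_fun \<epsilon> n \<and> ln (ln (nhat n)) \<le> - ln (h n)"
  have large: "eventually (\<lambda>n :: nat ^ 'n. P (nhat n)) multi_at_top" if "eventually P at_top" for P
    using that filterlim_nhat by (rule eventually_compose_filterlim)
  have l1: "eventually (\<lambda>n :: nat ^ 'n. 1 \<le> ln (nhat n) \<and> (real d + 3) * ln (ln (nhat n)) \<le> ln (nhat n)) multi_at_top"
    by (rule large, intro eventually_conj; real_asymp)
  have h1: "eventually (\<lambda>n. h n < 1) multi_at_top"
    using h_lim by (rule order_tendstoD) simp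
  have up1: "eventually (\<lambda>n. nhat n * h n ^ (d + 2) / ln (nhat n) < 1) multi_at_top"
    using h_upper by (rule order_tendstoD) simp
  have good: "eventually ?good multi_at_top"
    using eventually_pos_index l1 h1 up1 eventually_u_fun_ge_1[OF eps]
  proof eventually_elim
    case (elim n)
    then have n: "n \<in> pos_index" and L: "1 \<le> ln (nhat n)" and hn: "0 < h n" "h n < 1" using h_pos by auto
    have nh: "0 < nhat n" using n by (auto simp: nhat_def pos_index_def Suc_le_eq intro!: prod_pos)
    have le: "nhat n * h n ^ (d + 2) \<le> ln (nhat n)"
      using elim(4) L by (simp add: divide_less_eq split: if_splits)
    have "(h n)\<^sup>2 \<le> ln (nhat n) / (nhat n * h n ^ d)"
      using le hn nh by (simp add: pos_le_divide_eq power_add mult_ac power2_eq_square)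
    then have "h n \<le> ?\<Omega> n" unfolding Omega_def using hn by (intro real_le_rsqrt)
    moreover have "ln (ln (nhat n)) \<le> - ln (h n)"
    proof -
      have "ln (nhat n * h n ^ (d + 2)) \<le> ln (ln (nhat n))"
      proof (subst ln_le_cancel_iff)
        show "0 < ln (nhat n)" using L by linarith
      qed (use le nh hn in auto)
      then have "ln (nhat n) + (real d + 2) * ln (h n) \<le> ln (ln (nhat n))"
        using nh hn by (simp add: ln_mult ln_realpow distrib_right power_add)
      then have "(real d + 2) * ln (ln (nhat n)) \<le> (real d + 2) * (- ln (h n))"
        using elim(2) by (simp add: algebra_simps)
      then show ?thesis by (subst (asm) mult_le_cancel_left_pos) auto
    qed
    ultimately show ?case using elim by auto
  qed
  have logs: "ln (nhat n) = ln (ln (nhat n)) + (D - 1) * (- ln (h n)) + 2 * (- ln (?\<Omega> n)) \<and> 0 < h n \<and> 0 < ?\<Omega> n \<and> 1 < nhat n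
      \<and> - ln (?\<Omega> n) \<le> - ln (h n) \<and> 0 \<le> - ln (h n)"
    if g: "?good n" for n
  proof -
    have hn: "0 < h n" using g h_pos by auto
    have n: "n \<in> pos_index" and L: "1 \<le> ln (nhat n)" using g by auto
    have nh0: "0 < nhat n" using n by (auto simp: nhat_def pos_index_def Suc_le_eq intro!: prod_pos)
    have nh: "1 < nhat n" using L nh0 by (smt (verit) ln_le_zero_iff)
    have "0 < ln (nhat n)" using L by linarith
    then have "0 < ?\<Omega> n" unfolding Omega_def using hn nh0 by (intro real_sqrt_gt_zero divide_pos_pos) auto
    moreover have "2 * ln (?\<Omega> n) = ln (ln (nhat n)) - ln (nhat n) - real d * ln (h n)"
      unfolding Omega_def using hn nh0 \<open>0 < ln (nhat n)\<close> nh by (simp add: ln_sqrt ln_div ln_mult ln_realpow)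
    moreover have "ln (h n) \<le> ln (?\<Omega> n)" using g hn by simp
    moreover have "ln (h n) \<le> 0" using g hn by simp
    ultimately show ?thesis using hn nh by (simp add: D_def algebra_simps)
  qed
  have lower: "\<exists>\<kappa>\<ge>0. \<exists>C\<ge>0. \<beta> > N * (D + 4) \<and>
      (\<forall>n\<in>(pos_index :: (nat ^ 'n) set). mixing_size_bound \<phi> n (C * nhat n powr \<kappa>)) \<and>
      eventually (\<lambda>n. (3 + \<kappa>) * ln (nhat n) + ln (u_fun \<epsilon> n) + D * (- ln (h n) - ln (?\<Omega> n)) \<le> \<beta> / N * (- ln (?\<Omega> n))) multi_at_top"
    using h_lower
  proof
    assume "bandwidth_cond_a d \<phi> \<beta> \<epsilon> h"
    define \<delta> where "\<delta> = \<beta> - N * (D + 4)"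
    have \<delta>': "\<beta> - N * (real d + 5) = \<delta>" by (simp add: \<delta>_def D_def)
    from \<open>bandwidth_cond_a d \<phi> \<beta> \<epsilon> h\<close> obtain C where C: "0 < C" "\<And>n m. \<phi> n m \<le> C * real (min n m)" and \<delta>: "0 < \<delta>"
      and lim: "filterlim (\<lambda>n. nhat n * h n powr theta1 N (real d) \<beta>
            * ln (nhat n) powr theta2 N (real d) \<beta> * u_fun \<epsilon> n powr (- (2 * N / \<delta>))) at_top multi_at_top"
      unfolding bandwidth_cond_a_def Let_def N_def[symmetric] \<delta>' by auto
    have "eventually (\<lambda>n. 1 \<le> nhat n * h n powr theta1 N (real d) \<beta>
            * ln (nhat n) powr theta2 N (real d) \<beta> * u_fun \<epsilon> n powr (- (2 * N / \<delta>))) multi_at_top"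
      using lim unfolding filterlim_at_top by blast
    with good have "eventually (\<lambda>n. 3 * ln (nhat n) + ln (u_fun \<epsilon> n) + D * (- ln (h n) + - ln (?\<Omega> n)) \<le> \<beta> / N * (- ln (?\<Omega> n))) multi_at_top"
    proof eventually_elim
      case (elim n)
      note lg = logs[OF elim(1)]
      have u: "1 \<le> u_fun \<epsilon> n" and L: "1 \<le> ln (nhat n)" using elim(1) by auto
      have "0 \<le> ln (nhat n * h n powr theta1 N (real d) \<beta>
            * ln (nhat n) powr theta2 N (real d) \<beta> * u_fun \<epsilon> n powr (- (2 * N / \<delta>)))"
        using elim(2) by (rule ln_ge_zero)
      also have "\<dots> = ln (nhat n) + theta1 N (real d) \<beta> * ln (h n) + theta2 N (real d) \<beta> * ln (ln (nhat n)) - 2 * N / \<delta> * ln (u_fun \<epsilon> n)"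
        using lg u L by (simp add: ln_mult ln_powr)
      also have "theta1 N (real d) \<beta> = (N * D * (D + 1) + D * \<beta>) / \<delta>"
        unfolding theta1_def \<delta>' by (simp add: D_def algebra_simps)
      also have "theta2 N (real d) \<beta> = (N * (D + 1) - \<beta>) / \<delta>"
        unfolding theta2_def \<delta>' by (simp add: D_def algebra_simps)
      finally have "0 \<le> ln (nhat n) - (N * D * (D + 1) + D * \<beta>) / \<delta> * (- ln (h n)) + (N * (D + 1) - \<beta>) / \<delta> * ln (ln (nhat n)) - 2 * N / \<delta> * ln (u_fun \<epsilon> n)"
        by simp
      then show ?case
        using lg elim(1) D N \<delta> by (intro log_bandwidth_bound_a[where \<delta>=\<delta>, OF _ _ _ _ _ _ \<delta>_def]) auto
    qed
    then have ev: "eventually (\<lambda>n. (3 + 0) * ln (nhat n) + ln (u_fun \<epsilon> n) + D * (- ln (h n) - ln (?\<Omega> n)) \<le> \<beta> / N * (- ln (?\<Omega> n))) multi_at_top"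
      by simp
    show ?thesis
    proof (rule exI[where x=0], rule conjI[OF order_refl], rule exI[where x=C], unfold mixing_size_bound_def, intro conjI ballI allI impI)
      fix n :: "nat ^ 'n" and E E' :: "(nat ^ 'n) set" assume n: "n \<in> pos_index"
      have "nhat n > 0" using n by (auto simp: nhat_def pos_index_def Suc_le_eq intro!: prod_pos)
      then have "nhat n powr 0 = 1" by simp
      moreover have "\<phi> (card E) (card E') \<le> C * real (min (card E) (card E'))" by (rule C(2))
      moreover have "C * real (min (card E) (card E')) \<le> C * real (card E')"
        using C(1) by (intro mult_left_mono) auto
      ultimately show "\<phi> (card E) (card E') \<le> C * nhat n powr 0 * real (card E')" by simp
    qed (use C \<delta> ev in \<open>simp_all add: \<delta>_def\<close>)
  next
    assume "bandwidth_cond_b d \<phi> \<beta> \<epsilon> h"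
    then obtain \<kappa> where \<kappa>: "1 \<le> \<kappa>" and cond: "let N = real CARD('n); \<delta> = \<beta> - N * (real d + 4 + 2 * \<kappa>) in
       (\<exists>C>0. \<forall>n m. \<phi> n m \<le> C * real (n + m + 1) powr \<kappa>) \<and> \<delta> > 0 \<and>
       filterlim (\<lambda>n. nhat n * h n powr theta3 N (real d) \<beta> \<kappa>
            * ln (nhat n) powr theta4 N (real d) \<beta> \<kappa>
            * u_fun \<epsilon> n powr (- (2 * N / \<delta>)))
         at_top multi_at_top"
      unfolding bandwidth_cond_b_def by blast
    define \<delta> where "\<delta> = \<beta> - N * (D + 3 + 2 * \<kappa>)"
    have \<delta>': "\<beta> - N * (real d + 4 + 2 * \<kappa>) = \<delta>" by (simp add: \<delta>_def D_def)
    from cond obtain C where C: "0 < C" "\<And>n m. \<phi> n m \<le> C * real (n + m + 1) powr \<kappa>" and \<delta>: "0 < \<delta>"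
      and lim: "filterlim (\<lambda>n. nhat n * h n powr theta3 N (real d) \<beta> \<kappa>
            * ln (nhat n) powr theta4 N (real d) \<beta> \<kappa> * u_fun \<epsilon> n powr (- (2 * N / \<delta>))) at_top multi_at_top"
      unfolding Let_def N_def[symmetric] \<delta>' by auto
    have "eventually (\<lambda>n. 1 \<le> nhat n * h n powr theta3 N (real d) \<beta> \<kappa>
            * ln (nhat n) powr theta4 N (real d) \<beta> \<kappa> * u_fun \<epsilon> n powr (- (2 * N / \<delta>))) multi_at_top"
      using lim unfolding filterlim_at_top by blast
    with good have ev: "eventually (\<lambda>n. (3 + \<kappa>) * ln (nhat n) + ln (u_fun \<epsilon> n) + D * (- ln (h n) + - ln (?\<Omega> n)) \<le> \<beta> / N * (- ln (?\<Omega> n))) multi_at_top"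
    proof eventually_elim
      case (elim n)
      note lg = logs[OF elim(1)]
      have u: "1 \<le> u_fun \<epsilon> n" and L: "1 \<le> ln (nhat n)" using elim(1) by auto
      have "0 \<le> ln (nhat n * h n powr theta3 N (real d) \<beta> \<kappa>
            * ln (nhat n) powr theta4 N (real d) \<beta> \<kappa> * u_fun \<epsilon> n powr (- (2 * N / \<delta>)))"
        using elim(2) by (rule ln_ge_zero)
      also have "\<dots> = ln (nhat n) + theta3 N (real d) \<beta> \<kappa> * ln (h n) + theta4 N (real d) \<beta> \<kappa> * ln (ln (nhat n)) - 2 * N / \<delta> * ln (u_fun \<epsilon> n)"
        using lg u L by (simp add: ln_mult ln_powr)
      also have "theta3 N (real d) \<beta> \<kappa> = (N * (D\<^sup>2 + 2 * D - 1) + D * \<beta>) / \<delta>"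
        unfolding theta3_def \<delta>' by (simp add: D_def algebra_simps power2_eq_square)
      also have "theta4 N (real d) \<beta> \<kappa> = (N * D - \<beta>) / \<delta>"
        unfolding theta4_def \<delta>' by (simp add: D_def algebra_simps)
      finally have "0 \<le> ln (nhat n) - (N * (D\<^sup>2 + 2 * D - 1) + D * \<beta>) / \<delta> * (- ln (h n)) + (N * D - \<beta>) / \<delta> * ln (ln (nhat n)) - 2 * N / \<delta> * ln (u_fun \<epsilon> n)"
        by simp
      then show ?case
        using lg elim(1) D N \<delta> \<kappa> by (intro log_bandwidth_bound_b[where \<delta>=\<delta>, OF _ _ _ _ _ _ _ \<delta>_def]) auto
    qed
    have "N * (D + 4) \<le> N * (D + 3 + 2 * \<kappa>)" using N \<kappa> by (intro mult_left_mono) auto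
    then have \<beta>: "N * (D + 4) < \<beta>" using \<delta> by (simp add: \<delta>_def)
    have \<phi>: "\<phi> (card E) (card E') \<le> (C * 3 powr \<kappa>) * nhat n powr \<kappa> * real (card E')"
      if "n \<in> pos_index" "E \<subseteq> rect n" "E' \<subseteq> rect n" "E' \<noteq> {}" for n :: "nat ^ 'n" and E E'
    proof -
      have c: "real (card E) \<le> nhat n" "real (card E') \<le> nhat n"
        unfolding card_rect[symmetric] using that by (auto intro!: card_mono)
      have "finite E'" using that(3) finite_rect by (rule finite_subset)
      then have E1: "1 \<le> real (card E')" using that by (simp add: Suc_leI card_gt_0_iff)
      then have nh: "1 \<le> nhat n" using c by linarith
      have "\<phi> (card E) (card E') \<le> C * real (card E + card E' + 1) powr \<kappa>" by (rule C(2))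
      also have "\<dots> \<le> C * (3 * nhat n) powr \<kappa>"
        using C(1) c nh \<kappa> by (intro mult_left_mono powr_mono2) auto
      also have "\<dots> = C * 3 powr \<kappa> * nhat n powr \<kappa> * 1" using nh by (simp add: powr_mult)
      also have "\<dots> \<le> C * 3 powr \<kappa> * nhat n powr \<kappa> * real (card E')"
        using C(1) E1 by (intro mult_left_mono) auto
      finally show ?thesis .
    qed
    show ?thesis
    proof (rule exI[where x=\<kappa>], rule conjI, use \<kappa> in simp, rule exI[where x="C * 3 powr \<kappa>"], unfold mixing_size_bound_def, intro conjI ballI allI impI)
      show "eventually (\<lambda>n. (3 + \<kappa>) * ln (nhat n) + ln (u_fun \<epsilon> n) + D * (- ln (h n) - ln (?\<Omega> n)) \<le> \<beta> / N * (- ln (?\<Omega> n))) multi_at_top"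
        using ev by simp
    qed (use C \<kappa> \<beta> \<phi> in simp_all)
  qed
  then obtain \<kappa> C where \<kappa>: "0 \<le> \<kappa>" and C: "0 \<le> C" and \<beta>: "N * (D + 4) < \<beta>"
    and \<phi>: "\<forall>n\<in>(pos_index :: (nat ^ 'n) set). mixing_size_bound \<phi> n (C * nhat n powr \<kappa>)"
    and ev: "eventually (\<lambda>n. (3 + \<kappa>) * ln (nhat n) + ln (u_fun \<epsilon> n) + D * (- ln (h n) - ln (?\<Omega> n)) \<le> \<beta> / N * (- ln (?\<Omega> n))) multi_at_top"
    by blast
  have "N * 4 \<le> N * (D + 4)" using N D by (intro mult_left_mono) auto
  then have "4 * N \<le> \<beta>" using \<beta> by linarith
  then show "4 * real CARD('n) \<le> \<beta>" unfolding N_def .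
  have bD: "D + 4 < \<beta> / N" using \<beta> N by (simp add: pos_less_divide_eq mult.commute)
  have W: "eventually (\<lambda>n. 3 / (\<beta> / N - D) * ln (nhat n) \<le> - ln (?\<Omega> n)) multi_at_top"
    using good ev
  proof eventually_elim
    case (elim n)
    note lg = logs[OF elim(1)]
    have u: "0 \<le> ln (u_fun \<epsilon> n)" and L: "0 \<le> ln (nhat n)" using elim(1) by (auto intro: ln_ge_zero)
    have "0 \<le> D * (- ln (h n))" using lg D by (intro mult_nonneg_nonneg) auto
    moreover have "0 \<le> \<kappa> * ln (nhat n)" using \<kappa> L by simp
    ultimately have "3 * ln (nhat n) \<le> (\<beta> / N - D) * (- ln (?\<Omega> n))"
      using elim(2) u by (simp add: algebra_simps)
    then show ?case using bD by (simp add: pos_divide_le_eq mult.commute)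
  qed
  have \<Omega>_le: "eventually (\<lambda>n. ?\<Omega> n \<le> nhat n powr (- (3 / (\<beta> / N - D)))) multi_at_top"
    using good W
  proof eventually_elim
    case (elim n)
    note lg = logs[OF elim(1)]
    have "ln (?\<Omega> n) \<le> ln (nhat n powr (- (3 / (\<beta> / N - D))))"
      using elim(2) lg by (simp add: ln_powr)
    then show ?case using lg by (subst (asm) ln_le_cancel_iff) auto
  qed
  have pw: "((\<lambda>n :: nat ^ 'n. nhat n powr (- (3 / (\<beta> / N - D)))) \<longlongrightarrow> 0) multi_at_top"
    using bD filterlim_nhat by (intro tendsto_neg_powr) auto
  have "eventually (\<lambda>n. 0 \<le> ?\<Omega> n) multi_at_top"
    using good by eventually_elim (use logs in force)
  from tendsto_sandwich[OF this \<Omega>_le tendsto_const pw]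
  show \<Omega>0: "(?\<Omega> \<longlongrightarrow> 0) multi_at_top" .
  have "eventually (\<lambda>n. ?\<Omega> n < 1) multi_at_top" using \<Omega>0 by (rule order_tendstoD) simp
  with good ev have "eventually (\<lambda>n. n \<in> pos_index \<and> 1 \<le> ln (nhat n) \<and> h n < 1 \<and> h n \<le> ?\<Omega> n \<and> ?\<Omega> n \<le> 1 \<and> 1 \<le> u_fun \<epsilon> n \<and>
         nhat n powr (3 + \<kappa>) * u_fun \<epsilon> n * (h n * ?\<Omega> n) powr (- (real d + 1))
           * ?\<Omega> n powr (\<beta> / real CARD('n)) \<le> 1) multi_at_top"
  proof eventually_elim
    case (elim n)
    note lg = logs[OF elim(1)]
    have u: "1 \<le> u_fun \<epsilon> n" using elim(1) by auto
    let ?X = "nhat n powr (3 + \<kappa>) * u_fun \<epsilon> n * (h n * ?\<Omega> n) powr (- D) * ?\<Omega> n powr (\<beta> / N)"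
    have "ln ?X = (3 + \<kappa>) * ln (nhat n) + ln (u_fun \<epsilon> n) + (- D) * (ln (h n) + ln (?\<Omega> n)) + \<beta> / N * ln (?\<Omega> n)"
      using lg u by (simp add: ln_mult ln_powr)
    then have "ln ?X \<le> ln 1" using elim(2) by (simp add: algebra_simps)
    moreover have "0 < ?X" using lg u by (intro mult_pos_pos) auto
    ultimately have "?X \<le> 1" by (subst (asm) ln_le_cancel_iff) auto
    then show ?case using elim unfolding D_def N_def by auto
  qed
  then show "\<exists>\<kappa>\<ge>0. \<exists>C\<ge>0.
      (\<forall>n\<in>(pos_index :: (nat ^ 'n) set). mixing_size_bound \<phi> n (C * nhat n powr \<kappa>)) \<and>
      eventually (\<lambda>n. n \<in> pos_index \<and> 1 \<le> ln (nhat n) \<and> h n < 1 \<and> h n \<le> Omega d h n \<and> Omega d h n \<le> 1 \<and> 1 \<le> u_fun \<epsilon> n \<and>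
         nhat n powr (3 + \<kappa>) * u_fun \<epsilon> n * (h n * Omega d h n) powr (- (real d + 1))
           * Omega d h n powr (\<beta> / real CARD('n)) \<le> 1) multi_at_top"
    using \<kappa> C \<phi> by blast
qed

section \<open>Almost sure deviations over finite families\<close>

text \<open>
  Blocks of side \<open>p = \<lfloor>\<Omega> powr (- 1 / N)\<rfloor>\<close> have at most \<open>1 / \<Omega>\<close> sites, so \<open>lam = \<Omega> / 2\<close> is admissible
  in the exponential inequality. Both the variance term and \<open>lam * t\<close> are then multiples of
  \<open>nhat * h ^ d * \<Omega>\<^sup>2 = ln nhat\<close>, and a large \<open>\<eta>\<close> turns the Gaussian part into any desired power of
  \<open>nhat\<close>.
\<close>

lemma (in polynomially_mixing_field) AE_uniform_deviation:
  fixes F :: "nat ^ 'n \<Rightarrow> ('b \<Rightarrow> real) set" and d :: nat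
  assumes d: "1 \<le> d" and eps: "0 < \<epsilon>"
    and h_pos: "\<forall>n\<in>pos_index. h n > 0"
    and h_lim: "(h \<longlongrightarrow> 0) multi_at_top"
    and h_upper: "((\<lambda>n. nhat n * h n ^ (d + 2) / ln (nhat n)) \<longlongrightarrow> 0) multi_at_top"
    and h_lower: "bandwidth_cond_a d \<phi> \<beta> \<epsilon> h \<or> bandwidth_cond_b d \<phi> \<beta> \<epsilon> h"
    and C1: "0 < C1"
    and fin: "eventually (\<lambda>n. finite (F n) \<and> real (card (F n)) \<le> Cg * (h n * Omega d h n) powr (- (real d + 1))) multi_at_top"
    and test: "eventually (\<lambda>n. \<forall>\<zeta>\<in>F n. local_test M Z D (C1 * h n ^ d) \<zeta>) multi_at_top"
  shows "\<exists>\<eta>\<ge>0. AE x in M. eventually (\<lambda>n. \<forall>\<zeta>\<in>F n.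
      \<bar>centred_sum M Z \<zeta> n x\<bar> \<le> \<eta> * (nhat n * h n ^ d * Omega d h n)) multi_at_top"
proof -
  let ?\<Omega> = "Omega d h"
  define N where "N = real CARD('n)"
  define D' where "D' = real d + 1"
  define two where "two = (2::real) ^ CARD('n)"
  have two: "0 < two" by (simp add: two_def)
  have N: "1 \<le> N" unfolding N_def by (simp add: Suc_leI)
  note bw = bandwidth_consequences[OF d eps h_pos h_lim h_upper h_lower]
  have \<beta>N: "4 * N \<le> \<beta>" using bw(1) by (simp add: N_def)
  then have \<beta>0: "0 < \<beta>" using N by linarith
  obtain \<kappa> C\<phi> where \<kappa>: "0 \<le> \<kappa>" and C\<phi>: "0 \<le> C\<phi>"
    and \<phi>: "\<forall>n\<in>(pos_index :: (nat ^ 'n) set). mixing_size_bound \<phi> n (C\<phi> * nhat n powr \<kappa>)"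
    and bwe: "eventually (\<lambda>n. n \<in> pos_index \<and> 1 \<le> ln (nhat n) \<and> h n < 1 \<and> h n \<le> ?\<Omega> n \<and> ?\<Omega> n \<le> 1 \<and> 1 \<le> u_fun \<epsilon> n \<and>
         nhat n powr (3 + \<kappa>) * u_fun \<epsilon> n * (h n * ?\<Omega> n) powr (- D') * ?\<Omega> n powr (\<beta> / N) \<le> 1) multi_at_top"
    using bw(3)[folded N_def D'_def] by (elim exE conjE) (rule that[rotated 2])
  obtain C2 where C2': "0 < C2 \<and> (\<forall>n \<zeta> a \<Phi> p lam t. n \<in> pos_index \<longrightarrow> 0 \<le> a \<longrightarrow> a \<le> 1 \<longrightarrow> local_test M Z D a \<zeta> \<longrightarrow>
      0 \<le> \<Phi> \<longrightarrow> mixing_size_bound \<phi> n \<Phi> \<longrightarrow> 1 \<le> p \<longrightarrow> 0 < lam \<longrightarrow> lam * (2 * real p ^ CARD('n)) \<le> 1 \<longrightarrow>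
      prob {x \<in> space M. 2 ^ CARD('n) * t \<le> \<bar>centred_sum M Z \<zeta> n x\<bar>}
        \<le> 2 * 2 ^ CARD('n) * (exp (lam\<^sup>2 * (C2 * a * nhat n) + 1 - lam * t) + 4 * (nhat n)\<^sup>2 * \<Phi> * chi (real p)))"
    using local_field_deviation_le[OF bw(1)] by (rule exE)
  then have C2: "0 < C2" by (rule conjunct1)
  note dev = conjunct2[OF C2', rule_format]
  (* The power nhat^(-A) has to beat nhat^(2 D') for the number of test functions, and
     nhat * nhat^(beta / N) for nhat * u. *)
  define A where "A = 2 * D' + 1 + \<beta> / N"
  define \<eta> where "\<eta> = C2 * C1 / 2 + 2 * A"
  have A0: "0 \<le> A" using \<beta>0 N by (simp add: A_def D'_def)
  have \<eta>0: "0 \<le> \<eta>" using C2 C1 A0 by (simp add: \<eta>_def)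
  define t where "t n = \<eta> * (nhat n * h n ^ d * ?\<Omega> n)" for n
  define B where "B n = (if finite (F n) \<and> (\<forall>\<zeta>\<in>F n. \<zeta> \<in> borel_measurable borel) \<and> n \<in> pos_index
     then \<Union>\<zeta>\<in>F n. {x \<in> space M. two * t n \<le> \<bar>centred_sum M Z \<zeta> n x\<bar>} else {})" for n
  have evt: "{x \<in> space M. c \<le> \<bar>centred_sum M Z \<zeta> n x\<bar>} \<in> events"
    if "\<zeta> \<in> borel_measurable borel" for n :: "nat ^ 'n" and \<zeta> :: "'b \<Rightarrow> real" and c :: real
  proof -
    have "(\<lambda>x. \<Sum>i\<in>rect n. \<zeta> (Z i x)) \<in> borel_measurable M"
      using rect_subset_pos[of n] by (intro borel_measurable_sum measurable_compose[OF Z that]) auto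
    then show ?thesis unfolding centred_sum_def by measurable
  qed
  have Bev: "B n \<in> events" for n
    unfolding B_def using evt by (cases "finite (F n)") (simp_all add: sets.finite_UN)
  define C4 where "C4 = 4 * C\<phi> * max Cc 0 * 2 powr \<beta>"
  have C4: "0 \<le> C4" using C\<phi> by (simp add: C4_def)
  define C3 where "C3 = max Cg 0 * (2 * two) * (exp 1 + C4)"
  have hd: "eventually (\<lambda>n. C1 * h n ^ d \<le> 1) multi_at_top"
  proof -
    have "((\<lambda>n. C1 * h n ^ d) \<longlongrightarrow> C1 * 0 ^ d) multi_at_top" by (intro tendsto_intros h_lim)
    then have "((\<lambda>n. C1 * h n ^ d) \<longlongrightarrow> 0) multi_at_top" using d by (simp add: power_0_left)
    then have "eventually (\<lambda>n. C1 * h n ^ d < 1) multi_at_top" by (rule order_tendstoD) simp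
    then show ?thesis by eventually_elim simp
  qed
  have bigp: "eventually (\<lambda>n. ?\<Omega> n < 1 / (max T 1 + 1) powr N) multi_at_top"
    using bw(2) by (rule order_tendstoD) simp
  have "eventually (\<lambda>n. prob (B n) \<le> C3 / (nhat n * u_fun \<epsilon> n)) multi_at_top"
    using bwe fin test hd bigp
  proof eventually_elim
    case (elim n)
    have n: "n \<in> pos_index" and L: "1 \<le> ln (nhat n)" and h1: "h n < 1" and h\<Omega>: "h n \<le> ?\<Omega> n" "?\<Omega> n \<le> 1"
      and u: "1 \<le> u_fun \<epsilon> n" and key: "nhat n powr (3 + \<kappa>) * u_fun \<epsilon> n * (h n * ?\<Omega> n) powr (- D') * ?\<Omega> n powr (\<beta> / N) \<le> 1"
      using elim(1) by simp_all
    have finF: "finite (F n)" and cardF: "real (card (F n)) \<le> Cg * (h n * ?\<Omega> n) powr (- D')"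
      using elim(2) unfolding D'_def by simp_all
    note hd1 = elim(4) and big = elim(5)
    have h0: "0 < h n" using h_pos n by auto
    have \<Omega>0: "0 < ?\<Omega> n" using h0 h\<Omega> by linarith
    have nh0: "0 < nhat n" using n by (auto simp: nhat_def pos_index_def Suc_le_eq intro!: prod_pos)
    have nh1: "1 \<le> nhat n" using L nh0 ln_le_minus_one[of "nhat n"] by linarith
    define P where "P = ?\<Omega> n powr (- (1 / N))"
    define p where "p = nat \<lfloor>P\<rfloor>"
    (* Since Omega is small, rounding P down loses at most a factor 2 and leaves p >= T. *)
    have P_big: "max T 1 + 1 \<le> P"
    proof -
      have "(max T 1 + 1) powr N < 1 / ?\<Omega> n" using big \<Omega>0 by (simp add: field_simps)
      then have "((max T 1 + 1) powr N) powr (1 / N) \<le> (1 / ?\<Omega> n) powr (1 / N)"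
        using N by (intro powr_mono2) auto
      moreover have "((max T 1 + 1) powr N) powr (1 / N) = max T 1 + 1" using N by (simp add: powr_powr)
      moreover have "(1 / ?\<Omega> n) powr (1 / N) = P"
        using \<Omega>0 by (simp add: P_def powr_minus_divide powr_divide)
      ultimately show ?thesis by simp
    qed
    have pP: "real p \<le> P" "P / 2 \<le> real p" "1 \<le> p" "T \<le> real p"
      unfolding p_def using P_big by linarith+
    have pN: "real p ^ CARD('n) \<le> 1 / ?\<Omega> n"
    proof -
      have "real p ^ CARD('n) \<le> P ^ CARD('n)" using pP by (intro power_mono) auto
      also have "\<dots> = P powr N" using pP(2) P_big unfolding N_def by (subst powr_realpow) auto
      also have "\<dots> = ?\<Omega> n powr (- 1)" using N unfolding P_def powr_powr by simp
      also have "\<dots> = 1 / ?\<Omega> n" using \<Omega>0 by (simp add: powr_minus_divide)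
      finally show ?thesis .
    qed
    define lam where "lam = ?\<Omega> n / 2"
    have lam: "0 < lam" "lam * (2 * real p ^ CARD('n)) \<le> 1"
      using \<Omega>0 pN by (auto simp: lam_def pos_le_divide_eq mult.commute)
    define \<Phi> where "\<Phi> = C\<phi> * nhat n powr \<kappa>"
    have \<Omega>sq: "nhat n * h n ^ d * (?\<Omega> n)\<^sup>2 = ln (nhat n)"
    proof -
      have "0 < nhat n * h n ^ d" using h0 nh0 by simp
      moreover have "(?\<Omega> n)\<^sup>2 = ln (nhat n) / (nhat n * h n ^ d)"
        unfolding Omega_def using L calculation by (intro real_sqrt_pow2 divide_nonneg_pos) auto
      ultimately show ?thesis using h0 nh0 by simp
    qed
    have chip: "chi (real p) \<le> max Cc 0 * 2 powr \<beta> * ?\<Omega> n powr (\<beta> / N)"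
    proof -
      have "chi (real p) \<le> Cc * real p powr (- \<beta>)" using pP(4) by (rule rate)
      also have "\<dots> \<le> max Cc 0 * real p powr (- \<beta>)" by (intro mult_right_mono) auto
      also have "\<dots> \<le> max Cc 0 * (P / 2) powr (- \<beta>)"
        using pP P_big \<beta>0 by (intro mult_left_mono powr_mono2') auto
      also have "(P / 2) powr (- \<beta>) = P powr (- \<beta>) * 2 powr \<beta>"
        using P_big by (simp add: powr_divide powr_minus_divide)
      also have "P powr (- \<beta>) = ?\<Omega> n powr (\<beta> / N)" by (simp add: P_def powr_powr)
      finally show ?thesis by (simp add: mult_ac)
    qed
    have one: "prob {x \<in> space M. two * t n \<le> \<bar>centred_sum M Z \<zeta> n x\<bar>}
        \<le> 2 * two * (exp 1 * nhat n powr (- A) + C4 * nhat n powr (2 + \<kappa>) * ?\<Omega> n powr (\<beta> / N))"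
      if \<zeta>: "\<zeta> \<in> F n" for \<zeta>
    proof -
      have "prob {x \<in> space M. two * t n \<le> \<bar>centred_sum M Z \<zeta> n x\<bar>}
        \<le> 2 * two * (exp (lam\<^sup>2 * (C2 * (C1 * h n ^ d) * nhat n) + 1 - lam * t n) + 4 * (nhat n)\<^sup>2 * \<Phi> * chi (real p))"
        unfolding two_def
      proof (rule dev)
        show "mixing_size_bound \<phi> n \<Phi>" using \<phi> n unfolding \<Phi>_def by blast
        show "0 \<le> C1 * h n ^ d" using C1 h0 by simp
        show "0 \<le> \<Phi>" using C\<phi> by (simp add: \<Phi>_def)
        show "local_test M Z D (C1 * h n ^ d) \<zeta>" using elim(3) \<zeta> by blast
      qed (fact n hd1 pP(3) lam)+
      also have "lam\<^sup>2 * (C2 * (C1 * h n ^ d) * nhat n) = C2 * C1 / 4 * (nhat n * h n ^ d * (?\<Omega> n)\<^sup>2)"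
        by (simp add: lam_def power2_eq_square)
      also have "\<dots> = C2 * C1 / 4 * ln (nhat n)" by (simp only: \<Omega>sq)
      also have "lam * t n = \<eta> / 2 * (nhat n * h n ^ d * (?\<Omega> n)\<^sup>2)" by (simp add: lam_def t_def power2_eq_square)
      also have "\<dots> = \<eta> / 2 * ln (nhat n)" by (simp only: \<Omega>sq)
      also have "C2 * C1 / 4 * ln (nhat n) + 1 - \<eta> / 2 * ln (nhat n) = 1 + (- A) * ln (nhat n)"
        by (simp add: \<eta>_def algebra_simps)
      also have "exp \<dots> = exp 1 * nhat n powr (- A)" using nh0 by (simp only: exp_add powr_def) simp
      also have "4 * (nhat n)\<^sup>2 * \<Phi> * chi (real p) \<le> 4 * (nhat n)\<^sup>2 * \<Phi> * (max Cc 0 * 2 powr \<beta> * ?\<Omega> n powr (\<beta> / N))"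
        using chip C\<phi> by (intro mult_left_mono) (auto simp: \<Phi>_def)
      also have "\<dots> = C4 * nhat n powr (2 + \<kappa>) * ?\<Omega> n powr (\<beta> / N)"
        using nh0 by (simp add: \<Phi>_def C4_def powr_add)
      finally show ?thesis using two by simp
    qed
    have \<zeta>m: "\<zeta> \<in> borel_measurable borel" if "\<zeta> \<in> F n" for \<zeta>
      using elim(3) that unfolding local_test_def by blast
    have Bn: "B n = (\<Union>\<zeta>\<in>F n. {x \<in> space M. two * t n \<le> \<bar>centred_sum M Z \<zeta> n x\<bar>})"
      using finF \<zeta>m n unfolding B_def by auto
    let ?r = "(h n * ?\<Omega> n) powr (- D')"
    have "prob (B n) \<le> (\<Sum>\<zeta>\<in>F n. prob {x \<in> space M. two * t n \<le> \<bar>centred_sum M Z \<zeta> n x\<bar>})"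
      unfolding Bn using finF evt \<zeta>m by (intro finite_measure_subadditive_finite) auto
    also have "\<dots> \<le> (\<Sum>\<zeta>\<in>F n. 2 * two * (exp 1 * nhat n powr (- A) + C4 * nhat n powr (2 + \<kappa>) * ?\<Omega> n powr (\<beta> / N)))"
      by (intro sum_mono one)
    also have "\<dots> = real (card (F n)) * (2 * two * (exp 1 * nhat n powr (- A) + C4 * nhat n powr (2 + \<kappa>) * ?\<Omega> n powr (\<beta> / N)))"
      by simp
    also have "\<dots> \<le> (max Cg 0 * ?r) * (2 * two * (exp 1 * nhat n powr (- A) + C4 * nhat n powr (2 + \<kappa>) * ?\<Omega> n powr (\<beta> / N)))"
    proof (rule mult_right_mono)
      have "Cg * ?r \<le> max Cg 0 * ?r" by (intro mult_right_mono) auto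
      then show "real (card (F n)) \<le> max Cg 0 * ?r" using cardF by linarith
    qed (use two C4 in auto)
    also have "\<dots> = max Cg 0 * (2 * two) * (exp 1 * (?r * nhat n powr (- A)) + C4 * (?r * nhat n powr (2 + \<kappa>) * ?\<Omega> n powr (\<beta> / N)))"
      by (simp add: algebra_simps)
    also have "\<dots> \<le> max Cg 0 * (2 * two) * (exp 1 * (1 / (nhat n * u_fun \<epsilon> n)) + C4 * (1 / (nhat n * u_fun \<epsilon> n)))"
    proof -
      have nu: "0 < nhat n * u_fun \<epsilon> n" using nh0 u by (intro mult_pos_pos) auto
      have i2: "?r * nhat n powr (2 + \<kappa>) * ?\<Omega> n powr (\<beta> / N) \<le> 1 / (nhat n * u_fun \<epsilon> n)"
      proof -
        have "nhat n powr (3 + \<kappa>) = nhat n * nhat n powr (2 + \<kappa>)"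
          using nh0 powr_add[of "nhat n" 1 "2 + \<kappa>"] by simp
        then have "(?r * nhat n powr (2 + \<kappa>) * ?\<Omega> n powr (\<beta> / N)) * (nhat n * u_fun \<epsilon> n) \<le> 1"
          using key by (simp add: mult_ac)
        then show ?thesis using nu by (subst pos_le_divide_eq) auto
      qed
      (* Crude polynomial bounds for 1 / h, 1 / Omega and u in terms of nhat; they only have to be
         beaten by nhat^(-A). *)
      have hlow: "1 / nhat n \<le> h n"
      proof -
        have "1 \<le> nhat n * h n ^ d" 
        proof -
          have "(?\<Omega> n)\<^sup>2 \<le> 1" using h\<Omega> \<Omega>0 by (simp add: power_le_one)
          then have "nhat n * h n ^ d * (?\<Omega> n)\<^sup>2 \<le> nhat n * h n ^ d * 1"
            using nh0 h0 by (intro mult_left_mono) auto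
          then show ?thesis using \<Omega>sq L by linarith
        qed
        also have "nhat n * h n ^ d \<le> nhat n * h n"
          using nh0 h0 h1 d power_decreasing[of 1 d "h n"] by (intro mult_left_mono) auto
        finally show ?thesis using nh0 by (simp add: pos_divide_le_eq mult.commute)
      qed
      have \<Omega>low: "1 / nhat n \<le> ?\<Omega> n" using hlow h\<Omega> by linarith
      have r_le: "?r \<le> nhat n powr (2 * D')"
      proof -
        have "(1 / nhat n) * (1 / nhat n) \<le> h n * ?\<Omega> n" using hlow \<Omega>low nh0 h0 by (intro mult_mono) auto
        then have "?r \<le> ((1 / nhat n) * (1 / nhat n)) powr (- D')"
          using nh0 by (intro powr_mono2') (auto simp: D'_def)
        also have "\<dots> = nhat n powr (2 * D')"
          using nh0 by (simp add: powr_divide powr_minus_divide powr_mult powr_add[symmetric])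
        finally show ?thesis .
      qed
      have u_le: "u_fun \<epsilon> n \<le> nhat n powr (\<beta> / N)"
      proof -
        have "1 \<le> ?r" 
        proof -
          have "h n * ?\<Omega> n \<le> 1" using h1 h\<Omega> h0 \<Omega>0 by (intro mult_le_one) auto
          then have "1 powr (- D') \<le> ?r" using h0 \<Omega>0 by (intro powr_mono2') (auto simp: D'_def)
          then show ?thesis by simp
        qed
        moreover have "1 \<le> nhat n powr (3 + \<kappa>)" using nh1 \<kappa> by (intro ge_one_powr_ge_zero) auto
        ultimately have "1 * 1 \<le> nhat n powr (3 + \<kappa>) * ?r" by (intro mult_mono) auto
        then have "1 * (u_fun \<epsilon> n * ?\<Omega> n powr (\<beta> / N)) \<le> (nhat n powr (3 + \<kappa>) * ?r) * (u_fun \<epsilon> n * ?\<Omega> n powr (\<beta> / N))"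
          using u by (intro mult_right_mono) auto
        also have "\<dots> \<le> 1" using key by (simp add: mult_ac)
        finally have "u_fun \<epsilon> n * ?\<Omega> n powr (\<beta> / N) \<le> 1" by simp
        moreover have "(1 / nhat n) powr (\<beta> / N) \<le> ?\<Omega> n powr (\<beta> / N)"
          using \<Omega>low nh0 \<beta>0 N by (intro powr_mono2) auto
        ultimately have "u_fun \<epsilon> n * (1 / nhat n) powr (\<beta> / N) \<le> 1"
          using u mult_left_mono[of "(1 / nhat n) powr (\<beta> / N)" "?\<Omega> n powr (\<beta> / N)" "u_fun \<epsilon> n"] by linarith
        then show ?thesis using nh0 by (simp add: powr_divide pos_divide_le_eq)
      qed
      have "?r * nhat n powr (- A) \<le> 1 / (nhat n * u_fun \<epsilon> n)"
      proof -
        have "(?r * nhat n powr (- A)) * (nhat n * u_fun \<epsilon> n) \<le> (nhat n powr (2 * D') * nhat n powr (- A)) * (nhat n powr 1 * nhat n powr (\<beta> / N))"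
          using r_le u_le nh0 u by (intro mult_mono) auto
        also have "\<dots> = 1" using nh0 by (simp only: powr_add[symmetric]) (simp add: A_def)
        finally show ?thesis using nu by (subst pos_le_divide_eq) auto
      qed
      then show ?thesis using i2 two C4 by (intro mult_left_mono add_mono) auto
    qed
    also have "\<dots> = C3 / (nhat n * u_fun \<epsilon> n)" by (simp add: C3_def algebra_simps add_divide_distrib)
    finally show ?case .
  qed
  from borel_cantelli_multi_index[OF eps Bev this]
  have "AE x in M. eventually (\<lambda>n. x \<notin> B n) multi_at_top" .
  then have "AE x in M. eventually (\<lambda>n. \<forall>\<zeta>\<in>F n.
      \<bar>centred_sum M Z \<zeta> n x\<bar> \<le> (two * \<eta>) * (nhat n * h n ^ d * ?\<Omega> n)) multi_at_top"
  proof (rule AE_mp, intro AE_I2 impI)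
    fix x assume x: "x \<in> space M" and "eventually (\<lambda>n. x \<notin> B n) multi_at_top"
    from this(2) fin test bwe show "eventually (\<lambda>n. \<forall>\<zeta>\<in>F n.
      \<bar>centred_sum M Z \<zeta> n x\<bar> \<le> (two * \<eta>) * (nhat n * h n ^ d * ?\<Omega> n)) multi_at_top"
    proof eventually_elim
      case (elim n)
      have "finite (F n) \<and> (\<forall>\<zeta>\<in>F n. \<zeta> \<in> borel_measurable borel) \<and> n \<in> pos_index"
        using elim unfolding local_test_def by blast
      then have "\<forall>\<zeta>\<in>F n. \<not> two * t n \<le> \<bar>centred_sum M Z \<zeta> n x\<bar>"
        using elim(1) x unfolding B_def by auto
      then show ?case by (force simp: t_def mult.assoc not_le)
    qed
  qed
  then show ?thesis using \<eta>0 two by (intro exI[of _ "two * \<eta>"]) auto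
qed

section \<open>Nets, kernels and elementary calculus\<close>

text \<open>
  Coordinates are rounded to a grid of mesh \<open>r / DIM\<close> and one point of \<open>S\<close> is chosen in every
  cell that meets \<open>S\<close>.
\<close>

lemma bounded_finite_net:
  fixes S :: "'a::euclidean_space set"
  assumes "bounded S"
  shows "\<exists>C>0. \<forall>r. 0 < r \<longrightarrow> r \<le> 1 \<longrightarrow>
    (\<exists>G\<subseteq>S. finite G \<and> real (card G) \<le> C * (1 / r) ^ DIM('a) \<and> (\<forall>x\<in>S. \<exists>y\<in>G. dist x y \<le> r))"
proof -
  obtain R where R: "0 < R" "\<And>x. x \<in> S \<Longrightarrow> norm x \<le> R" using assms bounded_pos by metis
  define D where "D = real DIM('a)"
  have D: "1 \<le> D" by (simp add: D_def Suc_leI)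
  show ?thesis
  proof (intro exI[of _ "(2 * R * D + 4) ^ DIM('a)"] conjI allI impI)
    show "0 < (2 * R * D + 4) ^ DIM('a)" using R D by (intro zero_less_power) (simp add: add_nonneg_pos)
    fix r :: real assume r: "0 < r" "r \<le> 1"
    define c where "c = r / D"
    have c: "0 < c" using r D by (simp add: c_def)
    define cell where "cell x = (\<lambda>b\<in>(Basis :: 'a set). \<lfloor>x \<bullet> b / c\<rfloor>)" for x :: 'a
    define I where "I = {\<lfloor>- R / c\<rfloor>..\<lfloor>R / c\<rfloor>}"
    have cardI: "real (card I) \<le> (2 * R * D + 4) / r"
    proof -
      have "- R / c \<le> R / c" using R c by (simp add: divide_right_mono)
      then have "\<lfloor>- R / c\<rfloor> \<le> \<lfloor>R / c\<rfloor>" by (rule floor_mono)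
      then have "real (card I) = real_of_int \<lfloor>R / c\<rfloor> + 1 - real_of_int \<lfloor>- R / c\<rfloor>" by (simp add: I_def)
      also have "\<dots> \<le> R / c + 1 - (- R / c - 1)" by linarith
      also have "\<dots> = 2 * R * D / r + 2" by (simp add: c_def)
      also have "\<dots> \<le> 2 * R * D / r + 4 / r" using r by (simp add: pos_le_divide_eq)
      finally show ?thesis by (simp add: add_divide_distrib)
    qed
    have sub: "cell ` S \<subseteq> Pi\<^sub>E Basis (\<lambda>_. I)"
    proof
      fix v assume "v \<in> cell ` S"
      then obtain x where x: "x \<in> S" "v = cell x" by auto
      have "\<lfloor>x \<bullet> b / c\<rfloor> \<in> I" if "b \<in> Basis" for b
      proof -
        have "\<bar>x \<bullet> b\<bar> \<le> R" using Basis_le_norm[OF that, of x] R(2)[OF x(1)] by linarith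
        then have "- R / c \<le> x \<bullet> b / c" "x \<bullet> b / c \<le> R / c" using c by (intro divide_right_mono; simp)+
        then show ?thesis unfolding I_def by (auto intro!: floor_mono)
      qed
      then show "v \<in> Pi\<^sub>E Basis (\<lambda>_. I)" unfolding x(2) cell_def by auto
    qed
    have finP: "finite (Pi\<^sub>E (Basis :: 'a set) (\<lambda>_. I))" by (intro finite_PiE) (auto simp: I_def)
    have fin: "finite (cell ` S)" using sub finP by (rule finite_subset)
    define G where "G = (\<lambda>v. SOME x. x \<in> S \<and> cell x = v) ` (cell ` S)"
    have rep: "(SOME y. y \<in> S \<and> cell y = cell x) \<in> S \<and> cell (SOME y. y \<in> S \<and> cell y = cell x) = cell x" if "x \<in> S" for x
      by (rule someI[of _ x]) (use that in simp)
    show "\<exists>G\<subseteq>S. finite G \<and> real (card G) \<le> (2 * R * D + 4) ^ DIM('a) * (1 / r) ^ DIM('a) \<and> (\<forall>x\<in>S. \<exists>y\<in>G. dist x y \<le> r)"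
    proof (intro exI[of _ G] conjI ballI)
      show "G \<subseteq> S" unfolding G_def using rep by blast
      show "finite G" unfolding G_def using fin by simp
      have "card G \<le> card (cell ` S)" unfolding G_def using fin by (rule card_image_le)
      also have "\<dots> \<le> card (Pi\<^sub>E (Basis :: 'a set) (\<lambda>_. I))" using finP sub by (rule card_mono)
      also have "\<dots> = card I ^ DIM('a)" by (simp add: card_PiE)
      finally have "real (card G) \<le> real (card I) ^ DIM('a)" by (metis of_nat_mono of_nat_power)
      also have "\<dots> \<le> ((2 * R * D + 4) / r) ^ DIM('a)" using cardI by (intro power_mono) auto
      finally show "real (card G) \<le> (2 * R * D + 4) ^ DIM('a) * (1 / r) ^ DIM('a)"
        by (simp add: power_divide)
      fix x assume x: "x \<in> S"
      let ?y = "SOME y. y \<in> S \<and> cell y = cell x"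
      have cl: "cell ?y = cell x" using rep[OF x] by simp
      have "norm (x - ?y) \<le> (\<Sum>b\<in>Basis. \<bar>(x - ?y) \<bullet> b\<bar>)" by (rule norm_le_l1)
      also have "\<dots> \<le> (\<Sum>b\<in>(Basis :: 'a set). c)"
      proof (rule sum_mono)
        fix b :: 'a assume b: "b \<in> Basis"
        have "\<lfloor>?y \<bullet> b / c\<rfloor> = \<lfloor>x \<bullet> b / c\<rfloor>" using fun_cong[OF cl, of b] b by (simp add: cell_def)
        then have "\<bar>x \<bullet> b / c - ?y \<bullet> b / c\<bar> \<le> 1" by linarith
        also have "x \<bullet> b / c - ?y \<bullet> b / c = ((x - ?y) \<bullet> b) / c" by (simp add: inner_diff_left diff_divide_distrib)
        finally show "\<bar>(x - ?y) \<bullet> b\<bar> \<le> c" using c by (simp add: abs_divide)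
      qed
      also have "\<dots> = r" using D by (simp add: c_def D_def)
      finally have "dist x ?y \<le> r" by (simp add: dist_norm)
      moreover have "?y \<in> G" using x unfolding G_def by blast
      ultimately show "\<exists>y\<in>G. dist x y \<le> r" by blast
    qed
  qed
qed

lemma kernel_bounds:
  fixes k :: "'v::euclidean_space \<Rightarrow> real"
  assumes "lipschitz_fun k" "compact_support k"
  obtains R B L where "0 < R" "0 < B" "0 \<le> L" "\<And>s. R \<le> norm s \<Longrightarrow> k s = 0" "\<And>s. \<bar>k s\<bar> \<le> B"
    "\<And>s t. \<bar>k s - k t\<bar> \<le> L * dist s t"
proof -
  obtain L where L: "L-lipschitz_on UNIV k" using assms(1) unfolding lipschitz_fun_def by blast
  then have lip: "\<bar>k s - k t\<bar> \<le> L * dist s t" for s t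
    using lipschitz_onD[OF L, of s t] by (simp add: dist_real_def)
  have L0: "0 \<le> L" using L by (rule lipschitz_on_nonneg)
  have "bounded {s. k s \<noteq> 0}"
    using assms(2) unfolding compact_support_def by (meson bounded_subset closure_subset compact_imp_bounded)
  then obtain R where R: "0 < R" "\<And>s. k s \<noteq> 0 \<Longrightarrow> norm s < R"
    unfolding bounded_pos_less by blast
  obtain s0 :: 'v where s0: "norm s0 = R" using vector_choose_size[of R] R(1) by auto
  have k0: "k s = 0" if "R \<le> norm s" for s using R(2)[of s] that by auto
  show thesis
  proof (rule that)
    show "0 < R" by fact
    show "0 < L * (2 * R) + 1" using R(1) L0 by (simp add: add_nonneg_pos)
    show "\<bar>k s\<bar> \<le> L * (2 * R) + 1" for s
    proof (cases "R \<le> norm s")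
      case True
      then show ?thesis using k0[OF True] R(1) L0 by simp
    next
      case False
      have "\<bar>k s\<bar> \<le> L * dist s s0" using lip[of s s0] k0[of s0] s0 by simp
      also have "dist s s0 \<le> 2 * R" using False s0 norm_triangle_ineq4[of s s0] by (simp add: dist_norm)
      finally show ?thesis using L0 by (simp add: mult_left_mono)
    qed
  qed (use L0 k0 lip in auto)
qed

text \<open>
  The distribution function of the density \<open>w\<close>; up to scaling it is the smoothed indicator that the
  estimator uses in the variable \<open>y\<close>.
\<close>

definition primitive :: "(real \<Rightarrow> real) \<Rightarrow> real \<Rightarrow> real" where
  "primitive w s = (LINT z|lborel. indicator {..s} z * w z)"

lemma smoothed_indicator_eq:
  fixes w :: "real \<Rightarrow> real"
  assumes "0 < h"
  shows "(LINT z:{..y}|lborel. w ((z - t) / h)) = h * primitive w ((y - t) / h)"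
proof -
  have "(LINT z:{..y}|lborel. w ((z - t) / h)) = (LINT z|lborel. indicator {..y} z * w ((z - t) / h))"
    by (simp add: set_lebesgue_integral_def)
  also have "\<dots> = h * (LINT z|lborel. indicator {..y} (t + h * z) * w ((t + h * z - t) / h))"
    using assms by (subst lborel_integral_real_affine[where c=h and t=t]) auto
  also have "(\<lambda>z. indicator {..y} (t + h * z) * w ((t + h * z - t) / h)) = (\<lambda>z. indicator {..(y - t) / h} z * w z)"
    using assms by (auto simp: indicator_def fun_eq_iff field_simps)
  finally show ?thesis by (simp add: primitive_def)
qed

lemma primitive_properties:
  assumes w: "prob_density w" and B: "\<And>z. \<bar>w z\<bar> \<le> B" and R: "\<forall>z. R \<le> norm z \<longrightarrow> w z = 0"
  shows "0 \<le> primitive w s" "primitive w s \<le> 1" "R \<le> s \<Longrightarrow> primitive w s = 1" "s \<le> - R \<Longrightarrow> primitive w s = 0"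
    and "mono (primitive w)" "\<bar>primitive w s - primitive w t\<bar> \<le> B * \<bar>s - t\<bar>"
proof -
  have w0: "0 \<le> w z" for z using w by (simp add: prob_density_def)
  have iw: "integrable lborel w" and w1: "(LINT z|lborel. w z) = 1" using w by (auto simp: prob_density_def)
  have ii: "integrable lborel (\<lambda>z. indicator A z * w z)" if "A \<in> sets borel" for A
    using integrable_mult_indicator[of A lborel w] iw that by simp
  show "0 \<le> primitive w s" unfolding primitive_def using w0 by (intro Bochner_Integration.integral_nonneg) auto
  have "primitive w s \<le> (LINT z|lborel. w z)"
    unfolding primitive_def
  proof (rule integral_mono)
    show "integrable lborel (\<lambda>z. indicator {..s} z * w z)" by (rule ii) simp
  qed (use iw w0 in \<open>auto simp: indicator_def\<close>)
  then show "primitive w s \<le> 1" using w1 by simp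
  show "primitive w s = 1" if "R \<le> s"
  proof -
    have "(\<lambda>z. indicator {..s} z * w z) = w"
      using that R by (auto simp: fun_eq_iff indicator_def)
    then show ?thesis unfolding primitive_def using w1 by simp
  qed
  show "primitive w s = 0" if "s \<le> - R"
  proof -
    have "(\<lambda>z. indicator {..s} z * w z) = (\<lambda>_. 0)"
      using that R by (auto simp: fun_eq_iff indicator_def)
    then show ?thesis unfolding primitive_def by simp
  qed
  have inc: "0 \<le> primitive w b - primitive w a \<and> primitive w b - primitive w a \<le> B * (b - a)" if "a \<le> b" for a b
  proof -
    have "primitive w b - primitive w a = (LINT z|lborel. indicator {..b} z * w z - indicator {..a} z * w z)"
      unfolding primitive_def using ii by simp
    also have "(\<lambda>z. indicator {..b} z * w z - indicator {..a} z * w z) = (\<lambda>z. indicator {a<..b} z * w z)"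
      using that by (auto simp: fun_eq_iff indicator_def)
    finally have eq: "primitive w b - primitive w a = (LINT z|lborel. indicator {a<..b} z * w z)" .
    have "(LINT z|lborel. indicator {a<..b} z * w z) \<le> (LINT z|lborel. indicator {a<..b} z * B)"
    proof (rule integral_mono)
      show "integrable lborel (\<lambda>z. indicator {a<..b} z * B)" using that by simp
      show "indicator {a<..b} z * w z \<le> indicator {a<..b} z * B" for z
        using B[of z] by (auto simp: indicator_def)
    qed (use ii in auto)
    also have "\<dots> = B * (b - a)" using that by simp
    finally show ?thesis unfolding eq using w0 by (auto intro!: Bochner_Integration.integral_nonneg)
  qed
  show "mono (primitive w)" using inc by (intro monoI) force
  show "\<bar>primitive w s - primitive w t\<bar> \<le> B * \<bar>s - t\<bar>"
    using inc[of s t] inc[of t s] by (cases "s \<le> t") auto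
qed

text \<open>
  Landau's inequality: the mean value theorem yields a point where the first derivative is at most
  \<open>2 / \<delta>\<close>, and the second derivative controls how far it can move from there. It bounds first partial
  derivatives of which nothing but existence is known.
\<close>

lemma second_derivative_interpolation:
  fixes \<phi> \<phi>' \<phi>'' :: "real \<Rightarrow> real"
  assumes \<delta>: "0 < \<delta>"
    and d1: "\<And>t. 0 \<le> t \<Longrightarrow> t \<le> \<delta> \<Longrightarrow> (\<phi> has_real_derivative \<phi>' t) (at t)"
    and d2: "\<And>t. 0 \<le> t \<Longrightarrow> t \<le> \<delta> \<Longrightarrow> (\<phi>' has_real_derivative \<phi>'' t) (at t)"
    and b: "\<And>t. 0 \<le> t \<Longrightarrow> t \<le> \<delta> \<Longrightarrow> \<bar>\<phi> t\<bar> \<le> 1"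
    and b2: "\<And>t. 0 \<le> t \<Longrightarrow> t \<le> \<delta> \<Longrightarrow> \<bar>\<phi>'' t\<bar> \<le> B"
  shows "\<bar>\<phi>' 0\<bar> \<le> 2 / \<delta> + B * \<delta>"
proof -
  obtain z where z: "0 < z" "z < \<delta>" "\<phi> \<delta> - \<phi> 0 = (\<delta> - 0) * \<phi>' z"
    using MVT2[of 0 \<delta> \<phi> \<phi>'] \<delta> d1 by auto
  obtain y where y: "0 < y" "y < z" "\<phi>' z - \<phi>' 0 = (z - 0) * \<phi>'' y"
    using MVT2[of 0 z \<phi>' \<phi>''] z d2 by auto
  have "\<delta> * \<bar>\<phi>' z\<bar> = \<bar>\<phi> \<delta> - \<phi> 0\<bar>" using z \<delta> by (simp add: abs_mult)
  also have "\<dots> \<le> 2" using b[of \<delta>] b[of 0] \<delta> by auto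
  finally have 1: "\<bar>\<phi>' z\<bar> \<le> 2 / \<delta>" using \<delta> by (simp add: field_simps)
  have "\<bar>\<phi>' z - \<phi>' 0\<bar> = z * \<bar>\<phi>'' y\<bar>" using y z by (simp add: abs_mult)
  also have "\<dots> \<le> \<delta> * B" using z y b2[of y] by (intro mult_mono) auto
  finally show ?thesis using 1 by (simp add: mult.commute)
qed

lemma partial_derivative_along_line:
  assumes "has_partial_on U v F" "z + t *\<^sub>R v \<in> U"
  shows "((\<lambda>t. F (z + t *\<^sub>R v)) has_real_derivative partial v F (z + t *\<^sub>R v)) (at t)"
proof -
  have "(\<lambda>s. F (z + t *\<^sub>R v + s *\<^sub>R v)) field_differentiable at 0"
    using assms unfolding has_partial_on_def by blast
  then have "((\<lambda>s. F (z + t *\<^sub>R v + s *\<^sub>R v)) has_real_derivative partial v F (z + t *\<^sub>R v)) (at 0)"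
    unfolding partial_def by (rule field_differentiable_derivI)
  then have "((\<lambda>s. F (z + (s + t) *\<^sub>R v)) has_real_derivative partial v F (z + t *\<^sub>R v)) (at 0)"
    by (simp add: scaleR_add_left add_ac)
  then show ?thesis using DERIV_shift[of "\<lambda>t. F (z + t *\<^sub>R v)" _ 0 t] by simp
qed

text \<open>
  The coordinates are changed one at a time. All intermediate points lie coordinatewise between
  \<open>x\<close> and \<open>s\<close> and hence in the ball in which the derivatives are bounded.
\<close>

lemma lipschitz_from_coordinate_derivatives:
  fixes H :: "real ^ 'd::finite \<Rightarrow> real" and H' :: "'d \<Rightarrow> real ^ 'd \<Rightarrow> real"
  assumes d: "\<And>l z t. dist x (z + t *\<^sub>R axis l 1) \<le> r \<Longrightarrow>
      ((\<lambda>t. H (z + t *\<^sub>R axis l 1)) has_real_derivative H' l (z + t *\<^sub>R axis l 1)) (at t)"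
    and b: "\<And>l z. dist x z \<le> r \<Longrightarrow> \<bar>H' l z\<bar> \<le> B"
    and s: "dist x s \<le> r"
  shows "\<bar>H s - H x\<bar> \<le> real CARD('d) * B * dist x s"
proof -
  define P where "P I = (\<chi> k. if k \<in> I then s $ k else x $ k)" for I
  have r: "0 \<le> r" using s zero_le_dist order_trans by blast
  have B: "0 \<le> B" using b[of x undefined] r by simp
  have step: "\<bar>H (P (insert l I)) - H (P I)\<bar> \<le> B * dist x s" if l: "l \<notin> I" for l I
  proof -
    let ?u = "s $ l - x $ l"
    have Pl: "P (insert l I) = P I + ?u *\<^sub>R axis l 1"
      using l by (auto simp: P_def vec_eq_iff axis_def)
    have near: "dist x (P I + t *\<^sub>R axis l 1) \<le> dist x s" if t: "\<bar>t\<bar> \<le> \<bar>?u\<bar>" for t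
    proof -
      have "norm (P I + t *\<^sub>R axis l 1 - x) \<le> norm (s - x)"
      proof (rule norm_le_componentwise_cart)
        fix k show "norm ((P I + t *\<^sub>R axis l 1 - x) $ k) \<le> norm ((s - x) $ k)"
          using l t by (auto simp: P_def axis_def)
      qed
      then show ?thesis by (simp add: dist_norm norm_minus_commute)
    qed
    have der: "((\<lambda>t. H (P I + t *\<^sub>R axis l 1)) has_real_derivative H' l (P I + t *\<^sub>R axis l 1)) (at t)"
      and bd: "\<bar>H' l (P I + t *\<^sub>R axis l 1)\<bar> \<le> B" if "\<bar>t\<bar> \<le> \<bar>?u\<bar>" for t
      using near[OF that] s d b by (meson order_trans)+
    have u: "\<bar>?u\<bar> \<le> dist x s" using component_le_norm_cart[of "s - x" l] by (simp add: dist_norm norm_minus_commute)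
    have "\<bar>H (P I + ?u *\<^sub>R axis l 1) - H (P I + 0 *\<^sub>R axis l 1)\<bar> \<le> B * \<bar>?u\<bar>"
    proof (cases ?u "0::real" rule: linorder_cases)
      case less
      then obtain z where "?u < z" "z < 0" "H (P I + 0 *\<^sub>R axis l 1) - H (P I + ?u *\<^sub>R axis l 1) = (0 - ?u) * H' l (P I + z *\<^sub>R axis l 1)"
        using MVT2[of ?u 0 "\<lambda>t. H (P I + t *\<^sub>R axis l 1)" "\<lambda>t. H' l (P I + t *\<^sub>R axis l 1)"] der by auto
      then show ?thesis using bd[of z] less
        by (subst abs_minus_commute) (simp add: abs_mult mult.commute mult_right_mono)
    next
      case greater
      then obtain z where "0 < z" "z < ?u" "H (P I + ?u *\<^sub>R axis l 1) - H (P I + 0 *\<^sub>R axis l 1) = (?u - 0) * H' l (P I + z *\<^sub>R axis l 1)"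
        using MVT2[of 0 ?u "\<lambda>t. H (P I + t *\<^sub>R axis l 1)" "\<lambda>t. H' l (P I + t *\<^sub>R axis l 1)"] der by auto
      then show ?thesis using bd[of z] greater
        by (simp add: abs_mult mult.commute mult_right_mono)
    qed simp
    also have "\<dots> \<le> B * dist x s" using u B by (rule mult_left_mono)
    finally show ?thesis unfolding Pl by simp
  qed
  have "\<bar>H (P I) - H x\<bar> \<le> real (card I) * B * dist x s" if "finite I" for I
    using that
  proof (induction I)
    case empty
    have "P {} = x" by (simp add: P_def vec_eq_iff)
    then show ?case by simp
  next
    case (insert l I)
    have "\<bar>H (P (insert l I)) - H x\<bar> \<le> B * dist x s + real (card I) * B * dist x s"
      using step[OF insert.hyps(2)] insert.IH by linarith
    then show ?case using insert.hyps by (simp add: algebra_simps)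
  qed
  from this[of UNIV] have "\<bar>H (P UNIV) - H x\<bar> \<le> real CARD('d) * B * dist x s" by simp
  moreover have "P UNIV = s" by (simp add: P_def vec_eq_iff)
  ultimately show ?thesis by simp
qed

lemma lborel_integral_scaled:
  fixes k :: "'v::euclidean_space \<Rightarrow> real"
  assumes "k \<in> borel_measurable borel" "0 < h"
  shows "(LINT s|lborel. k ((x - s) /\<^sub>R h)) = h ^ DIM('v) * (LINT s|lborel. k s)"
proof -
  have T: "(lborel :: 'v measure) = density (distr lborel borel (\<lambda>s. x + (- h) *\<^sub>R s)) (\<lambda>_. ennreal (\<bar>- h\<bar> ^ DIM('v)))"
    using assms(2) by (intro lborel_affine) auto
  have [measurable]: "k \<in> borel_measurable borel" by fact
  have "(LINT s|lborel. k ((x - s) /\<^sub>R h)) = (LINT s|density (distr lborel borel (\<lambda>s. x + (- h) *\<^sub>R s)) (\<lambda>_. ennreal (\<bar>- h\<bar> ^ DIM('v))). k ((x - s) /\<^sub>R h))"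
    by (subst (1) T) simp
  also have "\<dots> = (LINT s|distr lborel borel (\<lambda>s. x + (- h) *\<^sub>R s). \<bar>- h\<bar> ^ DIM('v) * k ((x - s) /\<^sub>R h))"
    by (subst integral_density) auto
  also have "\<dots> = (LINT s|lborel. \<bar>- h\<bar> ^ DIM('v) * k ((x - (x + (- h) *\<^sub>R s)) /\<^sub>R h))"
    by (subst integral_distr) auto
  also have "(\<lambda>s. (x - (x + (- h) *\<^sub>R s)) /\<^sub>R h) = (\<lambda>s. s)"
    using assms(2) by (simp add: fun_eq_iff)
  finally show ?thesis using assms(2) by simp
qed

section \<open>Conditional distribution functions\<close>

lemma (in prob_space) expectation_product_form:
  fixes X :: "'a \<Rightarrow> real ^ 'd::finite" and Y :: "'a \<Rightarrow> real"
  assumes law: "distributed M lborel (\<lambda>\<omega>. (X \<omega>, Y \<omega>)) (\<lambda>z. ennreal (f z))"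
    and f: "\<forall>z. 0 \<le> f z" "f \<in> borel_measurable borel"
    and k: "k \<in> borel_measurable borel" "\<And>s. \<bar>k s\<bar> \<le> Bk"
    and v: "v \<in> borel_measurable borel" "\<And>t. \<bar>v t\<bar> \<le> Bv"
  shows "expectation (\<lambda>\<omega>. k (X \<omega>) * v (Y \<omega>)) = (LINT s|lborel. k s * (LINT t|lborel. v t * f (s, t)))"
    and "integrable lborel (\<lambda>s. k s * (LINT t|lborel. v t * f (s, t)))"
proof -
  have [measurable]: "f \<in> borel_measurable borel" "k \<in> borel_measurable borel" "v \<in> borel_measurable borel"
    using f k v by auto
  have XY [measurable]: "random_variable lborel (\<lambda>\<omega>. (X \<omega>, Y \<omega>))" using law by (rule distributed_measurable)
  define u where "u = (\<lambda>z :: (real ^ 'd) \<times> real. k (fst z) * v (snd z))"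
  have "u \<in> borel_measurable (borel \<Otimes>\<^sub>M borel)" unfolding u_def by measurable
  then have u [measurable]: "u \<in> borel_measurable lborel" by (simp add: borel_prod)
  have ub: "\<bar>u z\<bar> \<le> Bk * Bv" for z
    unfolding u_def abs_mult using k(2) v(2) by (intro mult_mono) (auto intro: order_trans[OF abs_ge_zero])
  have iu: "integrable M (\<lambda>\<omega>. u (X \<omega>, Y \<omega>))"
    by (rule integrable_const_bound[where B="Bk * Bv"]) (use ub in auto)
  have eq: "expectation (\<lambda>\<omega>. u (X \<omega>, Y \<omega>)) = (LINT z|lborel. f z * u z)"
    using distributed_integral[OF law u] f by simp
  have "integrable lborel (\<lambda>z. f z * u z)"
    using distributed_integrable[OF law u] f iu by simp
  then have int: "integrable (lborel \<Otimes>\<^sub>M lborel) (\<lambda>z. f z * u z)" by (simp add: lborel_prod)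
  have inner: "(LINT t|lborel. f (s, t) * u (s, t)) = k s * (LINT t|lborel. v t * f (s, t))" for s
    by (simp add: u_def mult_ac)
  show "expectation (\<lambda>\<omega>. k (X \<omega>) * v (Y \<omega>)) = (LINT s|lborel. k s * (LINT t|lborel. v t * f (s, t)))"
    using eq lborel_pair.integral_fst'[OF int] unfolding inner by (simp add: u_def lborel_prod)
  show "integrable lborel (\<lambda>s. k s * (LINT t|lborel. v t * f (s, t)))"
    using lborel_pair.integrable_fst'[OF int] unfolding inner .
qed

lemma (in prob_space) expectation_marginal_form:
  fixes X :: "'a \<Rightarrow> real ^ 'd::finite" and Y :: "'a \<Rightarrow> real"
  assumes law: "distributed M lborel (\<lambda>\<omega>. (X \<omega>, Y \<omega>)) (\<lambda>z. ennreal (f z))"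
    and f: "\<forall>z. 0 \<le> f z" "f \<in> borel_measurable borel"
    and k: "k \<in> borel_measurable borel" "\<And>s. \<bar>k s\<bar> \<le> Bk"
  shows "expectation (\<lambda>\<omega>. k (X \<omega>)) = (LINT s|lborel. k s * marginal_density f s)"
    and "integrable lborel (\<lambda>s. k s * marginal_density f s)"
  using expectation_product_form[OF law f k, of "\<lambda>_. 1" 1] by (simp_all add: marginal_density_def)

lemma integrable_section:
  assumes "marginal_density f s > 0"
  shows "integrable lborel (\<lambda>t. f (s, t))"
  using assms not_integrable_integral_eq[of lborel "\<lambda>t. f (s, t)"] unfolding marginal_density_def by force

lemma integrable_section_mult:
  assumes g: "marginal_density f s > 0"
    and v: "v \<in> borel_measurable borel" "\<And>t. \<bar>v t\<bar> \<le> 1"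
  shows "integrable lborel (\<lambda>t. v t * f (s, t))"
proof (rule Bochner_Integration.integrable_bound[OF integrable_section[OF g]])
  have "(\<lambda>t. f (s, t)) \<in> borel_measurable lborel" using integrable_section[OF g] by (rule borel_measurable_integrable)
  then show "(\<lambda>t. v t * f (s, t)) \<in> borel_measurable lborel" using v(1) by (intro borel_measurable_times) auto
  show "AE t in lborel. norm (v t * f (s, t)) \<le> norm (f (s, t))"
    using v(2) by (auto simp: abs_mult intro!: mult_left_le_one_le)
qed

lemma cond_cdf_eq:
  "cond_cdf f y s = (LINT t|lborel. indicator {..y} t * f (s, t)) / marginal_density f s"
  unfolding cond_cdf_def cond_density_def set_lebesgue_integral_def by simp

lemma cond_cdf_bounds:
  assumes f: "\<forall>z. 0 \<le> f z" and g: "marginal_density f s > 0"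
  shows "0 \<le> cond_cdf f y s" "cond_cdf f y s \<le> 1"
proof -
  have "(LINT t|lborel. indicator {..y} t * f (s, t)) \<le> marginal_density f s"
    unfolding marginal_density_def
    by (rule integral_mono)
      (use f integrable_section[OF g] integrable_section_mult[OF g, of "indicator {..y}"] in \<open>auto simp: indicator_def\<close>)
  then show "cond_cdf f y s \<le> 1" using g by (simp add: cond_cdf_eq)
  show "0 \<le> cond_cdf f y s" unfolding cond_cdf_eq using f g by (intro divide_nonneg_pos Bochner_Integration.integral_nonneg) auto
qed

lemma cond_cdf_lipschitz_y:
  assumes f: "\<forall>z. 0 \<le> f z" "\<And>z. f z \<le> B" and g: "marginal_density f s > 0"
  shows "\<bar>cond_cdf f y s - cond_cdf f y' s\<bar> \<le> B / marginal_density f s * \<bar>y - y'\<bar>"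
proof -
  let ?I = "\<lambda>y. LINT t|lborel. indicator {..y} t * f (s, t)"
  have ii: "integrable lborel (\<lambda>t. indicator A t * f (s, t))" if "A \<in> sets borel" for A
    using that by (intro integrable_section_mult[OF g]) (auto simp: indicator_def)
  have inc: "0 \<le> ?I b - ?I a \<and> ?I b - ?I a \<le> B * (b - a)" if "a \<le> b" for a b
  proof -
    have "?I b - ?I a = (LINT t|lborel. indicator {..b} t * f (s, t) - indicator {..a} t * f (s, t))"
      using ii[of "{..b}"] ii[of "{..a}"] by simp
    also have "(\<lambda>t. indicator {..b} t * f (s, t) - indicator {..a} t * f (s, t)) = (\<lambda>t. indicator {a<..b} t * f (s, t))"
      using that by (auto simp: fun_eq_iff indicator_def)
    finally have eq: "?I b - ?I a = (LINT t|lborel. indicator {a<..b} t * f (s, t))" .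
    have "(LINT t|lborel. indicator {a<..b} t * f (s, t)) \<le> (LINT t|lborel. indicator {a<..b} t * B)"
    proof (rule integral_mono)
      show "integrable lborel (\<lambda>t. indicator {a<..b} t * f (s, t))" by (rule ii) simp
      show "integrable lborel (\<lambda>t. indicator {a<..b} t * B)" using that by simp
      show "indicator {a<..b} t * f (s, t) \<le> indicator {a<..b} t * B" for t
        using f(2)[of "(s, t)"] by (auto simp: indicator_def)
    qed
    also have "\<dots> = B * (b - a)" using that by simp
    finally show ?thesis unfolding eq using f by (auto intro!: Bochner_Integration.integral_nonneg)
  qed
  have "\<bar>?I y - ?I y'\<bar> \<le> B * \<bar>y - y'\<bar>"
    using inc[of y y'] inc[of y' y] by (cases "y \<le> y'") auto
  then have "\<bar>?I y - ?I y'\<bar> / marginal_density f s \<le> B * \<bar>y - y'\<bar> / marginal_density f s"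
    using g by (intro divide_right_mono) auto
  then show ?thesis unfolding cond_cdf_eq using g by (simp add: diff_divide_distrib[symmetric] abs_divide)
qed

text \<open>
  As \<open>v\<close> lies between the indicators of two half-lines, its integral against \<open>f (s, t)\<close> in \<open>t\<close> lies between
  the values at \<open>y - \<delta>\<close> and \<open>y + \<delta>\<close> of the conditional distribution function, times the marginal
  density at \<open>s\<close>.
\<close>

lemma (in prob_space) smoothed_cdf_bias:
  fixes X :: "'a \<Rightarrow> real ^ 'd::finite" and Y :: "'a \<Rightarrow> real"
  assumes law: "distributed M lborel (\<lambda>\<omega>. (X \<omega>, Y \<omega>)) (\<lambda>z. ennreal (f z))"
    and f: "\<forall>z. 0 \<le> f z" "f \<in> borel_measurable borel"
    and k: "k \<in> borel_measurable borel" "\<And>s. 0 \<le> k s" "\<And>s. k s \<le> Bk"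
    and v: "v \<in> borel_measurable borel" "\<And>t. indicator {..y - \<delta>} t \<le> v t" "\<And>t. v t \<le> indicator {..y + \<delta>} t"
    and near: "\<And>s. k s \<noteq> 0 \<Longrightarrow> marginal_density f s > 0 \<and>
        \<bar>cond_cdf f (y - \<delta>) s - c\<bar> \<le> \<Lambda> \<and> \<bar>cond_cdf f (y + \<delta>) s - c\<bar> \<le> \<Lambda>"
  shows "\<bar>expectation (\<lambda>\<omega>. k (X \<omega>) * v (Y \<omega>)) - c * expectation (\<lambda>\<omega>. k (X \<omega>))\<bar> \<le> \<Lambda> * expectation (\<lambda>\<omega>. k (X \<omega>))"
proof -
  let ?g = "marginal_density f"
  have v1: "\<bar>v t\<bar> \<le> 1" for t
    using order_trans[OF indicator_pos_le v(2)[of t]] order_trans[OF v(3)[of t] indicator_le_1] by simp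
  have kb: "\<bar>k s\<bar> \<le> Bk" for s using k(2,3)[of s] by simp
  note e1 = expectation_product_form[OF law f k(1) kb v(1) v1]
  note e2 = expectation_marginal_form[OF law f k(1) kb]
  let ?J = "\<lambda>s. LINT t|lborel. v t * f (s, t)"
  have cdf: "?g s * cond_cdf f y' s = (LINT t|lborel. indicator {..y'} t * f (s, t))" if "?g s > 0" for s y'
    using that by (simp add: cond_cdf_eq)
  have up: "k s * ?J s \<le> (c + \<Lambda>) * (k s * ?g s)" and low: "(c - \<Lambda>) * (k s * ?g s) \<le> k s * ?J s" for s
  proof -
    have "k s * ?J s \<le> (c + \<Lambda>) * (k s * ?g s) \<and> (c - \<Lambda>) * (k s * ?g s) \<le> k s * ?J s"
    proof (cases "k s = 0")
      case False
      note nr = near[OF False]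
      then have g: "?g s > 0" by simp
      have iv: "integrable lborel (\<lambda>t. v t * f (s, t))" using v(1) v1 by (intro integrable_section_mult[OF g])
      have ii: "integrable lborel (\<lambda>t. indicator {..a} t * f (s, t))" for a
        by (intro integrable_section_mult[OF g]) (auto simp: indicator_def)
      have "?J s \<le> (LINT t|lborel. indicator {..y + \<delta>} t * f (s, t))"
        using v(3) f(1) by (intro integral_mono iv ii mult_right_mono) auto
      also have "\<dots> = ?g s * cond_cdf f (y + \<delta>) s" using cdf[OF g] by simp
      also have "\<dots> \<le> ?g s * (c + \<Lambda>)" using nr by (intro mult_left_mono) auto
      finally have a: "?J s \<le> ?g s * (c + \<Lambda>)" .
      have "?g s * (c - \<Lambda>) \<le> ?g s * cond_cdf f (y - \<delta>) s" using nr by (intro mult_left_mono) auto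
      also have "\<dots> = (LINT t|lborel. indicator {..y - \<delta>} t * f (s, t))" using cdf[OF g] by simp
      also have "\<dots> \<le> ?J s"
        using v(2) f(1) by (intro integral_mono iv ii mult_right_mono) auto
      finally have b: "?g s * (c - \<Lambda>) \<le> ?J s" .
      show ?thesis using mult_left_mono[OF a k(2)[of s]] mult_left_mono[OF b k(2)[of s]] by (simp add: mult_ac)
    qed simp
    then show "k s * ?J s \<le> (c + \<Lambda>) * (k s * ?g s)" "(c - \<Lambda>) * (k s * ?g s) \<le> k s * ?J s" by auto
  qed
  have "(LINT s|lborel. k s * ?J s) \<le> (LINT s|lborel. (c + \<Lambda>) * (k s * ?g s))"
    using e1(2) e2(2) up by (intro integral_mono) auto
  moreover have "(LINT s|lborel. (c - \<Lambda>) * (k s * ?g s)) \<le> (LINT s|lborel. k s * ?J s)"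
    using e1(2) e2(2) low by (intro integral_mono) auto
  ultimately have "(LINT s|lborel. k s * ?J s) \<le> (c + \<Lambda>) * (LINT s|lborel. k s * ?g s)"
    "(c - \<Lambda>) * (LINT s|lborel. k s * ?g s) \<le> (LINT s|lborel. k s * ?J s)" by simp_all
  then show ?thesis unfolding e1(1) e2(1) by (simp add: algebra_simps abs_le_iff)
qed

text \<open>
  In \<open>y\<close> the Lipschitz constant is \<open>B\<close> over a lower bound of the marginal density. In \<open>x\<close>, the pure
  second derivatives are bounded on a compact neighbourhood, the function itself takes values in
  \<open>[0, 1]\<close>, and interpolation bounds the first derivatives on a smaller neighbourhood.
\<close>

lemma cond_cdf_lipschitz_near_compact:
  fixes f :: "(real ^ 'd::finite) \<times> real \<Rightarrow> real" and S :: "(real ^ 'd) set" and V :: "real set"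
  defines "g \<equiv> marginal_density f" and "H \<equiv> \<lambda>(x, y). cond_cdf f y x"
  assumes f: "\<forall>z. 0 \<le> f z" "\<And>z. f z \<le> B" and g: "continuous_on UNIV g" "\<forall>x\<in>S. g x > 0"
    and S: "compact S" and V: "compact V"
    and H1: "\<And>l. has_partial_on {(x, y). g x > 0} (dir_x l) H"
    and H2: "\<And>l. has_partial_on {(x, y). g x > 0} (dir_x l) (partial (dir_x l) H)"
    and H2c: "\<And>l. continuous_on {(x, y). g x > 0} (partial (dir_x l) (partial (dir_x l) H))"
  shows "\<exists>\<delta>>0. \<exists>CF\<ge>0. \<exists>gm>0. \<exists>gM>0. \<forall>x\<in>S. \<forall>s. dist x s \<le> \<delta> \<longrightarrow> gm \<le> g s \<and> g s \<le> gM \<and>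
    (\<forall>y\<in>V. \<forall>y'. \<bar>cond_cdf f y' s - cond_cdf f y x\<bar> \<le> CF * (dist x s + \<bar>y' - y\<bar>))"
proof (cases "S = {}")
  case True
  then show ?thesis by (intro exI[of _ 1]) (auto intro!: exI[of _ 1])
next
  case False
  have openG: "open {x. g x > 0}"
    using g(1) by (intro open_Collect_less continuous_on_const)
  obtain e where e: "0 < e" "(\<Union>x\<in>S. ball x e) \<subseteq> {x. g x > 0}"
    using compact_subset_open_imp_ball_epsilon_subset[OF S openG] g(2) by auto
  define \<delta> where "\<delta> = e / 3"
  have \<delta>: "0 < \<delta>" using e by (simp add: \<delta>_def)
  define S1 where "S1 = {x + y | x y. x \<in> S \<and> y \<in> cball 0 (2 * \<delta>)}"
  have S1c: "compact S1" unfolding S1_def using S by (intro compact_sums compact_cball)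
  have S1I: "s \<in> S1" if "x \<in> S" "dist x s \<le> 2 * \<delta>" for x s
    unfolding S1_def using that by (intro CollectI exI[of _ x] exI[of _ "s - x"]) (auto simp: dist_norm norm_minus_commute)
  have S1pos: "g s > 0" if "s \<in> S1" for s
  proof -
    from that obtain x y where "x \<in> S" "s = x + y" "norm y \<le> 2 * \<delta>" by (auto simp: S1_def)
    then have "s \<in> ball x e" using e by (auto simp: dist_norm \<delta>_def)
    then have "s \<in> (\<Union>x\<in>S. ball x e)" using \<open>x \<in> S\<close> by blast
    then show ?thesis using e(2) by blast
  qed
  have S1ne: "S1 \<noteq> {}" using S1I[of _] False \<delta> by (metis all_not_in_conv dist_self less_eq_real_def mult_pos_pos zero_less_numeral)
  have gc: "continuous_on S1 g" using g(1) continuous_on_subset by blast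
  obtain s1 where s1: "s1 \<in> S1" "\<forall>s\<in>S1. g s1 \<le> g s" using continuous_attains_inf[OF S1c S1ne gc] by blast
  obtain s2 where s2: "s2 \<in> S1" "\<forall>s\<in>S1. g s \<le> g s2" using continuous_attains_sup[OF S1c S1ne gc] by blast
  have "\<exists>M2. \<forall>l. \<forall>z\<in>S1 \<times> V. \<bar>partial (dir_x l) (partial (dir_x l) H) z\<bar> \<le> M2"
  proof -
    have "\<forall>l. \<exists>b. \<forall>z\<in>S1 \<times> V. \<bar>partial (dir_x l) (partial (dir_x l) H) z\<bar> \<le> b"
    proof
      fix l
      have "continuous_on (S1 \<times> V) (partial (dir_x l) (partial (dir_x l) H))"
        using S1pos by (intro continuous_on_subset[OF H2c]) auto
      then have "compact (partial (dir_x l) (partial (dir_x l) H) ` (S1 \<times> V))"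
        using S1c V by (intro compact_continuous_image compact_Times)
      then have "bounded (partial (dir_x l) (partial (dir_x l) H) ` (S1 \<times> V))" by (rule compact_imp_bounded)
      then show "\<exists>b. \<forall>z\<in>S1 \<times> V. \<bar>partial (dir_x l) (partial (dir_x l) H) z\<bar> \<le> b"
        unfolding bounded_iff by auto
    qed
    then obtain b where b: "\<And>l z. z \<in> S1 \<times> V \<Longrightarrow> \<bar>partial (dir_x l) (partial (dir_x l) H) z\<bar> \<le> b l" by metis
    have "b l \<le> Max (range b)" for l by (intro Max_ge) auto
    then show ?thesis by (intro exI[of _ "Max (range b)"] allI ballI order_trans[OF b])
  qed
  then obtain M2 where M2: "\<And>l z. z \<in> S1 \<times> V \<Longrightarrow> \<bar>partial (dir_x l) (partial (dir_x l) H) z\<bar> \<le> M2" by blast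
  define B1 where "B1 = 2 / \<delta> + M2 * \<delta>"
  have line: "(s, y) + t *\<^sub>R dir_x l = (s + t *\<^sub>R axis l 1, y)" for s :: "real ^ 'd" and y t :: real and l
    by (simp add: dir_x_def)
  have first: "\<bar>partial (dir_x l) H (s, y)\<bar> \<le> B1" if x: "x \<in> S" "dist x s \<le> \<delta>" and y: "y \<in> V" for x s y l
  proof -
    have inS1: "s + t *\<^sub>R axis l 1 \<in> S1" if t: "0 \<le> t" "t \<le> \<delta>" for t
    proof (rule S1I[OF x(1)])
      have "dist x (s + t *\<^sub>R axis l 1) \<le> dist x s + dist s (s + t *\<^sub>R axis l 1)" by (rule dist_triangle)
      also have "dist s (s + t *\<^sub>R axis l 1) = t" using t by (simp add: dist_norm norm_axis_1)
      finally show "dist x (s + t *\<^sub>R axis l 1) \<le> 2 * \<delta>" using x t by simp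
    qed
    have inG: "(s, y) + t *\<^sub>R dir_x l \<in> {(x, y). g x > 0}" if "0 \<le> t" "t \<le> \<delta>" for t
      unfolding line using S1pos[OF inS1[OF that]] by simp
    have "\<bar>partial (dir_x l) H ((s, y) + 0 *\<^sub>R dir_x l)\<bar> \<le> 2 / \<delta> + M2 * \<delta>"
    proof (rule second_derivative_interpolation[OF \<delta>])
      fix t assume t: "0 \<le> t" "t \<le> \<delta>"
      show "((\<lambda>t. H ((s, y) + t *\<^sub>R dir_x l)) has_real_derivative partial (dir_x l) H ((s, y) + t *\<^sub>R dir_x l)) (at t)"
        by (rule partial_derivative_along_line[OF H1 inG[OF t]])
      show "((\<lambda>t. partial (dir_x l) H ((s, y) + t *\<^sub>R dir_x l)) has_real_derivative partial (dir_x l) (partial (dir_x l) H) ((s, y) + t *\<^sub>R dir_x l)) (at t)"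
        by (rule partial_derivative_along_line[OF H2 inG[OF t]])
      show "\<bar>H ((s, y) + t *\<^sub>R dir_x l)\<bar> \<le> 1"
        unfolding line H_def using cond_cdf_bounds[OF f(1), of "s + t *\<^sub>R axis l 1" y] S1pos[OF inS1[OF t]]
        by (simp add: g_def)
      show "\<bar>partial (dir_x l) (partial (dir_x l) H) ((s, y) + t *\<^sub>R dir_x l)\<bar> \<le> M2"
        unfolding line using inS1[OF t] y by (intro M2) auto
    qed
    then show ?thesis by (simp add: B1_def)
  qed
  define CF where "CF = max (real CARD('d) * B1) (B / g s1)"
  have B0: "0 \<le> B" using order_trans[OF f(1)[rule_format] f(2)] .
  have gs1: "0 < g s1" and gs2: "0 < g s2" using S1pos s1 s2 by auto
  have CF0: "0 \<le> CF" unfolding CF_def using B0 gs1 by (intro max.coboundedI2) simp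
  show ?thesis
  proof (rule exI[where x=\<delta>], rule conjI[OF \<delta>], rule exI[where x=CF], rule conjI[OF CF0],
      rule exI[where x="g s1"], rule conjI[OF gs1], rule exI[where x="g s2"], rule conjI[OF gs2],
      intro conjI ballI allI impI)
    fix x s y y' assume x: "x \<in> S" and s: "dist x s \<le> \<delta>" and y: "y \<in> V"
    have sS1: "s \<in> S1" using S1I[OF x, of s] s \<delta> by simp
    have gs: "g s > 0" "g s1 \<le> g s" using S1pos[OF sS1] s1 sS1 by auto
    have "\<bar>H (s, y) - H (x, y)\<bar> \<le> real CARD('d) * B1 * dist x s"
    proof (rule lipschitz_from_coordinate_derivatives[where r=\<delta> and H="\<lambda>s. H (s, y)" and H'="\<lambda>l s. partial (dir_x l) H (s, y)"])
      fix l z and t :: real assume z: "dist x (z + t *\<^sub>R axis l 1) \<le> \<delta>"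
      have "z + t *\<^sub>R axis l 1 \<in> S1" using S1I[OF x, of "z + t *\<^sub>R axis l 1"] z \<delta> by simp
      then have "(z, y) + t *\<^sub>R dir_x l \<in> {(x, y). g x > 0}" unfolding line using S1pos by simp
      from partial_derivative_along_line[OF H1 this]
      show "((\<lambda>t. H (z + t *\<^sub>R axis l 1, y)) has_real_derivative partial (dir_x l) H (z + t *\<^sub>R axis l 1, y)) (at t)"
        unfolding line .
    qed (use first[OF x _ y] s in auto)
    also have "\<dots> \<le> CF * dist x s" by (intro mult_right_mono) (auto simp: CF_def)
    finally have 1: "\<bar>cond_cdf f y s - cond_cdf f y x\<bar> \<le> CF * dist x s" by (simp add: H_def)
    have "\<bar>cond_cdf f y' s - cond_cdf f y s\<bar> \<le> B / g s * \<bar>y' - y\<bar>"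
      using cond_cdf_lipschitz_y[OF f, of s y' y] gs by (simp add: g_def)
    also have "\<dots> \<le> CF * \<bar>y' - y\<bar>"
    proof (rule mult_right_mono)
      have "B / g s \<le> B / g s1" using B0 gs gs1 by (intro divide_left_mono) auto
      then show "B / g s \<le> CF" by (simp add: CF_def)
    qed simp
    finally have 2: "\<bar>cond_cdf f y' s - cond_cdf f y s\<bar> \<le> CF * \<bar>y' - y\<bar>" .
    show "\<bar>cond_cdf f y' s - cond_cdf f y x\<bar> \<le> CF * (dist x s + \<bar>y' - y\<bar>)"
      using 1 2 by (simp add: distrib_left)
  next
    fix x s assume x: "x \<in> S" and s: "dist x s \<le> \<delta>"
    have sS1: "s \<in> S1" using S1I[OF x, of s] s \<delta> by simp
    show "g s1 \<le> g s" "g s \<le> g s2" using s1 s2 sS1 by auto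
  qed
qed

lemma (in prob_space) joint_ball_prob_le:
  fixes X X' :: "'a \<Rightarrow> real ^ 'd::finite"
  assumes law: "distributed M lborel (\<lambda>\<omega>. (X \<omega>, X' \<omega>)) (\<lambda>z. ennreal (k z))"
    and A: "A \<in> sets borel" and b: "\<And>u v. u \<in> A \<Longrightarrow> v \<in> A \<Longrightarrow> k (u, v) \<le> b" and b0: "0 \<le> b"
    and fin: "emeasure lborel A < \<infinity>"
  shows "prob {\<omega> \<in> space M. X \<omega> \<in> A \<and> X' \<omega> \<in> A} \<le> b * (measure lborel A)\<^sup>2"
proof -
  have AA: "A \<times> A \<in> sets lborel" using A by (simp add: borel_prod[symmetric])
  have "emeasure M {\<omega> \<in> space M. X \<omega> \<in> A \<and> X' \<omega> \<in> A} = emeasure M ((\<lambda>\<omega>. (X \<omega>, X' \<omega>)) -` (A \<times> A) \<inter> space M)"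
    by (rule arg_cong[where f="emeasure M"]) auto
  also have "\<dots> = (\<integral>\<^sup>+ z. ennreal (k z) * indicator (A \<times> A) z \<partial>lborel)"
    by (rule distributed_emeasure[OF law AA])
  also have "\<dots> \<le> (\<integral>\<^sup>+ z. ennreal b * indicator (A \<times> A) z \<partial>lborel)"
    using b by (intro nn_integral_mono) (auto simp: indicator_def intro: ennreal_leI)
  also have "\<dots> = ennreal b * emeasure (lborel \<Otimes>\<^sub>M lborel) (A \<times> A)"
    using AA by (simp add: nn_integral_cmult_indicator lborel_prod)
  also have "\<dots> = ennreal b * (emeasure lborel A * emeasure lborel A)"
    using A by (subst lborel.emeasure_pair_measure_Times) auto
  also have "emeasure lborel A = ennreal (measure lborel A)"
    using fin by (intro emeasure_eq_ennreal_measure) auto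
  also have "ennreal b * (ennreal (measure lborel A) * ennreal (measure lborel A)) = ennreal (b * (measure lborel A)\<^sup>2)"
    using b0 by (simp add: ennreal_mult[symmetric] power2_eq_square)
  finally show ?thesis using b0 by (simp add: emeasure_eq_measure ennreal_le_iff)
qed

section \<open>Moments of localised functions and a ratio estimate\<close>

lemma marginal_density_nonneg: "\<forall>z. 0 \<le> f z \<Longrightarrow> 0 \<le> marginal_density f s"
  unfolding marginal_density_def by (intro Bochner_Integration.integral_nonneg) auto

text \<open>
  Both bounds come from the event that \<open>X i\<close> lies in the ball. For pairs of sites this makes the joint
  density of \<open>(X i, X j)\<close> enter on a bounded set, where an additive error \<open>c\<close> in the density costs
  only \<open>c\<close> times the squared volume of the ball.
\<close>

lemma (in prob_space) local_moments:
  fixes X :: "nat ^ 'n::finite \<Rightarrow> 'a \<Rightarrow> real ^ 'd::finite" and Y :: "nat ^ 'n \<Rightarrow> 'a \<Rightarrow> real"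
  assumes law: "\<forall>i\<in>pos_index. distributed M lborel (\<lambda>\<omega>. (X i \<omega>, Y i \<omega>)) (\<lambda>z. ennreal (f z))"
    and f: "\<forall>z. 0 \<le> f z" "f \<in> borel_measurable borel"
    and c: "0 \<le> c"
    and joint: "\<forall>i\<in>pos_index. \<forall>j\<in>pos_index. dist (lattice_point i) (lattice_point j) > D \<longrightarrow>
        (\<exists>gij. (\<forall>u v. 0 \<le> gij (u, v)) \<and>
           distributed M lborel (\<lambda>\<omega>. (X i \<omega>, X j \<omega>)) (\<lambda>z. ennreal (gij z)) \<and>
           (\<forall>u v. \<bar>gij (u, v) - marginal_density f u * marginal_density f v\<bar> \<le> c))"
    and r: "0 \<le> r" and gM: "\<And>s. dist x s \<le> r \<Longrightarrow> marginal_density f s \<le> gM"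
    and \<zeta>: "\<zeta> \<in> borel_measurable borel" "\<And>z. \<bar>\<zeta> z\<bar> \<le> indicator (cball x r) (fst z)"
  shows "i \<in> pos_index \<Longrightarrow> expectation (\<lambda>\<omega>. \<zeta> (X i \<omega>, Y i \<omega>)) = (LINT z|lborel. f z * \<zeta> z)"
    and "i \<in> pos_index \<Longrightarrow> expectation (\<lambda>\<omega>. \<bar>\<zeta> (X i \<omega>, Y i \<omega>)\<bar>) \<le> gM * measure lborel (cball x r)"
    and "i \<in> pos_index \<Longrightarrow> j \<in> pos_index \<Longrightarrow> dist (lattice_point i) (lattice_point j) > D \<Longrightarrow>
      expectation (\<lambda>\<omega>. \<bar>\<zeta> (X i \<omega>, Y i \<omega>) * \<zeta> (X j \<omega>, Y j \<omega>)\<bar>) \<le> (gM\<^sup>2 + c) * (measure lborel (cball x r))\<^sup>2"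
proof -
  let ?g = "marginal_density f"
  let ?B = "cball x r"
  have g0: "0 \<le> ?g s" for s using f(1) by (rule marginal_density_nonneg)
  have gM0: "0 \<le> gM" using g0[of x] gM[of x] r by simp
  have indB: "indicat_real ?B \<in> borel_measurable borel" by (rule borel_measurable_indicator) simp
  have \<zeta>1: "\<bar>\<zeta> z\<bar> \<le> 1" for z using \<zeta>(2)[of z] indicator_le_1 order_trans by blast
  have Zm: "random_variable borel (\<lambda>\<omega>. (X i \<omega>, Y i \<omega>))" if "i \<in> pos_index" for i
    using distributed_measurable[OF law[rule_format, OF that]] by simp
  have Xm: "random_variable borel (X i)" if "i \<in> pos_index" for i
  proof -
    have "random_variable borel (\<lambda>\<omega>. fst (X i \<omega>, Y i \<omega>))"
      using Zm[OF that] by (rule measurable_compose) (simp add: borel_prod[symmetric])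
    then show ?thesis by simp
  qed
  have \<zeta>m: "random_variable borel (\<lambda>\<omega>. \<zeta> (X i \<omega>, Y i \<omega>))" if "i \<in> pos_index" for i
    using Zm[OF that] \<zeta>(1) by (rule measurable_compose)
  show "expectation (\<lambda>\<omega>. \<zeta> (X i \<omega>, Y i \<omega>)) = (LINT z|lborel. f z * \<zeta> z)" if "i \<in> pos_index"
    using distributed_integral[OF law[rule_format, OF that], of \<zeta>] \<zeta>(1) f by simp
  show "expectation (\<lambda>\<omega>. \<bar>\<zeta> (X i \<omega>, Y i \<omega>)\<bar>) \<le> gM * measure lborel ?B" if i: "i \<in> pos_index"
  proof -
    have "expectation (\<lambda>\<omega>. \<bar>\<zeta> (X i \<omega>, Y i \<omega>)\<bar>) \<le> expectation (\<lambda>\<omega>. indicator ?B (X i \<omega>))"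
    proof (rule integral_mono)
      show "integrable M (\<lambda>\<omega>. \<bar>\<zeta> (X i \<omega>, Y i \<omega>)\<bar>)"
        by (rule integrable_const_bound[where B=1]) (use \<zeta>1 \<zeta>m[OF i] in auto)
      show "integrable M (\<lambda>\<omega>. indicat_real ?B (X i \<omega>))"
      proof (rule integrable_const_bound[where B=1])
        show "random_variable borel (\<lambda>\<omega>. indicat_real ?B (X i \<omega>))" using Xm[OF i] indB by (rule measurable_compose)
      qed auto
      show "\<bar>\<zeta> (X i \<omega>, Y i \<omega>)\<bar> \<le> indicator ?B (X i \<omega>)" for \<omega> using \<zeta>(2)[of "(X i \<omega>, Y i \<omega>)"] by simp
    qed
    also have "\<dots> = (LINT s|lborel. indicator ?B s * ?g s)"
      by (rule expectation_marginal_form(1)[OF law[rule_format, OF i] f indB, where Bk=1]) auto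
    also have "\<dots> \<le> (LINT s|lborel. indicator ?B s * gM)"
    proof (rule integral_mono)
      show "integrable lborel (\<lambda>s. indicator ?B s * ?g s)"
        by (rule expectation_marginal_form(2)[OF law[rule_format, OF i] f indB, where Bk=1]) auto
      show "integrable lborel (\<lambda>s. indicator ?B s * gM)"
        using emeasure_lborel_cball_finite[of x r]
        by (intro integrable_mult_left integrable_real_indicator) auto
      show "indicator ?B s * ?g s \<le> indicator ?B s * gM" for s using gM[of s] by (auto simp: indicator_def)
    qed
    also have "\<dots> = gM * measure lborel ?B" by simp
    finally show ?thesis .
  qed
  show "expectation (\<lambda>\<omega>. \<bar>\<zeta> (X i \<omega>, Y i \<omega>) * \<zeta> (X j \<omega>, Y j \<omega>)\<bar>) \<le> (gM\<^sup>2 + c) * (measure lborel ?B)\<^sup>2"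
    if i: "i \<in> pos_index" and j: "j \<in> pos_index" and ij: "dist (lattice_point i) (lattice_point j) > D"
  proof -
    obtain gij where gij: "distributed M lborel (\<lambda>\<omega>. (X i \<omega>, X j \<omega>)) (\<lambda>z. ennreal (gij z))"
      and gc: "\<And>u v. \<bar>gij (u, v) - ?g u * ?g v\<bar> \<le> c" using joint i j ij by blast
    let ?E = "{\<omega> \<in> space M. X i \<omega> \<in> ?B \<and> X j \<omega> \<in> ?B}"
    have "?E = (X i -` ?B \<inter> space M) \<inter> (X j -` ?B \<inter> space M)" by auto
    then have E: "?E \<in> events"
      using measurable_sets[OF Xm[OF i], of ?B] measurable_sets[OF Xm[OF j], of ?B] by auto
    have "expectation (\<lambda>\<omega>. \<bar>\<zeta> (X i \<omega>, Y i \<omega>) * \<zeta> (X j \<omega>, Y j \<omega>)\<bar>) \<le> expectation (indicator ?E)"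
    proof (rule integral_mono)
      have "\<bar>\<zeta> z * \<zeta> z'\<bar> \<le> 1" for z z' using mult_mono[OF \<zeta>1[of z] \<zeta>1[of z']] by (simp add: abs_mult)
      then show "integrable M (\<lambda>\<omega>. \<bar>\<zeta> (X i \<omega>, Y i \<omega>) * \<zeta> (X j \<omega>, Y j \<omega>)\<bar>)"
        by (intro integrable_const_bound[where B=1] borel_measurable_abs borel_measurable_times \<zeta>m i j) auto
      show "integrable M (indicat_real ?E)" using E by (simp add: integrable_real_indicator emeasure_eq_measure)
      show "\<bar>\<zeta> (X i \<omega>, Y i \<omega>) * \<zeta> (X j \<omega>, Y j \<omega>)\<bar> \<le> indicator ?E \<omega>" if "\<omega> \<in> space M" for \<omega>
      proof -
        have "\<bar>\<zeta> (X i \<omega>, Y i \<omega>)\<bar> * \<bar>\<zeta> (X j \<omega>, Y j \<omega>)\<bar> \<le> indicator ?B (X i \<omega>) * indicator ?B (X j \<omega>)"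
          using \<zeta>(2)[of "(X i \<omega>, Y i \<omega>)"] \<zeta>(2)[of "(X j \<omega>, Y j \<omega>)"] by (intro mult_mono) auto
        also have "\<dots> = indicator ?E \<omega>" using that by (auto simp: indicator_def)
        finally show ?thesis by (simp add: abs_mult)
      qed
    qed
    also have "\<dots> = prob ?E" using E by simp
    also have "\<dots> \<le> (gM\<^sup>2 + c) * (measure lborel ?B)\<^sup>2"
    proof (rule joint_ball_prob_le[OF gij])
      fix u v assume uv: "u \<in> ?B" "v \<in> ?B"
      have "?g u * ?g v \<le> gM * gM" using gM[of u] gM[of v] uv g0 gM0 by (intro mult_mono) auto
      then show "gij (u, v) \<le> gM\<^sup>2 + c" using gc[of u v] by (simp add: power2_eq_square abs_le_iff)
    qed (use c emeasure_lborel_cball_finite[of x r] in \<open>auto simp: less_top\<close>)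
    finally show ?thesis .
  qed
qed

text \<open>
  Primed quantities belong to a grid point and unprimed ones to a nearby point, \<open>w\<close> is the rate and
  \<open>s\<close> the normalisation. The difference \<open>\<Sum> k v - c \<Sum> k\<close> is split into the change of the two sums
  between the points, controlled by the count \<open>\<Sum> b\<close>, the two deviations from the means \<open>e1\<close> and
  \<open>e2\<close>, the bias, and the change of \<open>c\<close>.
\<close>

lemma ratio_deviation:
  fixes k k' v v' b :: "'i \<Rightarrow> real"
  assumes kk: "\<And>i. i \<in> I \<Longrightarrow> \<bar>k i - k' i\<bar> \<le> L * w * b i"
    and kv: "\<And>i. i \<in> I \<Longrightarrow> \<bar>k i * v i - k' i * v' i\<bar> \<le> L' * w * b i"
    and k': "\<And>i. i \<in> I \<Longrightarrow> \<bar>k' i\<bar> \<le> B * b i" and b: "(\<Sum>i\<in>I. b i) \<le> C * s"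
    and d1: "\<bar>(\<Sum>i\<in>I. k' i * v' i) - e1\<bar> \<le> a * w * s"
    and d2: "\<bar>(\<Sum>i\<in>I. k' i) - e2\<bar> \<le> a * w * s"
    and bias: "\<bar>e1 - c' * e2\<bar> \<le> q * w * s"
    and cc: "\<bar>c - c'\<bar> \<le> r * w" "\<bar>c\<bar> \<le> 1" "\<bar>c'\<bar> \<le> 1"
    and low: "m * s \<le> e2" and small: "(a + L * C) * w \<le> m / 2"
    and pos: "0 < m" "0 < s" "0 < w" "0 \<le> L" "0 \<le> L'" "0 \<le> B" "0 \<le> r"
  shows "0 < (\<Sum>i\<in>I. k i)"
    and "\<bar>(\<Sum>i\<in>I. k i * v i) / (\<Sum>i\<in>I. k i) - c\<bar> \<le> 2 * (L' * C + 2 * a + q + r * B * C + L * C) / m * w"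
proof -
  have up: "\<bar>\<Sum>i\<in>I. z i\<bar> \<le> u * (C * s)" if "\<And>i. i \<in> I \<Longrightarrow> \<bar>z i\<bar> \<le> u * b i" "0 \<le> u" for z u
  proof -
    have "\<bar>\<Sum>i\<in>I. z i\<bar> \<le> (\<Sum>i\<in>I. \<bar>z i\<bar>)" by (rule sum_abs)
    also have "\<dots> \<le> (\<Sum>i\<in>I. u * b i)" using that(1) by (rule sum_mono)
    also have "\<dots> \<le> u * (C * s)"
      unfolding sum_distrib_left[symmetric] using b that(2) by (rule mult_left_mono)
    finally show ?thesis .
  qed
  have t1: "\<bar>(\<Sum>i\<in>I. k i) - (\<Sum>i\<in>I. k' i)\<bar> \<le> L * w * (C * s)"
    unfolding sum_subtractf[symmetric] by (rule up) (use kk pos in auto)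
  have t2: "\<bar>(\<Sum>i\<in>I. k i * v i) - (\<Sum>i\<in>I. k' i * v' i)\<bar> \<le> L' * w * (C * s)"
    unfolding sum_subtractf[symmetric] by (rule up) (use kv pos in auto)
  have t3: "\<bar>\<Sum>i\<in>I. k' i\<bar> \<le> B * (C * s)"
    by (rule up) (use k' pos in auto)
  let ?k = "\<Sum>i\<in>I. k i" and ?k' = "\<Sum>i\<in>I. k' i" and ?kv = "\<Sum>i\<in>I. k i * v i" and ?kv' = "\<Sum>i\<in>I. k' i * v' i"
  have "(a + L * C) * w * s \<le> m / 2 * s" using small pos by (intro mult_right_mono) auto
  then have kpos: "m / 2 * s \<le> ?k" using t1 d2 low by (simp add: algebra_simps abs_le_iff)
  then show k0: "0 < ?k" using pos by (smt (verit) half_gt_zero mult_pos_pos)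
  have p1: "\<bar>c' * (e2 - ?k')\<bar> \<le> 1 * (a * w * s)"
    unfolding abs_mult using cc d2 by (intro mult_mono) (auto simp: abs_minus_commute)
  have p2: "\<bar>(c' - c) * ?k'\<bar> \<le> (r * w) * (B * (C * s))"
    unfolding abs_mult using cc t3 pos by (intro mult_mono) (auto simp: abs_minus_commute)
  have p3: "\<bar>c * (?k' - ?k)\<bar> \<le> 1 * (L * w * (C * s))"
    unfolding abs_mult using cc t1 by (intro mult_mono) (auto simp: abs_minus_commute)
  have "?kv - c * ?k = (?kv - ?kv') + (?kv' - e1) + (e1 - c' * e2) + c' * (e2 - ?k') + (c' - c) * ?k' + c * (?k' - ?k)"
    by (simp add: algebra_simps)
  then have "\<bar>?kv - c * ?k\<bar> \<le> L' * w * (C * s) + a * w * s + q * w * s + a * w * s + (r * w) * (B * (C * s)) + L * w * (C * s)"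
    using t2 d1 bias p1 p2 p3 by linarith
  also have "\<dots> = (L' * C + 2 * a + q + r * B * C + L * C) * w * s" by (simp add: algebra_simps)
  finally have num: "\<bar>?kv - c * ?k\<bar> \<le> (L' * C + 2 * a + q + r * B * C + L * C) * w * s" .
  have "\<bar>?kv / ?k - c\<bar> = \<bar>?kv - c * ?k\<bar> / ?k" using k0 by (simp add: field_simps abs_divide)
  also have "\<dots> \<le> ((L' * C + 2 * a + q + r * B * C + L * C) * w * s) / (m / 2 * s)"
    using num kpos k0 pos by (intro frac_le) auto
  also have "\<dots> = 2 * (L' * C + 2 * a + q + r * B * C + L * C) / m * w" using pos by simp
  finally show "\<bar>?kv / ?k - c\<bar> \<le> 2 * (L' * C + 2 * a + q + r * B * C + L * C) / m * w" .
qed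

lemma F_est_eq_ratio:
  fixes K :: "real ^ 'd::finite \<Rightarrow> real" and n :: "nat ^ 'n::finite"
  assumes h: "0 < h n" and n: "0 < nhat n" and pos: "0 < (\<Sum>i\<in>rect n. K ((x - X i \<omega>) /\<^sub>R h n))"
  shows "F_est K w h X Y n \<omega> y x =
    (\<Sum>i\<in>rect n. K ((x - X i \<omega>) /\<^sub>R h n) * primitive w ((y - Y i \<omega>) / h n)) / (\<Sum>i\<in>rect n. K ((x - X i \<omega>) /\<^sub>R h n))"
proof -
  have "psi_est K w h X Y n \<omega> x y = 1 / (nhat n * h n ^ (CARD('d) + 1)) * (h n * (\<Sum>i\<in>rect n. K ((x - X i \<omega>) /\<^sub>R h n) * primitive w ((y - Y i \<omega>) / h n)))"
    unfolding psi_est_def smoothed_indicator_eq[OF h] sum_distrib_left by (simp add: mult_ac)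
  also have "\<dots> = 1 / (nhat n * h n ^ CARD('d)) * (\<Sum>i\<in>rect n. K ((x - X i \<omega>) /\<^sub>R h n) * primitive w ((y - Y i \<omega>) / h n))"
    using h by simp
  finally show ?thesis using pos h n unfolding F_est_def g_est_def by simp
qed

section \<open>The kernel estimator of the conditional distribution function\<close>

text \<open>
  The setting of the estimator with all constants made explicit: \<open>\<delta>\<close>, \<open>CF\<close>, \<open>gm\<close> and \<open>gM\<close> describe the
  conditional distribution function and the marginal density near \<open>S\<close>, the constants \<open>RK\<close>, \<open>BK\<close> and
  \<open>LK\<close> are the radius of the support, the supremum and the Lipschitz constant of \<open>K\<close>, and \<open>Rw\<close> and
  \<open>Bw\<close> play the first two of these roles for \<open>w\<close>.
\<close>

locale kernel_cdf_estimation =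
  polynomially_mixing_field M "\<lambda>i \<omega>. (X i \<omega>, Y i \<omega>)" \<phi> chi \<beta> Cc T
  for M :: "'a measure" and X :: "nat ^ 'n::finite \<Rightarrow> 'a \<Rightarrow> real ^ 'd::finite" and Y :: "nat ^ 'n \<Rightarrow> 'a \<Rightarrow> real"
    and \<phi> :: "nat \<Rightarrow> nat \<Rightarrow> real" and chi :: "real \<Rightarrow> real" and \<beta> Cc T :: real +
  fixes f :: "(real ^ 'd) \<times> real \<Rightarrow> real" and K :: "real ^ 'd \<Rightarrow> real" and w :: "real \<Rightarrow> real"
    and h :: "nat ^ 'n \<Rightarrow> real" and S :: "(real ^ 'd) set" and V :: "real set"
    and \<epsilon> D c \<delta> CF gm gM RK BK LK Rw Bw C1 :: real
  assumes law: "\<forall>i\<in>pos_index. distributed M lborel (\<lambda>\<omega>. (X i \<omega>, Y i \<omega>)) (\<lambda>z. ennreal (f z))"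
    and f: "\<forall>z. 0 \<le> f z" "f \<in> borel_measurable borel"
    and c: "0 \<le> c"
    and joint: "\<forall>i\<in>pos_index. \<forall>j\<in>pos_index. dist (lattice_point i) (lattice_point j) > D \<longrightarrow>
        (\<exists>gij. (\<forall>u v. 0 \<le> gij (u, v)) \<and>
           distributed M lborel (\<lambda>\<omega>. (X i \<omega>, X j \<omega>)) (\<lambda>z. ennreal (gij z)) \<and>
           (\<forall>u v. \<bar>gij (u, v) - marginal_density f u * marginal_density f v\<bar> \<le> c))"
    and SV: "bounded (S \<times> V)"
    and \<delta>: "0 < \<delta>" and CF: "0 \<le> CF" and gm: "0 < gm" and gM: "0 < gM"
    and near_all: "\<forall>x\<in>S. \<forall>s. dist x s \<le> \<delta> \<longrightarrow> gm \<le> marginal_density f s \<and> marginal_density f s \<le> gM \<and>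
        (\<forall>y\<in>V. \<forall>y'. \<bar>cond_cdf f y' s - cond_cdf f y x\<bar> \<le> CF * (dist x s + \<bar>y' - y\<bar>))"
    and K: "prob_density K" and RK: "0 < RK" and BK: "0 < BK" and LK: "0 \<le> LK"
    and K0: "\<And>s. RK \<le> norm s \<Longrightarrow> K s = 0" and KB: "\<And>s. \<bar>K s\<bar> \<le> BK"
    and KL: "\<And>s t. \<bar>K s - K t\<bar> \<le> LK * dist s t"
    and w: "prob_density w" and Rw: "0 < Rw" and Bw: "0 < Bw"
    and w0: "\<forall>z. Rw \<le> norm z \<longrightarrow> w z = 0" and wB: "\<And>z. \<bar>w z\<bar> \<le> Bw"
    and eps: "0 < \<epsilon>" and h_pos: "\<forall>n\<in>pos_index. h n > 0" and h_lim: "(h \<longlongrightarrow> 0) multi_at_top"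
    and h_upper: "((\<lambda>n. nhat n * h n ^ (CARD('d) + 2) / ln (nhat n)) \<longlongrightarrow> 0) multi_at_top"
    and h_lower: "bandwidth_cond_a CARD('d) \<phi> \<beta> \<epsilon> h \<or> bandwidth_cond_b CARD('d) \<phi> \<beta> \<epsilon> h"
    and C1_def: "C1 = (gM + c + 1) * (unit_ball_vol (real CARD('d)) * (RK + 1) ^ CARD('d))"
    and cdf_le_1: "\<And>x y. x \<in> S \<Longrightarrow> \<bar>cond_cdf f y x\<bar> \<le> 1"
begin

abbreviation obs :: "nat ^ 'n \<Rightarrow> 'a \<Rightarrow> (real ^ 'd) \<times> real" where
  "obs i \<omega> \<equiv> (X i \<omega>, Y i \<omega>)"

lemma near:
  assumes "x \<in> S" "dist x s \<le> \<delta>"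
  shows "gm \<le> marginal_density f s \<and> marginal_density f s \<le> gM \<and>
    (\<forall>y\<in>V. \<forall>y'. \<bar>cond_cdf f y' s - cond_cdf f y x\<bar> \<le> CF * (dist x s + \<bar>y' - y\<bar>))"
  by (rule near_all[rule_format, OF assms])

lemma Kpos: "0 \<le> K s" and K1: "(LINT s|lborel. K s) = 1" and Km: "K \<in> borel_measurable borel"
  using K borel_measurable_integrable[of lborel K] by (auto simp: prob_density_def)

lemmas primitive_facts = primitive_properties[OF w wB w0]

lemma primitive_measurable: "primitive w \<in> borel_measurable borel"
  using primitive_facts(5) by (rule borel_measurable_mono)

lemma dim_ge_1: "1 \<le> CARD('d)"
  by (simp add: Suc_leI)

lemmas bandwidth_facts = bandwidth_consequences[OF dim_ge_1 eps h_pos h_lim h_upper h_lower]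

text \<open>
  A ball of radius \<open>\<rho> h\<close> contains the support of the scaled kernel around every point within \<open>h\<close> of its
  centre.
\<close>

definition \<rho> :: real where "\<rho> = RK + 1"

lemma \<rho>: "1 \<le> \<rho>"
  using RK by (simp add: \<rho>_def)

lemma C1: "0 < C1"
  unfolding C1_def using gM c RK by (intro mult_pos_pos zero_less_power) auto

text \<open>
  The numerator, the denominator, and the number of observations near a point, which controls how
  much the other two change between grid points. Division by \<open>BK\<close> brings all three into \<open>[-1, 1]\<close>.
\<close>

definition smooth_test :: "nat ^ 'n \<Rightarrow> (real ^ 'd) \<times> real \<Rightarrow> (real ^ 'd) \<times> real \<Rightarrow> real" where
  "smooth_test n p z = K ((fst p - fst z) /\<^sub>R h n) / BK * primitive w ((snd p - snd z) / h n)"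

definition kernel_test :: "nat ^ 'n \<Rightarrow> (real ^ 'd) \<times> real \<Rightarrow> (real ^ 'd) \<times> real \<Rightarrow> real" where
  "kernel_test n p z = K ((fst p - fst z) /\<^sub>R h n) / BK"

definition ball_test :: "nat ^ 'n \<Rightarrow> (real ^ 'd) \<times> real \<Rightarrow> (real ^ 'd) \<times> real \<Rightarrow> real" where
  "ball_test n p z = indicat_real (cball (fst p) (\<rho> * h n)) (fst z)"

lemma grid_exists:
  "\<exists>C. \<forall>r. \<exists>G. 0 < r \<longrightarrow> r \<le> 1 \<longrightarrow>
     G \<subseteq> S \<times> V \<and> finite G \<and> real (card G) \<le> C * (1 / r) ^ (CARD('d) + 1) \<and> (\<forall>z\<in>S \<times> V. \<exists>z'\<in>G. dist z z' \<le> r)"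
proof -
  have dim: "DIM((real ^ 'd) \<times> real) = CARD('d) + 1" by simp
  show ?thesis using bounded_finite_net[OF SV, unfolded dim] by meson
qed

definition Cg :: real where
  "Cg = (SOME C. \<forall>r. \<exists>G. 0 < r \<longrightarrow> r \<le> 1 \<longrightarrow>
     G \<subseteq> S \<times> V \<and> finite G \<and> real (card G) \<le> C * (1 / r) ^ (CARD('d) + 1) \<and> (\<forall>z\<in>S \<times> V. \<exists>z'\<in>G. dist z z' \<le> r))"

definition grid :: "real \<Rightarrow> ((real ^ 'd) \<times> real) set" where
  "grid = (SOME G. \<forall>r. 0 < r \<longrightarrow> r \<le> 1 \<longrightarrow>
     G r \<subseteq> S \<times> V \<and> finite (G r) \<and> real (card (G r)) \<le> Cg * (1 / r) ^ (CARD('d) + 1) \<and> (\<forall>z\<in>S \<times> V. \<exists>z'\<in>G r. dist z z' \<le> r))"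

lemma grid:
  assumes "0 < r" "r \<le> 1"
  shows "grid r \<subseteq> S \<times> V \<and> finite (grid r) \<and> real (card (grid r)) \<le> Cg * (1 / r) ^ (CARD('d) + 1) \<and> (\<forall>z\<in>S \<times> V. \<exists>z'\<in>grid r. dist z z' \<le> r)"
  using someI_ex[OF choice[OF someI_ex[OF grid_exists]], folded Cg_def, folded grid_def, rule_format, OF assms] .

definition tests :: "nat ^ 'n \<Rightarrow> ((real ^ 'd) \<times> real \<Rightarrow> real) set" where
  "tests n = smooth_test n ` grid (h n * Omega CARD('d) h n) \<union> kernel_test n ` grid (h n * Omega CARD('d) h n) \<union> ball_test n ` grid (h n * Omega CARD('d) h n)"

definition good :: "nat ^ 'n \<Rightarrow> bool" where
  "good n \<longleftrightarrow> 0 < nhat n \<and> 0 < h n \<and> h n < 1 \<and> h n \<le> Omega CARD('d) h n \<and> 0 < Omega CARD('d) h n \<and> Omega CARD('d) h n \<le> 1 \<and> \<rho> * h n \<le> \<delta>"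

lemma eventually_good: "eventually good multi_at_top"
proof -
  have bwe: "eventually (\<lambda>n. n \<in> pos_index \<and> 1 \<le> ln (nhat n) \<and> h n < 1 \<and> h n \<le> Omega CARD('d) h n \<and> Omega CARD('d) h n \<le> 1) multi_at_top"
    using bandwidth_facts(3) by (elim exE conjE, elim eventually_mono) (elim conjE, intro conjI)
  have hsmall: "eventually (\<lambda>n. h n < \<delta> / \<rho>) multi_at_top"
    using h_lim by (rule order_tendstoD) (use \<delta> \<rho> in simp)
  show ?thesis
    using bwe hsmall
  proof eventually_elim
    case (elim n)
    then have "0 < nhat n" by (auto simp: nhat_def pos_index_def Suc_le_eq intro!: prod_pos)
    moreover have "0 < h n" using h_pos elim by auto
    moreover have "\<rho> * h n \<le> \<delta>" using elim(2) \<rho> by (simp add: field_simps)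
    ultimately show ?case unfolding good_def using elim by auto
  qed
qed

lemma dist_scaled_iff:
  fixes x s :: "real ^ 'd"
  assumes "0 < h n"
  shows "dist x s \<le> r * h n \<longleftrightarrow> norm ((x - s) /\<^sub>R h n) \<le> r" "dist x s < r * h n \<longleftrightarrow> norm ((x - s) /\<^sub>R h n) < r"
proof -
  have "norm ((x - s) /\<^sub>R h n) = dist x s / h n"
    using assms unfolding dist_norm norm_scaleR by (simp add: divide_inverse mult.commute)
  then show "dist x s \<le> r * h n \<longleftrightarrow> norm ((x - s) /\<^sub>R h n) \<le> r" "dist x s < r * h n \<longleftrightarrow> norm ((x - s) /\<^sub>R h n) < r"
    using assms by (simp_all only: pos_divide_le_eq pos_divide_less_eq)
qed

lemma scaled_kernel_eq_0:
  assumes "0 < h n" "RK * h n \<le> dist x s"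
  shows "K ((x - s) /\<^sub>R h n) = 0"
  using dist_scaled_iff(2)[OF assms(1), of x s RK] assms(2) by (intro K0) (auto simp: not_less[symmetric])

lemma scaled_kernel_le:
  assumes "0 < h n"
  shows "\<bar>K ((x - s) /\<^sub>R h n) / BK\<bar> \<le> indicator (cball x (\<rho> * h n)) s"
proof (cases "s \<in> cball x (\<rho> * h n)")
  case True
  then show ?thesis using KB[of "(x - s) /\<^sub>R h n"] BK by (simp add: abs_divide)
next
  case False
  then have "RK * h n \<le> dist x s" using assms by (simp add: \<rho>_def distrib_right)
  then show ?thesis using scaled_kernel_eq_0[OF assms] by simp
qed

lemma test_le:
  assumes h0: "0 < h n" and \<zeta>: "\<zeta> = smooth_test n p \<or> \<zeta> = kernel_test n p \<or> \<zeta> = ball_test n p"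
  shows "\<bar>\<zeta> z\<bar> \<le> indicator (cball (fst p) (\<rho> * h n)) (fst z)"
proof -
  have "\<bar>smooth_test n p z\<bar> \<le> indicator (cball (fst p) (\<rho> * h n)) (fst z) * 1"
    unfolding smooth_test_def abs_mult using scaled_kernel_le[OF h0] primitive_facts(1,2) by (intro mult_mono) auto
  then show ?thesis using \<zeta> scaled_kernel_le[OF h0, of "fst p" "fst z"] by (auto simp: kernel_test_def ball_test_def)
qed

lemma test_measurable:
  assumes \<zeta>: "\<zeta> = smooth_test n p \<or> \<zeta> = kernel_test n p \<or> \<zeta> = ball_test n p"
  shows "\<zeta> \<in> borel_measurable borel"
proof -
  have fst': "(fst :: (real ^ 'd) \<times> real \<Rightarrow> _) \<in> borel_measurable borel" and snd': "(snd :: (real ^ 'd) \<times> real \<Rightarrow> _) \<in> borel_measurable borel"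
    by (simp_all add: borel_prod[symmetric])
  have k: "(\<lambda>z. K ((fst p - fst z) /\<^sub>R h n)) \<in> borel_measurable (borel :: ((real ^ 'd) \<times> real) measure)"
    by (rule measurable_compose[OF _ Km]) (intro borel_measurable_scaleR borel_measurable_diff borel_measurable_const fst')
  have v: "(\<lambda>z. primitive w ((snd p - snd z) / h n)) \<in> borel_measurable (borel :: ((real ^ 'd) \<times> real) measure)"
    by (rule measurable_compose[OF _ primitive_measurable]) (intro borel_measurable_divide borel_measurable_diff borel_measurable_const snd')
  have i: "(\<lambda>z. indicat_real (cball (fst p) (\<rho> * h n)) (fst z)) \<in> borel_measurable (borel :: ((real ^ 'd) \<times> real) measure)"
    by (rule measurable_compose[OF fst' borel_measurable_indicator]) simp
  show ?thesis using \<zeta> k v i unfolding smooth_test_def kernel_test_def ball_test_def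
    by (auto intro!: borel_measurable_times borel_measurable_divide)
qed

lemma measure_scaled_ball:
  fixes x :: "real ^ 'd"
  assumes "0 < h n"
  shows "measure lborel (cball x (\<rho> * h n)) = unit_ball_vol (real CARD('d)) * \<rho> ^ CARD('d) * h n ^ CARD('d)"
  using content_cball[of "\<rho> * h n" x] assms \<rho> by (simp add: power_mult_distrib DIM_cart)

lemma local_test_tests:
  assumes h0: "0 < h n" and h\<delta>: "\<rho> * h n \<le> \<delta>" and p: "p \<in> S \<times> V"
    and \<zeta>: "\<zeta> = smooth_test n p \<or> \<zeta> = kernel_test n p \<or> \<zeta> = ball_test n p"
  shows "local_test M obs D (C1 * h n ^ CARD('d)) \<zeta>"
proof -
  have xS: "fst p \<in> S" using p by auto
  have gMb: "marginal_density f s \<le> gM" if "dist (fst p) s \<le> \<rho> * h n" for s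
    using near[OF xS, of s] that h\<delta> by auto
  have r0: "0 \<le> \<rho> * h n" using \<rho> h0 by simp
  note \<zeta>m = test_measurable[OF \<zeta>] and \<zeta>b = test_le[OF h0 \<zeta>]
  have lm1: "expectation (\<lambda>\<omega>. \<zeta> (obs i \<omega>)) = (LINT z|lborel. f z * \<zeta> z)" if "i \<in> pos_index" for i
    using law f c joint r0 gMb \<zeta>m \<zeta>b that by (rule local_moments(1))
  have lm2: "expectation (\<lambda>\<omega>. \<bar>\<zeta> (obs i \<omega>)\<bar>) \<le> gM * measure lborel (cball (fst p) (\<rho> * h n))" if "i \<in> pos_index" for i
    using law f c joint r0 gMb \<zeta>m \<zeta>b that by (rule local_moments(2))
  have lm3: "expectation (\<lambda>\<omega>. \<bar>\<zeta> (obs i \<omega>) * \<zeta> (obs j \<omega>)\<bar>) \<le> (gM\<^sup>2 + c) * (measure lborel (cball (fst p) (\<rho> * h n)))\<^sup>2"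
    if "i \<in> pos_index" "j \<in> pos_index" "D < dist (lattice_point i) (lattice_point j)" for i j
    using law f c joint r0 gMb \<zeta>m \<zeta>b that by (rule local_moments(3))
  note lm2 = lm2[unfolded measure_scaled_ball[OF h0]] and lm3 = lm3[unfolded measure_scaled_ball[OF h0]]
  let ?v = "unit_ball_vol (real CARD('d)) * \<rho> ^ CARD('d) * h n ^ CARD('d)"
  have v0: "0 \<le> ?v" using \<rho> h0 by simp
  have m1: "gM * ?v \<le> C1 * h n ^ CARD('d)"
  proof -
    have "gM * ?v \<le> (gM + c + 1) * ?v" using v0 c by (intro mult_right_mono) auto
    then show ?thesis by (simp add: C1_def \<rho>_def mult_ac)
  qed
  have m2: "(gM\<^sup>2 + c) * ?v\<^sup>2 \<le> (C1 * h n ^ CARD('d))\<^sup>2"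
  proof -
    have "gM\<^sup>2 + c \<le> (gM + c + 1)\<^sup>2" using gM c by (simp add: power2_eq_square algebra_simps add_nonneg_nonneg)
    then have "(gM\<^sup>2 + c) * ?v\<^sup>2 \<le> (gM + c + 1)\<^sup>2 * ?v\<^sup>2" by (intro mult_right_mono) auto
    also have "\<dots> = (C1 * h n ^ CARD('d))\<^sup>2" by (simp add: C1_def \<rho>_def power_mult_distrib mult_ac)
    finally show ?thesis .
  qed
  have one: "1 \<in> (pos_index :: (nat ^ 'n) set)" by (simp add: pos_index_def)
  have le1: "\<bar>\<zeta> z\<bar> \<le> 1" for z using test_le[OF h0 \<zeta>, of z] by (rule order_trans) simp
  have eqE: "expectation (\<lambda>\<omega>. \<zeta> (obs i \<omega>)) = expectation (\<lambda>\<omega>. \<zeta> (obs 1 \<omega>))" if "i \<in> pos_index" for i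
    using lm1[OF that] lm1[OF one] by simp
  show ?thesis
    unfolding local_test_def
    by (intro conjI ballI allI impI \<zeta>m le1 eqE order_trans[OF lm2 m1] order_trans[OF lm3 m2])
qed

text \<open>
  The grid has at most a multiple of \<open>(h \<Omega>) powr (- (d + 1))\<close> points, which is the number of test
  functions that the bandwidth conditions allow for.
\<close>

lemma AE_tests:
  "\<exists>\<eta>\<ge>0. AE \<omega> in M. eventually (\<lambda>n. \<forall>\<zeta>\<in>tests n.
      \<bar>centred_sum M obs \<zeta> n \<omega>\<bar> \<le> \<eta> * (nhat n * h n ^ CARD('d) * Omega CARD('d) h n)) multi_at_top"
proof (rule AE_uniform_deviation[OF dim_ge_1 eps h_pos h_lim h_upper h_lower C1])
  show "eventually (\<lambda>n. finite (tests n) \<and> real (card (tests n)) \<le> (3 * Cg) * (h n * Omega CARD('d) h n) powr (- (real CARD('d) + 1))) multi_at_top"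
    using eventually_good
  proof eventually_elim
    case (elim n)
    let ?r = "h n * Omega CARD('d) h n"
    have r: "0 < ?r" "?r \<le> 1" using elim by (auto simp: good_def intro: mult_le_one)
    note Gr = grid[OF r]
    have "card (tests n) \<le> card (smooth_test n ` grid ?r) + card (kernel_test n ` grid ?r) + card (ball_test n ` grid ?r)"
      unfolding tests_def by (intro order_trans[OF card_Un_le] add_right_mono card_Un_le)
    also have "\<dots> \<le> card (grid ?r) + card (grid ?r) + card (grid ?r)" using Gr by (intro add_mono card_image_le) auto
    finally have "real (card (tests n)) \<le> 3 * real (card (grid ?r))" by simp
    also have "\<dots> \<le> 3 * (Cg * (1 / ?r) ^ (CARD('d) + 1))" using Gr by simp
    also have "(1 / ?r) ^ (CARD('d) + 1) = ?r powr (- (real CARD('d) + 1))"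
    proof -
      have "?r powr (- (real CARD('d) + 1)) = 1 / ?r powr real (CARD('d) + 1)"
        by (subst powr_minus_divide) (simp only: of_nat_add of_nat_1)
      also have "\<dots> = (1 / ?r) ^ (CARD('d) + 1)" using r by (simp only: powr_realpow power_one_over)
      finally show ?thesis by (rule sym)
    qed
    finally show ?case using Gr unfolding tests_def by simp
  qed
  show "eventually (\<lambda>n. \<forall>\<zeta>\<in>tests n. local_test M obs D (C1 * h n ^ CARD('d)) \<zeta>) multi_at_top"
    using eventually_good
  proof eventually_elim
    case (elim n)
    let ?r = "h n * Omega CARD('d) h n"
    have r: "0 < ?r" "?r \<le> 1" using elim by (auto simp: good_def intro: mult_le_one)
    show ?case
    proof
      fix \<zeta> assume "\<zeta> \<in> tests n"
      then obtain p where p: "p \<in> grid ?r" and \<zeta>: "\<zeta> = smooth_test n p \<or> \<zeta> = kernel_test n p \<or> \<zeta> = ball_test n p"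
        unfolding tests_def by blast
      have "p \<in> S \<times> V" using grid[OF r] p by blast
      moreover have "0 < h n" "\<rho> * h n \<le> \<delta>" using elim by (simp_all add: good_def)
      ultimately show "local_test M obs D (C1 * h n ^ CARD('d)) \<zeta>" using \<zeta> by (intro local_test_tests)
    qed
  qed
qed

definition bias_const :: real where "bias_const = CF * (\<rho> + Rw) * (BK * C1)"

text \<open>
  The kernel only sees points within \<open>\<rho> h\<close> of \<open>x\<close>, and the smoothed indicator is exact outside
  \<open>[y - Rw h, y + Rw h]\<close>, so the conditional distribution function enters through values within
  \<open>CF (\<rho> + Rw) h\<close> of \<open>F(y|x)\<close>.
\<close>

lemma kernel_bias:
  assumes h0: "0 < h n" and h\<delta>: "\<rho> * h n \<le> \<delta>" and x: "x \<in> S" and y: "y \<in> V"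
  shows "\<bar>expectation (\<lambda>\<omega>. K ((x - X 1 \<omega>) /\<^sub>R h n) * primitive w ((y - Y 1 \<omega>) / h n)) - cond_cdf f y x * expectation (\<lambda>\<omega>. K ((x - X 1 \<omega>) /\<^sub>R h n))\<bar>
      \<le> bias_const * h n * h n ^ CARD('d)"
    and "gm * h n ^ CARD('d) \<le> expectation (\<lambda>\<omega>. K ((x - X 1 \<omega>) /\<^sub>R h n))"
proof -
  let ?k = "\<lambda>s. K ((x - s) /\<^sub>R h n)" and ?v = "\<lambda>t. primitive w ((y - t) / h n)"
  have one: "1 \<in> (pos_index :: (nat ^ 'n) set)" by (simp add: pos_index_def)
  note law1 = law[rule_format, OF one]
  have km: "?k \<in> borel_measurable borel"
    by (rule measurable_compose[OF _ Km]) measurable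
  have vm: "?v \<in> borel_measurable borel"
    by (rule measurable_compose[OF _ primitive_measurable]) measurable
  have inball: "dist x s \<le> \<rho> * h n" "dist x s \<le> \<delta>" if "?k s \<noteq> 0" for s
  proof -
    have "dist x s < RK * h n" using scaled_kernel_eq_0[OF h0, of x s] that by (meson not_less)
    also have "\<dots> \<le> \<rho> * h n" using h0 by (intro mult_right_mono) (auto simp: \<rho>_def)
    finally show "dist x s \<le> \<rho> * h n" by simp
    then show "dist x s \<le> \<delta>" using h\<delta> by simp
  qed
  have EK: "expectation (\<lambda>\<omega>. ?k (X 1 \<omega>)) \<le> BK * C1 * h n ^ CARD('d)"
  proof -
    have "(x, y) \<in> S \<times> V" using x y by simp
    from local_test_tests[OF h0 h\<delta> this, of "kernel_test n (x, y)"] one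
    have "expectation (\<lambda>\<omega>. \<bar>kernel_test n (x, y) (obs 1 \<omega>)\<bar>) \<le> C1 * h n ^ CARD('d)"
        unfolding local_test_def by blast
    moreover have "(\<lambda>\<omega>. \<bar>kernel_test n (x, y) (obs 1 \<omega>)\<bar>) = (\<lambda>\<omega>. ?k (X 1 \<omega>) / BK)"
      using Kpos BK by (simp add: kernel_test_def)
    ultimately show ?thesis using BK by (simp add: pos_divide_le_eq mult_ac)
  qed
  have vlow: "indicator {..y - Rw * h n} t \<le> ?v t" and vup: "?v t \<le> indicator {..y + Rw * h n} t" for t
  proof -
    have "?v t = 1" if "t \<le> y - Rw * h n"
      by (rule primitive_facts(3), subst pos_le_divide_eq) (use that h0 in auto)
    then show "indicator {..y - Rw * h n} t \<le> ?v t" using primitive_facts(1) by (auto simp: indicator_def)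
    have "?v t = 0" if "\<not> t \<le> y + Rw * h n"
      by (rule primitive_facts(4), subst pos_divide_le_eq) (use that h0 in auto)
    then show "?v t \<le> indicator {..y + Rw * h n} t" using primitive_facts(2) by (auto simp: indicator_def)
  qed
  let ?\<Lambda> = "CF * (\<rho> + Rw) * h n"
  have "\<bar>expectation (\<lambda>\<omega>. ?k (X 1 \<omega>) * ?v (Y 1 \<omega>)) - cond_cdf f y x * expectation (\<lambda>\<omega>. ?k (X 1 \<omega>))\<bar>
     \<le> ?\<Lambda> * expectation (\<lambda>\<omega>. ?k (X 1 \<omega>))"
  proof (rule smoothed_cdf_bias[OF law1 f km _ _ vm vlow vup])
    show "0 \<le> ?k s" for s by (rule Kpos)
    show "?k s \<le> BK" for s using KB[of "(x - s) /\<^sub>R h n"] by simp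
    fix s assume "?k s \<noteq> 0"
    note ib = inball[OF this]
    note nr = near[OF x ib(2)]
    have b: "\<bar>cond_cdf f y' s - cond_cdf f y x\<bar> \<le> ?\<Lambda>" if "\<bar>y' - y\<bar> = Rw * h n" for y'
    proof -
      have "\<bar>cond_cdf f y' s - cond_cdf f y x\<bar> \<le> CF * (dist x s + \<bar>y' - y\<bar>)" using nr y by blast
      also have "\<dots> \<le> CF * (\<rho> * h n + Rw * h n)" using ib that CF by (intro mult_left_mono) auto
      finally show ?thesis by (simp add: algebra_simps)
    qed
    show "0 < marginal_density f s \<and> \<bar>cond_cdf f (y - Rw * h n) s - cond_cdf f y x\<bar> \<le> ?\<Lambda> \<and> \<bar>cond_cdf f (y + Rw * h n) s - cond_cdf f y x\<bar> \<le> ?\<Lambda>"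
      using nr gm b[of "y - Rw * h n"] b[of "y + Rw * h n"] Rw h0  by auto
  qed
  also have "\<dots> \<le> ?\<Lambda> * (BK * C1 * h n ^ CARD('d))" using CF \<rho> Rw h0 by (intro mult_left_mono[OF EK]) auto
  also have "\<dots> = bias_const * h n * h n ^ CARD('d)" by (simp add: bias_const_def)
  finally show "\<bar>expectation (\<lambda>\<omega>. ?k (X 1 \<omega>) * ?v (Y 1 \<omega>)) - cond_cdf f y x * expectation (\<lambda>\<omega>. ?k (X 1 \<omega>))\<bar> \<le> bias_const * h n * h n ^ CARD('d)" .
  note mf = expectation_marginal_form[OF law1 f km KB]
  have "gm * h n ^ CARD('d) = (LINT s|lborel. ?k s * gm)"
    using lborel_integral_scaled[OF Km h0, of x] K1 by (simp add: DIM_cart mult.commute)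
  also have "\<dots> \<le> (LINT s|lborel. ?k s * marginal_density f s)"
  proof (rule integral_mono)
    have "(LINT s|lborel. ?k s) \<noteq> 0" using lborel_integral_scaled[OF Km h0, of x] K1 h0 by simp
    then have "integrable lborel ?k" using not_integrable_integral_eq by blast
    then show "integrable lborel (\<lambda>s. ?k s * gm)" by simp
    show "integrable lborel (\<lambda>s. ?k s * marginal_density f s)" by (rule mf(2))
    show "?k s * gm \<le> ?k s * marginal_density f s" for s
    proof (cases "?k s = 0")
      case False
      then have "gm \<le> marginal_density f s" using near[OF x inball(2)[OF False]]  by blast
      then show ?thesis using Kpos by (intro mult_left_mono)
    qed simp
  qed
  also have "\<dots> = expectation (\<lambda>\<omega>. ?k (X 1 \<omega>))" by (rule mf(1)[symmetric])
  finally show "gm * h n ^ CARD('d) \<le> expectation (\<lambda>\<omega>. ?k (X 1 \<omega>))" .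
qed

text \<open>
  The deterministic part: on the event that all test functions on the grid are well behaved, an
  arbitrary point of \<open>S \<times> V\<close> is compared with a grid point at distance at most \<open>h \<Omega>\<close>.
\<close>

lemma estimator_deviation:
  assumes \<eta>: "0 \<le> \<eta>"
  defines "a \<equiv> BK * \<eta>" and "Cn \<equiv> \<eta> + C1" and "L' \<equiv> LK + BK * Bw"
  assumes gd: "good n" and dev: "\<forall>\<zeta>\<in>tests n. \<bar>centred_sum M obs \<zeta> n \<omega>\<bar> \<le> \<eta> * (nhat n * h n ^ CARD('d) * Omega CARD('d) h n)"
    and small: "(a + LK * Cn) * Omega CARD('d) h n \<le> gm / 2" and x: "x \<in> S" and y: "y \<in> V"
  shows "\<bar>F_est K w h X Y n \<omega> y x - cond_cdf f y x\<bar>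
    \<le> 2 * (L' * Cn + 2 * a + bias_const + 2 * CF * BK * Cn + LK * Cn) / gm * Omega CARD('d) h n"
proof -
  let ?s = "nhat n * h n ^ CARD('d)"
  let ?r = "h n * Omega CARD('d) h n"
  have h0: "0 < h n" and h1: "h n < 1" and nh: "0 < nhat n" and \<Omega>p: "0 < Omega CARD('d) h n" "Omega CARD('d) h n \<le> 1" and h\<Omega>: "h n \<le> Omega CARD('d) h n" and h\<delta>: "\<rho> * h n \<le> \<delta>"
    using gd by (auto simp: good_def)
  have s0: "0 < ?s" using h0 nh by simp
  have r: "0 < ?r" "?r \<le> 1" using h0 h1 \<Omega>p by (auto intro: mult_le_one)
  have a0: "0 \<le> a" "0 \<le> Cn" "0 \<le> L'" "0 \<le> bias_const" using BK \<eta> C1 LK Bw CF \<rho> Rw by (auto simp: a_def Cn_def L'_def bias_const_def)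
  obtain x' y' where p: "(x', y') \<in> grid ?r" and dxy: "dist (x, y) (x', y') \<le> ?r"
  proof -
    have "(x, y) \<in> S \<times> V" using x y by simp
    then obtain z' where "z' \<in> grid ?r" "dist (x, y) z' \<le> ?r" using grid[OF r] by blast
    then show thesis using that by (cases z') blast
  qed
  have x'S: "x' \<in> S" and y'V: "y' \<in> V" using grid[OF r] p by auto
  have dx: "dist x x' \<le> ?r" and dy: "\<bar>y - y'\<bar> \<le> ?r"
    using dist_fst_le[of "(x, y)" "(x', y')"] dist_snd_le[of "(x, y)" "(x', y')"] dxy by (auto simp: dist_real_def)
  let ?k = "\<lambda>i. K ((x - X i \<omega>) /\<^sub>R h n)" and ?k' = "\<lambda>i. K ((x' - X i \<omega>) /\<^sub>R h n)"
  let ?v = "\<lambda>i. primitive w ((y - Y i \<omega>) / h n)" and ?v' = "\<lambda>i. primitive w ((y' - Y i \<omega>) / h n)"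
  let ?b = "\<lambda>i. indicat_real (cball x' (\<rho> * h n)) (X i \<omega>)"
  let ?e1 = "nhat n * expectation (\<lambda>\<omega>. K ((x' - X 1 \<omega>) /\<^sub>R h n) * primitive w ((y' - Y 1 \<omega>) / h n))"
  let ?e2 = "nhat n * expectation (\<lambda>\<omega>. K ((x' - X 1 \<omega>) /\<^sub>R h n))"
  have out: "?k i = 0 \<and> ?k' i = 0" if "X i \<omega> \<notin> cball x' (\<rho> * h n)" for i
  proof -
    have "dist x' (X i \<omega>) > RK * h n + h n" using that by (simp add: \<rho>_def distrib_right)
    moreover have "dist x' (X i \<omega>) \<le> dist x x' + dist x (X i \<omega>)" by (rule dist_triangle3)
    moreover have "?r \<le> h n" using h0 \<Omega>p by (simp add: mult_left_le)
    ultimately have "RK * h n \<le> dist x (X i \<omega>)" "RK * h n \<le> dist x' (X i \<omega>)"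
      using dx h0 by linarith+
    then show ?thesis using scaled_kernel_eq_0[OF h0] by blast
  qed
  have kk: "\<bar>?k i - ?k' i\<bar> \<le> LK * Omega CARD('d) h n * ?b i" for i
  proof (cases "X i \<omega> \<in> cball x' (\<rho> * h n)")
    case True
    have "\<bar>?k i - ?k' i\<bar> \<le> LK * dist ((x - X i \<omega>) /\<^sub>R h n) ((x' - X i \<omega>) /\<^sub>R h n)" by (rule KL)
    also have "dist ((x - X i \<omega>) /\<^sub>R h n) ((x' - X i \<omega>) /\<^sub>R h n) = dist x x' / h n"
      using h0 by (simp add: dist_norm scaleR_diff_right[symmetric] divide_inverse mult.commute)
    also have "LK * (dist x x' / h n) \<le> LK * Omega CARD('d) h n"
      using dx h0 LK by (intro mult_left_mono) (auto simp: pos_divide_le_eq mult.commute)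
    finally show ?thesis using True by simp
  qed (use out in simp)
  have kv: "\<bar>?k i * ?v i - ?k' i * ?v' i\<bar> \<le> L' * Omega CARD('d) h n * ?b i" for i
  proof (cases "X i \<omega> \<in> cball x' (\<rho> * h n)")
    case True
    have "\<bar>?v i - ?v' i\<bar> \<le> Bw * \<bar>(y - Y i \<omega>) / h n - (y' - Y i \<omega>) / h n\<bar>" by (rule primitive_facts(6))
    also have "\<bar>(y - Y i \<omega>) / h n - (y' - Y i \<omega>) / h n\<bar> = \<bar>y - y'\<bar> / h n"
      using h0 by (simp add: diff_divide_distrib[symmetric] abs_divide)
    also have "Bw * (\<bar>y - y'\<bar> / h n) \<le> Bw * Omega CARD('d) h n"
      using dy h0 Bw by (intro mult_left_mono) (auto simp: pos_divide_le_eq mult.commute)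
    finally have vv: "\<bar>?v i - ?v' i\<bar> \<le> Bw * Omega CARD('d) h n" .
    have "\<bar>(?k i - ?k' i) * ?v i\<bar> \<le> (LK * Omega CARD('d) h n) * 1"
      unfolding abs_mult using kk[of i] True primitive_facts(1,2) by (intro mult_mono) auto
    moreover have "\<bar>?k' i * (?v i - ?v' i)\<bar> \<le> BK * (Bw * Omega CARD('d) h n)"
      unfolding abs_mult using KB vv BK by (intro mult_mono) auto
    moreover have "?k i * ?v i - ?k' i * ?v' i = (?k i - ?k' i) * ?v i + ?k' i * (?v i - ?v' i)"
      by (simp add: algebra_simps)
    ultimately have "\<bar>?k i * ?v i - ?k' i * ?v' i\<bar> \<le> LK * Omega CARD('d) h n + BK * (Bw * Omega CARD('d) h n)" by linarith
    then show ?thesis using True by (simp add: L'_def distrib_right)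
  qed (use out in simp)
  have k'b: "\<bar>?k' i\<bar> \<le> BK * ?b i" for i
    using out[of i] KB[of "(x' - X i \<omega>) /\<^sub>R h n"] by (auto simp: indicator_def)
  have inF: "smooth_test n (x', y') \<in> tests n" "kernel_test n (x', y') \<in> tests n" "ball_test n (x', y') \<in> tests n"
    unfolding tests_def using p by auto
  have b: "(\<Sum>i\<in>rect n. ?b i) \<le> Cn * ?s"
  proof -
    have "\<bar>(\<Sum>i\<in>rect n. ?b i) - nhat n * expectation (\<lambda>\<omega>. ball_test n (x', y') (obs 1 \<omega>))\<bar> \<le> \<eta> * (?s * Omega CARD('d) h n)"
      using bspec[OF dev inF(3)] by (simp add: centred_sum_def ball_test_def)
    moreover have "\<eta> * (?s * Omega CARD('d) h n) \<le> \<eta> * (?s * 1)" using \<eta> s0 \<Omega>p by (intro mult_left_mono) auto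
    moreover have "nhat n * expectation (\<lambda>\<omega>. ball_test n (x', y') (obs 1 \<omega>)) \<le> nhat n * (C1 * h n ^ CARD('d))"
    proof (rule mult_left_mono)
      have one: "1 \<in> (pos_index :: (nat ^ 'n) set)" by (simp add: pos_index_def)
      have "(x', y') \<in> S \<times> V" using x'S y'V by simp
      from local_test_tests[OF h0 h\<delta> this, of "ball_test n (x', y')"] one
      have "expectation (\<lambda>\<omega>. \<bar>ball_test n (x', y') (obs 1 \<omega>)\<bar>) \<le> C1 * h n ^ CARD('d)"
        unfolding local_test_def by blast
      then show "expectation (\<lambda>\<omega>. ball_test n (x', y') (obs 1 \<omega>)) \<le> C1 * h n ^ CARD('d)" by (simp add: ball_test_def)
    qed (use nh in simp)
    ultimately have "(\<Sum>i\<in>rect n. ?b i) \<le> \<eta> * (?s * 1) + nhat n * (C1 * h n ^ CARD('d))" by linarith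
    then show ?thesis by (simp add: Cn_def algebra_simps)
  qed
  have d1: "\<bar>(\<Sum>i\<in>rect n. ?k' i * ?v' i) - ?e1\<bar> \<le> a * Omega CARD('d) h n * ?s"
  proof -
    have "\<bar>(\<Sum>i\<in>rect n. ?k' i / BK * ?v' i) - nhat n * expectation (\<lambda>\<omega>. K ((x' - X 1 \<omega>) /\<^sub>R h n) / BK * primitive w ((y' - Y 1 \<omega>) / h n))\<bar> \<le> \<eta> * (?s * Omega CARD('d) h n)"
      using bspec[OF dev inF(1)] by (simp add: centred_sum_def smooth_test_def)
    also have "(\<Sum>i\<in>rect n. ?k' i / BK * ?v' i) = (\<Sum>i\<in>rect n. ?k' i * ?v' i) / BK" by (simp add: sum_divide_distrib)
    also have "nhat n * expectation (\<lambda>\<omega>. K ((x' - X 1 \<omega>) /\<^sub>R h n) / BK * primitive w ((y' - Y 1 \<omega>) / h n)) = ?e1 / BK" by simp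
    finally have "\<bar>(\<Sum>i\<in>rect n. ?k' i * ?v' i) - ?e1\<bar> / BK \<le> \<eta> * (?s * Omega CARD('d) h n)"
      using BK by (simp add: diff_divide_distrib[symmetric] abs_divide)
    then show ?thesis using BK by (simp add: a_def pos_divide_le_eq mult_ac)
  qed
  have d2: "\<bar>(\<Sum>i\<in>rect n. ?k' i) - ?e2\<bar> \<le> a * Omega CARD('d) h n * ?s"
  proof -
    have "\<bar>(\<Sum>i\<in>rect n. ?k' i / BK) - nhat n * expectation (\<lambda>\<omega>. K ((x' - X 1 \<omega>) /\<^sub>R h n) / BK)\<bar> \<le> \<eta> * (?s * Omega CARD('d) h n)"
      using bspec[OF dev inF(2)] by (simp add: centred_sum_def kernel_test_def)
    also have "(\<Sum>i\<in>rect n. ?k' i / BK) = (\<Sum>i\<in>rect n. ?k' i) / BK" by (simp add: sum_divide_distrib)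
    also have "nhat n * expectation (\<lambda>\<omega>. K ((x' - X 1 \<omega>) /\<^sub>R h n) / BK) = ?e2 / BK" by simp
    finally have "\<bar>(\<Sum>i\<in>rect n. ?k' i) - ?e2\<bar> / BK \<le> \<eta> * (?s * Omega CARD('d) h n)"
      using BK by (simp add: diff_divide_distrib[symmetric] abs_divide)
    then show ?thesis using BK by (simp add: a_def pos_divide_le_eq mult_ac)
  qed
  have bi: "\<bar>?e1 - cond_cdf f y' x' * ?e2\<bar> \<le> bias_const * Omega CARD('d) h n * ?s"
  proof -
    let ?E1 = "expectation (\<lambda>\<omega>. K ((x' - X 1 \<omega>) /\<^sub>R h n) * primitive w ((y' - Y 1 \<omega>) / h n))"
    let ?E2 = "expectation (\<lambda>\<omega>. K ((x' - X 1 \<omega>) /\<^sub>R h n))"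
    have "?e1 - cond_cdf f y' x' * ?e2 = nhat n * (?E1 - cond_cdf f y' x' * ?E2)" by (simp add: algebra_simps)
    then have "\<bar>?e1 - cond_cdf f y' x' * ?e2\<bar> = nhat n * \<bar>?E1 - cond_cdf f y' x' * ?E2\<bar>" using nh by (simp add: abs_mult)
    also have "\<dots> \<le> nhat n * (bias_const * h n * h n ^ CARD('d))" using kernel_bias(1)[OF h0 h\<delta> x'S y'V] nh by (intro mult_left_mono) auto
    also have "\<dots> = bias_const * h n * ?s" by simp
    also have "\<dots> \<le> bias_const * Omega CARD('d) h n * ?s" using h\<Omega> a0 s0 by (intro mult_right_mono mult_left_mono) auto
    finally show ?thesis .
  qed
  have cc: "\<bar>cond_cdf f y x - cond_cdf f y' x'\<bar> \<le> (2 * CF) * Omega CARD('d) h n"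
  proof -
    have rh: "?r \<le> h n" "?r \<le> Omega CARD('d) h n" using h0 h1 \<Omega>p by (simp_all add: mult_left_le mult_left_le_one_le)
    have "h n \<le> \<rho> * h n" using \<rho> h0 by simp
    then have "dist x' x \<le> \<delta>" using dx rh h\<delta> by (simp add: dist_commute)
    from near[OF x'S this] y'V have "\<bar>cond_cdf f y x - cond_cdf f y' x'\<bar> \<le> CF * (dist x' x + \<bar>y - y'\<bar>)" by blast
    also have "\<dots> \<le> CF * (Omega CARD('d) h n + Omega CARD('d) h n)" using dx dy rh CF by (intro mult_left_mono add_mono) (auto simp: dist_commute)
    finally show ?thesis by simp
  qed
  have low: "gm * ?s \<le> ?e2"
    using mult_left_mono[OF kernel_bias(2)[OF h0 h\<delta> x'S y'V], of "nhat n"] nh by (simp add: mult_ac)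
  note rd = ratio_deviation[OF kk kv k'b b d1 d2 bi cc cdf_le_1[OF x] cdf_le_1[OF x'S] low small gm s0 \<Omega>p(1) LK a0(3)]
  have B0: "0 \<le> BK" "0 \<le> 2 * CF" using BK CF by auto
  have kpos: "0 < (\<Sum>i\<in>rect n. ?k i)" by (rule rd(1)[OF B0])
  have "F_est K w h X Y n \<omega> y x = (\<Sum>i\<in>rect n. ?k i * ?v i) / (\<Sum>i\<in>rect n. ?k i)"
    by (rule F_est_eq_ratio) (fact h0 nh kpos)+
  then show ?thesis using rd(2)[OF B0] by simp
qed

theorem AE_uniform_rate:
  "AE \<omega> in M. Limsup multi_at_top
     (\<lambda>n. (SUP y\<in>V. SUP x\<in>S. ennreal \<bar>F_est K w h X Y n \<omega> y x - cond_cdf f y x\<bar>) / ennreal (Omega CARD('d) h n)) < \<infinity>"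
proof -
  obtain \<eta> where \<eta>: "0 \<le> \<eta>" and dev: "AE \<omega> in M. eventually (\<lambda>n. \<forall>\<zeta>\<in>tests n.
      \<bar>centred_sum M obs \<zeta> n \<omega>\<bar> \<le> \<eta> * (nhat n * h n ^ CARD('d) * Omega CARD('d) h n)) multi_at_top"
    using AE_tests by (elim exE conjE) (rule that)
  define a where "a = BK * \<eta>"
  define Cn where "Cn = \<eta> + C1"
  define L' where "L' = LK + BK * Bw"
  define Q where "Q = 2 * (L' * Cn + 2 * a + bias_const + 2 * CF * BK * Cn + LK * Cn) / gm"
  have a0: "0 \<le> a" "0 \<le> Cn" "0 \<le> L'" "0 \<le> bias_const" using BK \<eta> C1 LK Bw CF \<rho> Rw by (auto simp: a_def Cn_def L'_def bias_const_def)
  have Q0: "0 \<le> Q" unfolding Q_def using a0 gm CF BK LK by (intro divide_nonneg_pos) auto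
  have \<Omega>small: "eventually (\<lambda>n. Omega CARD('d) h n < gm / (2 * (a + LK * Cn + 1))) multi_at_top"
    using bandwidth_facts(2) by (rule order_tendstoD) (use gm a0 LK in \<open>auto intro!: divide_pos_pos add_nonneg_pos\<close>)
  show ?thesis
    using dev
  proof (rule AE_mp, intro AE_I2 impI)
    fix \<omega> assume "eventually (\<lambda>n. \<forall>\<zeta>\<in>tests n.
      \<bar>centred_sum M obs \<zeta> n \<omega>\<bar> \<le> \<eta> * (nhat n * h n ^ CARD('d) * Omega CARD('d) h n)) multi_at_top"
    then have "eventually (\<lambda>n. (SUP y\<in>V. SUP x\<in>S. ennreal \<bar>F_est K w h X Y n \<omega> y x - cond_cdf f y x\<bar>)
              / ennreal (Omega CARD('d) h n) \<le> ennreal Q) multi_at_top"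
      using eventually_good \<Omega>small
    proof eventually_elim
      case (elim n)
      have \<Omega>p: "0 < Omega CARD('d) h n" using elim(2) by (simp add: good_def)
      have small: "(a + LK * Cn) * Omega CARD('d) h n \<le> gm / 2"
      proof -
        have "0 < 2 * (a + LK * Cn + 1)" using a0 LK by (simp add: add_nonneg_pos)
        then have "Omega CARD('d) h n * (2 * (a + LK * Cn + 1)) < gm" using elim(3) by (simp only: pos_less_divide_eq)
        then show ?thesis using \<Omega>p by (simp add: algebra_simps)
      qed
      have est: "\<bar>F_est K w h X Y n \<omega> y x - cond_cdf f y x\<bar> \<le> Q * Omega CARD('d) h n" if "x \<in> S" "y \<in> V" for x y
        using estimator_deviation[OF \<eta> elim(2,1) small[unfolded a_def Cn_def] that]
        unfolding Q_def a_def Cn_def L'_def .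
      have "(SUP y\<in>V. SUP x\<in>S. ennreal \<bar>F_est K w h X Y n \<omega> y x - cond_cdf f y x\<bar>) \<le> ennreal (Q * Omega CARD('d) h n)"
        by (intro SUP_least ennreal_leI est)
      then have "(SUP y\<in>V. SUP x\<in>S. ennreal \<bar>F_est K w h X Y n \<omega> y x - cond_cdf f y x\<bar>) / ennreal (Omega CARD('d) h n) \<le> ennreal (Q * Omega CARD('d) h n) / ennreal (Omega CARD('d) h n)"
        by (rule divide_right_mono_ennreal)
      also have "\<dots> = ennreal Q" using Q0 \<Omega>p by (subst divide_ennreal) auto
      finally show ?case .
    qed
    then have "Limsup multi_at_top (\<lambda>n. (SUP y\<in>V. SUP x\<in>S. ennreal \<bar>F_est K w h X Y n \<omega> y x - cond_cdf f y x\<bar>) / ennreal (Omega CARD('d) h n)) \<le> ennreal Q"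
      by (rule Limsup_bounded)
    also have "\<dots> < \<infinity>" by simp
    finally show "Limsup multi_at_top (\<lambda>n. (SUP y\<in>V. SUP x\<in>S. ennreal \<bar>F_est K w h X Y n \<omega> y x - cond_cdf f y x\<bar>) / ennreal (Omega CARD('d) h n)) < \<infinity>" .
  qed
qed

end

theorem theorem1:
  fixes M :: "'a measure"
    and X :: "nat ^ 'n::finite \<Rightarrow> 'a \<Rightarrow> real ^ 'd::finite"
    and Y :: "nat ^ 'n \<Rightarrow> 'a \<Rightarrow> real"
    and f :: "(real ^ 'd) \<times> real \<Rightarrow> real"
    and g :: "real ^ 'd \<Rightarrow> real"
    and h :: "nat ^ 'n \<Rightarrow> real"
    and K :: "real ^ 'd \<Rightarrow> real" and w :: "real \<Rightarrow> real"
    and \<phi> :: "nat \<Rightarrow> nat \<Rightarrow> real" and chi :: "real \<Rightarrow> real"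
    and \<beta> \<epsilon> p \<mu> :: real and x0 :: "real ^ 'd"
    and S :: "(real ^ 'd) set" and V :: "real set"
  assumes prob: "prob_space M"
    and f_nonneg: "\<forall>z. 0 \<le> f z"
    and law: "\<forall>i\<in>pos_index. distributed M lborel (\<lambda>\<omega>. (X i \<omega>, Y i \<omega>)) (\<lambda>z. ennreal (f z))"
    and g_marginal: "g = marginal_density f"
    and stationary: "strictly_stationary M (\<lambda>i \<omega>. (X i \<omega>, Y i \<omega>))"
    and chi_nonneg: "\<forall>t\<ge>0. 0 \<le> chi t"
    and chi_decr: "\<forall>s t. 0 \<le> s \<and> s \<le> t \<longrightarrow> chi t \<le> chi s"
    and chi_lim: "(chi \<longlongrightarrow> 0) at_top"
    and \<phi>_nonneg: "\<forall>n m. 0 \<le> \<phi> n m"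
    and \<phi>_sym: "\<forall>n m. \<phi> n m = \<phi> m n"
    and \<phi>_mono: "\<forall>n n' m m'. n \<le> n' \<and> m \<le> m' \<longrightarrow> \<phi> n m \<le> \<phi> n' m'"
    and mixing: "mixing_field M (\<lambda>i \<omega>. (X i \<omega>, Y i \<omega>)) \<phi> chi"
    and \<beta>_pos: "\<beta> > 0"
    and chi_rate: "chi \<in> O[at_top](\<lambda>t. t powr (- \<beta>))"
    and h_pos: "\<forall>n\<in>pos_index. h n > 0"
    and h_lim: "(h \<longlongrightarrow> 0) multi_at_top"
    and \<epsilon>_pos: "\<epsilon> > 0"
    and S_compact: "compact S"
    and p: "0 < p" "p < 1"
    and x0: "g x0 > 0"
    and quantile: "cond_cdf f \<mu> x0 = p"
    and V_compact: "compact V"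
    and V_nbhd: "\<mu> \<in> interior V"
    and V_range: "\<forall>y\<in>V. lower_end f x0 \<le> ereal y \<and> ereal y \<le> upper_end f x0"
    and f_cont: "continuous_on UNIV f"
    and g_cont: "continuous_on UNIV g"
    and g_lipschitz: "lipschitz_fun g"
    and g_pos: "\<forall>x\<in>S. g x > 0"
    and joint: "\<exists>D\<ge>0. \<exists>c\<ge>0. \<forall>i\<in>pos_index. \<forall>j\<in>pos_index. dist (lattice_point i) (lattice_point j) > D \<longrightarrow>
        (\<exists>gij. (\<forall>u v. 0 \<le> gij (u, v)) \<and>
           distributed M lborel (\<lambda>\<omega>. (X i \<omega>, X j \<omega>)) (\<lambda>z. ennreal (gij z)) \<and>
           (\<forall>u v. \<bar>gij (u, v) - g u * g v\<bar> \<le> c)) \<and>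
        (\<exists>fij. (\<forall>s t. 0 \<le> fij (s, t)) \<and>
           distributed M lborel (\<lambda>\<omega>. ((X i \<omega>, Y i \<omega>), (X j \<omega>, Y j \<omega>))) (\<lambda>z. ennreal (fij z)) \<and>
           (\<forall>s t. \<bar>fij (s, t) - f s * f t\<bar> \<le> c))"
    and f_partials: "\<forall>i j l. i + j \<le> 2 \<longrightarrow>
        has_iter_partial dir_y j f \<and>
        has_iter_partial (dir_x l) i ((partial dir_y ^^ j) f) \<and>
        bounded (range ((partial (dir_x l) ^^ i) ((partial dir_y ^^ j) f))) \<and>
        integrable lborel ((partial (dir_x l) ^^ i) ((partial dir_y ^^ j) f))"
    and F_partials_x: "\<forall>k l.
        has_partial_on {(x, y). g x > 0} (dir_x l) (\<lambda>(x, y). cond_cdf f y x) \<and>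
        has_partial_on {(x, y). g x > 0} (dir_x k)
          (partial (dir_x l) (\<lambda>(x, y). cond_cdf f y x)) \<and>
        continuous_on {(x, y). g x > 0}
          (partial (dir_x k) (partial (dir_x l) (\<lambda>(x, y). cond_cdf f y x)))"
    and F_partials_y:
        "has_partial_on {(x, y). g x > 0} dir_y (\<lambda>(x, y). cond_cdf f y x) \<and>
        has_partial_on {(x, y). g x > 0} dir_y (partial dir_y (\<lambda>(x, y). cond_cdf f y x)) \<and>
        continuous_on {(x, y). g x > 0}
          (partial dir_y (partial dir_y (\<lambda>(x, y). cond_cdf f y x)))"
    and K: "prob_density K" "\<forall>s. K (- s) = K s" "lipschitz_fun K" "compact_support K"
        "integrable lborel (\<lambda>s. (norm s)\<^sup>2 * K s)"
    and w: "prob_density w" "\<forall>t. w (- t) = w t" "lipschitz_fun w" "compact_support w"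
    and h_upper: "((\<lambda>n. nhat n * h n ^ (CARD('d) + 2) / ln (nhat n)) \<longlongrightarrow> 0) multi_at_top"
    and h_lower: "bandwidth_cond_a CARD('d) \<phi> \<beta> \<epsilon> h \<or> bandwidth_cond_b CARD('d) \<phi> \<beta> \<epsilon> h"
  shows "AE \<omega> in M.
      Limsup multi_at_top
        (\<lambda>n. (SUP y\<in>V. SUP x\<in>S. ennreal \<bar>F_est K w h X Y n \<omega> y x - cond_cdf f y x\<bar>)
              / ennreal (Omega CARD('d) h n)) < \<infinity>"
proof -
  interpret prob_space M by (rule prob)
  have fm: "f \<in> borel_measurable borel" using f_cont by (rule borel_measurable_continuous_onI)
  obtain Bf where Bf: "\<And>z. f z \<le> Bf"
  proof -
    have "bounded (range f)" using f_partials[rule_format, of 0 0 undefined] by simp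
    then obtain B where "\<forall>u\<in>range f. norm u \<le> B" unfolding bounded_iff by blast
    from this[rule_format, OF rangeI] have "\<bar>f z\<bar> \<le> B" for z by simp
    then have "f z \<le> B" for z by (rule abs_le_D1)
    then show thesis by (rule that)
  qed
  obtain RK BK LK where RK: "0 < RK" and BK: "0 < BK" and LK: "0 \<le> LK" and K0: "\<And>s. RK \<le> norm s \<Longrightarrow> K s = 0"
    and KB: "\<And>s. \<bar>K s\<bar> \<le> BK" and KL: "\<And>s t. \<bar>K s - K t\<bar> \<le> LK * dist s t"
    by (rule kernel_bounds[OF K(3,4)]) (rule that)
  obtain Rw Bw Lw where Rw: "0 < Rw" and Bw: "0 < Bw" and w0: "\<And>s. Rw \<le> norm s \<Longrightarrow> w s = 0" and wB: "\<And>s. \<bar>w s\<bar> \<le> Bw"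
    by (rule kernel_bounds[OF w(3,4)]) (rule that)
  obtain D c where c: "0 \<le> c" and joint': "\<forall>i\<in>pos_index. \<forall>j\<in>pos_index. dist (lattice_point i) (lattice_point j) > D \<longrightarrow>
        (\<exists>gij. (\<forall>u v. 0 \<le> gij (u, v)) \<and>
           distributed M lborel (\<lambda>\<omega>. (X i \<omega>, X j \<omega>)) (\<lambda>z. ennreal (gij z)) \<and>
           (\<forall>u v. \<bar>gij (u, v) - marginal_density f u * marginal_density f v\<bar> \<le> c))"
    using joint[unfolded g_marginal]
  proof (elim exE conjE)
    fix D c :: real
    assume "0 \<le> c"
    assume J: "\<forall>i\<in>pos_index. \<forall>j\<in>pos_index. dist (lattice_point i) (lattice_point j) > D \<longrightarrow>
        (\<exists>gij. (\<forall>u v. 0 \<le> gij (u, v)) \<and>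
           distributed M lborel (\<lambda>\<omega>. (X i \<omega>, X j \<omega>)) (\<lambda>z. ennreal (gij z)) \<and>
           (\<forall>u v. \<bar>gij (u, v) - marginal_density f u * marginal_density f v\<bar> \<le> c)) \<and>
        (\<exists>fij. (\<forall>s t. 0 \<le> fij (s, t)) \<and>
           distributed M lborel (\<lambda>\<omega>. ((X i \<omega>, Y i \<omega>), (X j \<omega>, Y j \<omega>))) (\<lambda>z. ennreal (fij z)) \<and>
           (\<forall>s t. \<bar>fij (s, t) - f s * f t\<bar> \<le> c))"
    show thesis
      by (rule that[OF \<open>0 \<le> c\<close>], intro ballI impI, rule J[rule_format, THEN conjunct1])
  qed
  note F_partials = F_partials_x[unfolded g_marginal, rule_format]
  obtain \<delta> CF gm gM where \<delta>: "0 < \<delta>" and CF: "0 \<le> CF" and gm: "0 < gm" and gM: "0 < gM"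
    and near': "\<forall>x\<in>S. \<forall>s. dist x s \<le> \<delta> \<longrightarrow> gm \<le> marginal_density f s \<and> marginal_density f s \<le> gM \<and>
        (\<forall>y\<in>V. \<forall>y'. \<bar>cond_cdf f y' s - cond_cdf f y x\<bar> \<le> CF * (dist x s + \<bar>y' - y\<bar>))"
    using cond_cdf_lipschitz_near_compact[OF f_nonneg Bf g_cont[unfolded g_marginal] g_pos[unfolded g_marginal] S_compact V_compact
        F_partials[THEN conjunct1] F_partials[THEN conjunct2, THEN conjunct1] F_partials[THEN conjunct2, THEN conjunct2]]
    by (elim exE conjE) (rule that[rotated 4])
  obtain Cc T where rate: "\<And>t. T \<le> t \<Longrightarrow> chi t \<le> Cc * t powr (- \<beta>)"
  proof -
    obtain Cc where "eventually (\<lambda>t. norm (chi t) \<le> Cc * norm (t powr (- \<beta>))) at_top"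
      using chi_rate by (elim landau_o.bigE)
    then obtain T where T: "\<And>t. T \<le> t \<Longrightarrow> norm (chi t) \<le> Cc * norm (t powr (- \<beta>))"
      unfolding eventually_at_top_linorder by blast
    have "chi t \<le> Cc * t powr (- \<beta>)" if "T \<le> t" for t using T[OF that] by simp
    then show thesis by (rule that)
  qed
  have Zm: "random_variable borel (\<lambda>\<omega>. (X i \<omega>, Y i \<omega>))" if "i \<in> pos_index" for i
    using distributed_measurable[OF law[rule_format, OF that]] by simp
  have SV: "bounded (S \<times> V)" using S_compact V_compact by (intro compact_imp_bounded compact_Times)
  have w0': "\<forall>z. Rw \<le> norm z \<longrightarrow> w z = 0" using w0 by simp
  have F1: "\<bar>cond_cdf f y x\<bar> \<le> 1" if "x \<in> S" for x y
    using cond_cdf_bounds[OF f_nonneg, of x y] g_pos that unfolding g_marginal by auto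
  interpret kernel_cdf_estimation M X Y \<phi> chi \<beta> Cc T f K w h S V \<epsilon> D c \<delta> CF gm gM RK BK LK Rw Bw
      "(gM + c + 1) * (unit_ball_vol (real CARD('d)) * (RK + 1) ^ CARD('d))"
    by (unfold_locales; fact mixing \<phi>_nonneg chi_nonneg chi_decr Zm rate law f_nonneg fm c joint' SV \<delta> CF gm gM near'
      K(1) RK BK LK K0 KB KL w(1) Rw Bw w0' wB \<epsilon>_pos h_pos h_lim h_upper h_lower F1 refl)
  show ?thesis by (rule AE_uniform_rate)
qed

end
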